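(* There are universal constants $c_1,c_2>0$ such that the following holds for all $M,K,R\ge1$. For any $H,B,\sigma,\gamma>0$, there exists, in any dimension $$D\ge c_1\left(KR+\left(\frac{\gamma^2KR}{B^2}+\frac{H^2\gamma^2KR\Big(\frac{\sqrt\sigma KR}{\sqrt{HB}}+MKR\Big)}{\sigma^2}\right)\log(MK^2R^2)\right),$$ a function $F_0\in\mathcal{F}_0(H,B)$ on $\mathbb{R}^D$ (with a stochastic gradient oracle $\mathcal{O}_g^\sigma$ for $F_0$) such that the output $\hat x$ of any algorithm in $\mathcal{A}^\gamma(\mathcal{G}_{\mathrm{I.C.}},\mathcal{O}_g^\sigma)$ will have suboptimality at least $$\mathbb{E}F_0(\hat x)-F_0^*\ge c_2\left(\frac{HB^2}{K^2R^2}+\min\left\{\frac{\sigma B}{\sqrt{MKR}},HB^2\right\}+\min\left\{\frac{\sigma B}{\sqrt{KR}},\frac{HB^2}{R^2(1+\log M)^2}\right\}\right).$$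
   Context: $\mathcal{F}_0(H,B)$: convex, $H$-smooth (gradient $H$-Lipschitz) functions $F:\mathbb{R}^d\to\mathbb{R}$ with a minimizer $x^*$, $\|x^*\|\le B$. $F^*=\min F$. Oracle $\mathcal{O}_g^\sigma$ for $F$: when queried at $x$ it returns a random vector with mean $\nabla F(x)$ and $\mathbb{E}\|\mathcal{O}_g^\sigma(x)-\nabla F(x)\|^2\le\sigma^2$, which, given $x$, is independent of the algorithm's state and of all other oracle interactions. Intermittent communication setting: $M$ machines, $R$ rounds, $K$ oracle queries per machine per round. A (possibly randomized) algorithm has a random seed $\xi$ independent of the oracle and is given by measurable rules: the $k$-th query $x^m_{k,r}\in\mathbb{R}^D$ of machine $m$ in round $r$ is a function of $\xi$ and of all (query, oracle answer) pairs at indices $(m,k',r)$ with $k'<k$ and $(m',k',r')$ with $r'<r$ ($m'\in[M],k'\in[K]$ arbitrary); the output $\hat x$ is a function of $\xi$ and all $MKR$ (query, answer) pairs. $\mathcal{A}^\gamma(\mathcal{G}_{\mathrm{I.C.}},\mathcal{O}_g^\sigma)$ is the class of such algorithms all of whose queries satisfy $\|x^m_{k,r}\|\le\gamma$.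
   Formalization: The hard function and its oracle are chosen after the algorithm (for every algorithm there is an F_0), since for a fixed F_0 the algorithm that outputs its minimizer has suboptimality 0; the random seed is taken to be a sequence of reals. *)

theory Defs
  imports "HOL-Probability.Probability"
begin

text \<open>
  The dimension \<open>D\<close> is quantified inside the statement (below the universal constants), so it
  cannot be a type.  Vectors of \<open>\<real>\<^sup>D\<close> are the elements of \<open>space (Rn D)\<close>, i.e.\ the functions on
  \<open>{..<D}\<close> extended by \<^const>\<open>undefined\<close>; \<open>Rn D\<close> carries the Borel sigma-algebra and the Euclidean
  norm of \<open>x\<close> is \<open>L2_set x {..<D}\<close>.
\<close>

type_synonym rvec = "nat \<Rightarrow> real"

abbreviation Rn :: "nat \<Rightarrow> rvec measure" where
  "Rn D \<equiv> PiM {..<D} (\<lambda>_. borel)"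

abbreviation vnorm :: "nat \<Rightarrow> rvec \<Rightarrow> real" where
  "vnorm D x \<equiv> L2_set x {..<D}"

abbreviation vdist :: "nat \<Rightarrow> rvec \<Rightarrow> rvec \<Rightarrow> real" where
  "vdist D x y \<equiv> L2_set (\<lambda>i. x i - y i) {..<D}"

subsection \<open>The function class\<close>

definition convex_fun :: "nat \<Rightarrow> (rvec \<Rightarrow> real) \<Rightarrow> bool" where
  "convex_fun D F \<longleftrightarrow>
     (\<forall>x\<in>space (Rn D). \<forall>y\<in>space (Rn D). \<forall>t\<in>{0..1}.
        F (\<lambda>i\<in>{..<D}. (1 - t) * x i + t * y i) \<le> (1 - t) * F x + t * F y)"

text \<open>Frechet differentiability at \<open>x\<close> with gradient \<open>v\<close>.\<close>

definition has_gradient :: "nat \<Rightarrow> (rvec \<Rightarrow> real) \<Rightarrow> rvec \<Rightarrow> rvec \<Rightarrow> bool" where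
  "has_gradient D F x v \<longleftrightarrow> v \<in> space (Rn D) \<and>
     (\<forall>e>0. \<exists>d>0. \<forall>y\<in>space (Rn D). vdist D y x < d \<longrightarrow>
        \<bar>F y - F x - (\<Sum>i<D. v i * (y i - x i))\<bar> \<le> e * vdist D y x)"

definition smooth_fun :: "nat \<Rightarrow> real \<Rightarrow> (rvec \<Rightarrow> real) \<Rightarrow> bool" where
  "smooth_fun D H F \<longleftrightarrow>
     (\<exists>g. (\<forall>x\<in>space (Rn D). has_gradient D F x (g x)) \<and>
          (\<forall>x\<in>space (Rn D). \<forall>y\<in>space (Rn D). vdist D (g x) (g y) \<le> H * vdist D x y))"

definition F0_class :: "nat \<Rightarrow> real \<Rightarrow> real \<Rightarrow> (rvec \<Rightarrow> real) set" where
  "F0_class D H B = {F. convex_fun D F \<and> smooth_fun D H F \<and>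
     (\<exists>xs\<in>space (Rn D). vnorm D xs \<le> B \<and> (\<forall>x\<in>space (Rn D). F xs \<le> F x))}"

definition min_value :: "nat \<Rightarrow> (rvec \<Rightarrow> real) \<Rightarrow> real" where
  "min_value D F = (INF x\<in>space (Rn D). F x)"

subsection \<open>Stochastic gradient oracles\<close>

text \<open>
  An oracle is a Markov kernel: \<open>Orc x\<close> is the law of the answer to the query \<open>x\<close>.
\<close>

definition sg_oracle :: "nat \<Rightarrow> (rvec \<Rightarrow> real) \<Rightarrow> real \<Rightarrow> (rvec \<Rightarrow> rvec measure) \<Rightarrow> bool" where
  "sg_oracle D F \<sigma> Orc \<longleftrightarrow>
     Orc \<in> Rn D \<rightarrow>\<^sub>M prob_algebra (Rn D) \<and>
     (\<forall>x\<in>space (Rn D). \<exists>v. has_gradient D F x v \<and>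
        (\<forall>i<D. integrable (Orc x) (\<lambda>g. g i) \<and> (\<integral>g. g i \<partial>Orc x) = v i) \<and>
        (\<integral>\<^sup>+g. ennreal ((vdist D g v)\<^sup>2) \<partial>Orc x) \<le> ennreal (\<sigma>\<^sup>2))"

subsection \<open>Intermittent communication\<close>

text \<open>
  The index \<open>(m, k, r)\<close> stands for the \<open>k\<close>-th query of machine \<open>m\<close> in round \<open>r\<close>, all counted from
  \<open>0\<close>.  A transcript maps indices to (query, answer) pairs.
\<close>

type_synonym qindex = "nat \<times> nat \<times> nat"
type_synonym transcript = "qindex \<Rightarrow> rvec \<times> rvec"

definition indices :: "nat \<Rightarrow> nat \<Rightarrow> nat \<Rightarrow> qindex set" where
  "indices M K R = {..<M} \<times> {..<K} \<times> {..<R}"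

fun past :: "nat \<Rightarrow> nat \<Rightarrow> qindex \<Rightarrow> qindex set" where
  "past M K (m, k, r) = {(m, k', r) |k'. k' < k} \<union> {(m', k', r') |m' k' r'. m' < M \<and> k' < K \<and> r' < r}"

abbreviation transcripts :: "nat \<Rightarrow> qindex set \<Rightarrow> transcript measure" where
  "transcripts D I \<equiv> PiM I (\<lambda>_. Rn D \<Otimes>\<^sub>M Rn D)"

text \<open>
  \<open>S\<close> is the law of the seed, \<open>Q i\<close> the rule for the query with index \<open>i\<close>, \<open>X\<close> the rule for the output.
\<close>

definition ic_algorithm ::
  "nat \<Rightarrow> nat \<Rightarrow> nat \<Rightarrow> nat \<Rightarrow> 's measure \<Rightarrow> (qindex \<Rightarrow> 's \<times> transcript \<Rightarrow> rvec) \<Rightarrow>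
   ('s \<times> transcript \<Rightarrow> rvec) \<Rightarrow> bool" where
  "ic_algorithm D M K R S Q X \<longleftrightarrow>
     prob_space S \<and>
     (\<forall>i\<in>indices M K R. Q i \<in> S \<Otimes>\<^sub>M transcripts D (past M K i) \<rightarrow>\<^sub>M Rn D) \<and>
     X \<in> S \<Otimes>\<^sub>M transcripts D (indices M K R) \<rightarrow>\<^sub>M Rn D"

text \<open>
  The law of seed and full transcript.  Drawing each answer from the kernel, given everything that
  has happened before, makes it independent of the rest given its query.  The queries are run
  through by round, then by \<open>k\<close>, then by machine; this order extends the order given by
  \<^const>\<open>past\<close>, and the resulting law is the same for every such order.
\<close>

definition query_order :: "nat \<Rightarrow> nat \<Rightarrow> nat \<Rightarrow> qindex list" where
  "query_order M K R = [(m, k, r). r \<leftarrow> [0..<R], k \<leftarrow> [0..<K], m \<leftarrow> [0..<M]]"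

primrec play ::
  "nat \<Rightarrow> nat \<Rightarrow> ('s \<times> transcript) measure \<Rightarrow> (qindex \<Rightarrow> 's \<times> transcript \<Rightarrow> rvec) \<Rightarrow>
   (rvec \<Rightarrow> rvec measure) \<Rightarrow> qindex list \<Rightarrow> 's \<Rightarrow> transcript \<Rightarrow> ('s \<times> transcript) measure" where
  "play M K N Q Orc [] \<xi> h = return N (\<xi>, h)"
| "play M K N Q Orc (i # is) \<xi> h =
     (let x = Q i (\<xi>, restrict h (past M K i))
      in Orc x \<bind> (\<lambda>g. play M K N Q Orc is \<xi> (h(i := (x, g)))))"

definition run_law ::
  "nat \<Rightarrow> nat \<Rightarrow> nat \<Rightarrow> nat \<Rightarrow> 's measure \<Rightarrow> (qindex \<Rightarrow> 's \<times> transcript \<Rightarrow> rvec) \<Rightarrow>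
   (rvec \<Rightarrow> rvec measure) \<Rightarrow> ('s \<times> transcript) measure" where
  "run_law D M K R S Q Orc =
     S \<bind> (\<lambda>\<xi>. play M K (S \<Otimes>\<^sub>M transcripts D (indices M K R)) Q Orc
                  (query_order M K R) \<xi> (\<lambda>_. undefined))"

text \<open>
  The query bound is only required almost surely, on every admissible problem instance, which includes
  the algorithms whose rules are bounded by \<open>\<gamma>\<close> everywhere.  Conversely, projecting the rules onto
  the \<open>\<gamma>\<close>-ball does not change the run on any such instance.
\<close>

definition queries_bounded ::
  "nat \<Rightarrow> nat \<Rightarrow> nat \<Rightarrow> nat \<Rightarrow> real \<Rightarrow> real \<Rightarrow> real \<Rightarrow> real \<Rightarrow> 's measure \<Rightarrow>
   (qindex \<Rightarrow> 's \<times> transcript \<Rightarrow> rvec) \<Rightarrow> bool" where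
  "queries_bounded D M K R H B \<sigma> \<gamma> S Q \<longleftrightarrow>
     (\<forall>F\<in>F0_class D H B. \<forall>Orc. sg_oracle D F \<sigma> Orc \<longrightarrow>
        (AE p in run_law D M K R S Q Orc.
           \<forall>i\<in>indices M K R. vnorm D (fst (snd p i)) \<le> \<gamma>))"

text \<open>
  \<open>F X - min_value D F\<close> is nonnegative but need not be integrable, hence the extended expectation.
\<close>

definition expected_suboptimality ::
  "nat \<Rightarrow> nat \<Rightarrow> nat \<Rightarrow> nat \<Rightarrow> 's measure \<Rightarrow> (qindex \<Rightarrow> 's \<times> transcript \<Rightarrow> rvec) \<Rightarrow>
   ('s \<times> transcript \<Rightarrow> rvec) \<Rightarrow> (rvec \<Rightarrow> rvec measure) \<Rightarrow> (rvec \<Rightarrow> real) \<Rightarrow> ennreal" where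
  "expected_suboptimality D M K R S Q X Orc F =
     (\<integral>\<^sup>+p. ennreal (F (X p) - min_value D F) \<partial>run_law D M K R S Q Orc)"

subsection \<open>Well-formedness of the interaction law\<close>

lemma play_measurable:
  fixes S :: "'s measure"
  assumes O: "Orc \<in> Rn D \<rightarrow>\<^sub>M prob_algebra (Rn D)"
  and Q: "\<And>i. i \<in> set is \<Longrightarrow> Q i \<in> S \<Otimes>\<^sub>M transcripts D (past M K i) \<rightarrow>\<^sub>M Rn D"
  and ord: "\<And>as i bs. is = as @ i # bs \<Longrightarrow> past M K i \<subseteq> J \<union> set as"
  and I: "J \<union> set is = I"
  and N: "N = S \<Otimes>\<^sub>M transcripts D I"
  shows "(\<lambda>p. play M K N Q Orc is (fst p) (snd p)) \<in> S \<Otimes>\<^sub>M transcripts D J \<rightarrow>\<^sub>M prob_algebra N"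
  using Q ord I
proof (induction "is" arbitrary: J)
  case Nil
  then show ?case using N by (auto intro!: measurable_return_prob_space)
next
  case (Cons i "is")
  let ?P = "S \<Otimes>\<^sub>M transcripts D J"
  have pJ: "past M K i \<subseteq> J" using Cons.prems(2)[of "[]" i "is"] by simp
  have r: "(\<lambda>p. (fst p, restrict (snd p) (past M K i))) \<in> ?P \<rightarrow>\<^sub>M S \<Otimes>\<^sub>M transcripts D (past M K i)"
    using pJ by (intro measurable_Pair measurable_compose[OF measurable_snd measurable_restrict_subset]) auto
  have x: "(\<lambda>p. Q i (fst p, restrict (snd p) (past M K i))) \<in> ?P \<rightarrow>\<^sub>M Rn D"
    using measurable_compose[OF r Cons.prems(1)[of i]] by simp
  have IH: "(\<lambda>p. play M K N Q Orc is (fst p) (snd p)) \<in> S \<Otimes>\<^sub>M transcripts D (insert i J) \<rightarrow>\<^sub>M prob_algebra N"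
  proof (rule Cons.IH)
    show "\<And>as ia bs. is = as @ ia # bs \<Longrightarrow> past M K ia \<subseteq> insert i J \<union> set as"
      using Cons.prems(2)[of "i # _"] by auto
  qed (use Cons.prems in auto)
  have u: "(\<lambda>z. (fst (fst z), (snd (fst z))(i := (Q i (fst (fst z), restrict (snd (fst z)) (past M K i)), snd z))))
     \<in> ?P \<Otimes>\<^sub>M Rn D \<rightarrow>\<^sub>M S \<Otimes>\<^sub>M transcripts D (insert i J)"
    by (intro measurable_Pair measurable_fun_upd[where J = J]
        measurable_compose[OF measurable_fst x]) auto
  show ?case
    unfolding play.simps Let_def
    apply (rule measurable_bind_prob_space2[where N = "Rn D"])
    apply (rule measurable_compose[OF x O])
    using measurable_compose[OF u IH] by (simp add: case_prod_beta')
qed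

lemma set_order: "set (query_order M K R) = indices M K R"
  by (auto simp: query_order_def indices_def image_iff)

lemma sorted_order:
  "sorted_wrt (\<lambda>(m, k, r) (m', k', r'). r < r' \<or> r = r' \<and> (k < k' \<or> k = k' \<and> m < m')) (query_order M K R)"
  (is "sorted_wrt ?L _")
proof (induction R)
  case (Suc R)
  have "sorted_wrt ?L [(m, k, R). k \<leftarrow> [0..<K], m \<leftarrow> [0..<M]]"
  proof (induction K)
    case (Suc K)
    have "sorted_wrt ?L [(m, K, R). m \<leftarrow> [0..<M]]"
      by (induction M) (auto simp: sorted_wrt_append)
    then show ?case using Suc by (auto simp: sorted_wrt_append)
  qed simp
  moreover have "query_order M K (Suc R) = query_order M K R @ [(m, k, R). k \<leftarrow> [0..<K], m \<leftarrow> [0..<M]]"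
    by (simp add: query_order_def)
  ultimately show ?case using Suc by (auto simp: sorted_wrt_append set_order indices_def)
qed (simp add: query_order_def)

lemma past_order:
  assumes "query_order M K R = as @ i # bs"
  shows "past M K i \<subseteq> set as"
proof
  fix j assume j: "j \<in> past M K i"
  obtain m k r where i: "i = (m, k, r)" by (cases i)
  have "i \<in> indices M K R" using set_order[of M K R] assms by auto
  then have "j \<in> indices M K R" using j by (auto simp: i indices_def)
  then have "j \<in> set as \<union> {i} \<union> set bs" using set_order[of M K R] assms by auto
  moreover have "j \<noteq> i" using j by (auto simp: i)
  moreover have "j \<notin> set bs"
    using sorted_order[of M K R] j unfolding assms by (auto simp: i sorted_wrt_append)
  ultimately show "j \<in> set as" by auto
qed

lemma run_law_in_prob_algebra:
  assumes "ic_algorithm D M K R S Q X" "sg_oracle D F \<sigma> Orc"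
  shows "run_law D M K R S Q Orc \<in> space (prob_algebra (S \<Otimes>\<^sub>M transcripts D (indices M K R)))"
proof -
  let ?N = "S \<Otimes>\<^sub>M transcripts D (indices M K R)"
  have a: "(\<lambda>p. play M K ?N Q Orc (query_order M K R) (fst p) (snd p)) \<in> S \<Otimes>\<^sub>M transcripts D {} \<rightarrow>\<^sub>M prob_algebra ?N"
    by (rule play_measurable) (use assms past_order[of M K R] set_order[of M K R] in \<open>auto simp: ic_algorithm_def sg_oracle_def\<close>)
  have b: "(\<lambda>\<xi>. (\<xi>, \<lambda>_. undefined)) \<in> S \<rightarrow>\<^sub>M S \<Otimes>\<^sub>M transcripts D {}"
    by (auto intro!: measurable_Pair simp: space_PiM)
  have c: "(\<lambda>\<xi>. play M K ?N Q Orc (query_order M K R) \<xi> (\<lambda>_. undefined)) \<in> S \<rightarrow>\<^sub>M prob_algebra ?N"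
    using measurable_compose[OF b a] by simp
  have S: "S \<in> space (prob_algebra S)" using assms(1) by (simp add: ic_algorithm_def space_prob_algebra)
  have "(\<lambda>_::unit. S \<bind> (\<lambda>\<xi>. play M K ?N Q Orc (query_order M K R) \<xi> (\<lambda>_. undefined))) \<in> count_space UNIV \<rightarrow>\<^sub>M prob_algebra ?N"
    by (rule measurable_bind_prob_space[OF _ c]) (use S in simp)
  from measurable_space[OF this, of "()"] show ?thesis by (simp add: run_law_def)
qed

text \<open>
  No single function is hard for all algorithms: the algorithm that outputs a minimizer of \<open>F\<close> without
  using the oracle has suboptimality \<open>0\<close> on \<open>F\<close>.  In the lower bound the hard function is therefore
  chosen after the algorithm.
\<close>

lemma oblivious_algorithm_optimal:
  assumes F: "F \<in> F0_class D H B" and "\<gamma> > 0" and b: "b > 0" and S: "prob_space (S::'s measure)"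
  shows "\<exists>Q X. ic_algorithm D M K R S Q X \<and> (\<forall>i p. vnorm D (Q i p) \<le> \<gamma>) \<and>
     expected_suboptimality D M K R S Q X Orc F < ennreal b"
proof -
  obtain xs where xs: "xs \<in> space (Rn D)" "\<forall>x\<in>space (Rn D). F xs \<le> F x" using F by (auto simp: F0_class_def)
  have "min_value D F = F xs" unfolding min_value_def
    by (rule cInf_eq_minimum) (use xs in auto)
  moreover have "(\<lambda>i\<in>{..<D}. 0::real) \<in> space (Rn D)" by (simp add: space_PiM)
  moreover have "vnorm D (\<lambda>i\<in>{..<D}. 0::real) = 0" by (simp add: L2_set_def)
  ultimately show ?thesis using xs S assms
    by (intro exI[of _ "\<lambda>_ _. (\<lambda>i\<in>{..<D}. 0)"] exI[of _ "\<lambda>_. xs"])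
      (auto simp: ic_algorithm_def expected_suboptimality_def)
qed

end

theory Submission
  imports Defs
begin

text \<open>
  The hard functions are chains \<open>F \<epsilon> x = h * (\<Sum>j<N. hinge \<delta> (\<delta> - (y j - y (Suc j))))\<close> with \<open>y N = 0\<close>, where
  \<open>y j\<close> is the inner product of \<open>x\<close> with a random sign vector \<open>\<epsilon>\<close> on the \<open>j\<close>-th block of \<open>n\<close> coordinates.
  With \<open>\<delta> = B / N powr (3/2)\<close>, a point that is uncorrelated with half of the sign vectors has
  suboptimality of order \<open>h * B\<^sup>2 / N\<^sup>2\<close>.

  The oracle reveals the next sign vector of the chain only with probability \<open>p\<close>; the variance this costs
  bounds \<open>h\<close>.  With \<open>p = 1\<close> and \<open>N = 2 * K * R\<close> this gives the first term of the bound.  With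
  \<open>p = (1 + ln M) / K\<close> no machine makes more than \<open>O(1 + ln M)\<close> steps in a round, so
  \<open>N\<close> of order \<open>R * (1 + ln M)\<close> gives the third term.  The contribution of the sign vectors that a query has not
  reached is only revealed by a rare correction, of probability of order \<open>1 / (M * K * R)\<close>, which is where the
  dimension has to be large.  A chain of length one whose gradient is only revealed by such a
  correction gives the second term.

  The noise is finite, so a run is a deterministic function of the seed, the signs and the coins of the
  oracle.  As long as no correction happens and no query is correlated with the unreached blocks, the run coincides with an
  idealized run that ignores the signs in these blocks; flipping them then changes neither the run nor
  the output, and by convexity one of the two sign patterns is bad for the output.
\<close>

section \<open>Runs against oracles with finite noise\<close>

text \<open>The obstacle is adaptivity: queries depend on answers and thus on the signs, so no
  concentration bound applies to them directly. In the idealized run the number of blocks that enter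
  an answer is fixed by the coins alone. For fixed coins a query is then independent of the blocks
  it is tested against, and a Chernoff bound with a union over queries and blocks applies. The price
  is the variance of the correction, of order \<open>H\<^sup>2 * \<gamma>\<^sup>2 * M * K * R * ln
  (M * K\<^sup>2 * R\<^sup>2) / n\<close>; it has to stay below \<open>\<sigma>\<^sup>2\<close> with
  \<open>n\<close> of order \<open>D / (K * R)\<close>. Each of the three terms has its own family
  of instances, and reaching the largest term loses only a factor of three. Two ranges need care. If
  \<open>K < 1 + ln M\<close>, the reveal probability of the third term would exceed
  \<open>1\<close>, but then the first term dominates the third. If \<open>M = K = R = 1\<close>,
  the logarithm vanishes and the block length is no longer controlled; noiseless one-dimensional
  functions are used instead.\<close>

definition noisy :: "nat \<Rightarrow> 'o pmf \<Rightarrow> ('o \<Rightarrow> rvec \<Rightarrow> rvec) \<Rightarrow> rvec \<Rightarrow> rvec measure" where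
  "noisy D P A x = distr (measure_pmf P) (Rn D) (\<lambda>w. A w x)"

text \<open>\<open>play\<close> with the coins fixed in advance. The answer map \<open>a i\<close>
  may vary with the index, so that the idealized run, whose oracle changes from index to index, is
  an instance.\<close>

primrec sim ::
  "nat \<Rightarrow> nat \<Rightarrow> (qindex \<Rightarrow> 's \<times> transcript \<Rightarrow> rvec) \<Rightarrow> (qindex \<Rightarrow> rvec \<Rightarrow> rvec) \<Rightarrow>
   qindex list \<Rightarrow> 's \<Rightarrow> transcript \<Rightarrow> transcript" where
  "sim M K Q a [] \<xi> h = h"
| "sim M K Q a (i # is) \<xi> h =
     (let x = Q i (\<xi>, restrict h (past M K i)) in sim M K Q a is \<xi> (h(i := (x, a i x))))"

lemma sim_notin: "j \<notin> set is \<Longrightarrow> sim M K Q a is \<xi> h j = h j"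
  by (induction "is" arbitrary: h) (auto simp: Let_def)

lemma sim_cong: "(\<And>i. i \<in> set is \<Longrightarrow> a i = b i) \<Longrightarrow> sim M K Q a is \<xi> h = sim M K Q b is \<xi> h"
  by (induction "is" arbitrary: h) (auto simp: Let_def)

text \<open>No entry is written twice, so on \<open>past M K i\<close> the final transcript agrees
  with the one at the time of query \<open>i\<close>. The result is a recursion along
  \<open>past\<close> that no longer mentions the order of execution.\<close>

lemma sim_unfold:
  assumes "distinct is" and "\<And>as i bs. is = as @ i # bs \<Longrightarrow> past M K i \<inter> set (i # bs) = {}"
    and "i \<in> set is"
  shows "sim M K Q a is \<xi> h i =
    (Q i (\<xi>, restrict (sim M K Q a is \<xi> h) (past M K i)),
     a i (Q i (\<xi>, restrict (sim M K Q a is \<xi> h) (past M K i))))"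
  using assms
proof (induction "is" arbitrary: h)
  case (Cons j "is")
  have disj: "past M K j \<inter> set (j # is) = {}" using Cons.prems(2)[of "[]" j "is"] by simp
  have split: "past M K k \<inter> set (k # bs) = {}" if "is = as @ k # bs" for as k bs
    using Cons.prems(2)[of "j # as" k bs] that by simp
  define x where "x = Q j (\<xi>, restrict h (past M K j))"
  have *: "sim M K Q a (j # is) \<xi> h = sim M K Q a is \<xi> (h(j := (x, a j x)))" (is "?H = _")
    by (simp add: x_def Let_def)
  show ?case
  proof (cases "i = j")
    case True
    have "restrict ?H (past M K j) = restrict h (past M K j)"
      by (rule restrict_ext) (use disj sim_notin[of _ "j # is" M K Q a \<xi> h] in blast)
    moreover have "?H j = (x, a j x)" using Cons.prems(1) by (subst *) (simp add: sim_notin)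
    ultimately show ?thesis unfolding True by (simp only: x_def)
  next
    case False
    then have "i \<in> set is" using Cons.prems by simp
    then show ?thesis unfolding * using Cons.IH[OF _ split] Cons.prems(1) by auto
  qed
qed simp

lemma distinct_query_order: "distinct (query_order M K R)"
proof -
  have "irreflp (\<lambda>(m, k, r) (m', k', r'). (r::nat) < r' \<or> r = r' \<and> ((k::nat) < k' \<or> k = k' \<and> (m::nat) < m'))"
    by (auto simp: irreflp_def)
  then show ?thesis using sorted_order[of M K R] by (metis (no_types, lifting) distinct_conv_nth
        irreflpD linorder_neqE_nat sorted_wrt_iff_nth_less)
qed

definition transcript_of :: "nat \<Rightarrow> nat \<Rightarrow> nat \<Rightarrow> (qindex \<Rightarrow> 's \<times> transcript \<Rightarrow> rvec) \<Rightarrow>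
    (qindex \<Rightarrow> rvec \<Rightarrow> rvec) \<Rightarrow> 's \<Rightarrow> transcript" where
  "transcript_of M K R Q a \<xi> = sim M K Q a (query_order M K R) \<xi> (\<lambda>_. undefined)"

lemma transcript_of_notin: "i \<notin> indices M K R \<Longrightarrow> transcript_of M K R Q a \<xi> i = undefined"
  unfolding transcript_of_def by (subst sim_notin) (auto simp: set_order)

lemma transcript_of_unfold:
  assumes "i \<in> indices M K R"
  shows "transcript_of M K R Q a \<xi> i =
    (Q i (\<xi>, restrict (transcript_of M K R Q a \<xi>) (past M K i)),
     a i (Q i (\<xi>, restrict (transcript_of M K R Q a \<xi>) (past M K i))))"
  unfolding transcript_of_def
proof (rule sim_unfold)
  fix as j bs assume *: "query_order M K R = as @ j # bs"
  show "past M K j \<inter> set (j # bs) = {}"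
    using past_order[OF *] distinct_query_order[of M K R] unfolding * by auto
qed (use assms in \<open>auto simp: distinct_query_order set_order\<close>)

lemma transcript_of_eq_query:
  assumes "i \<in> indices M K R"
  shows "transcript_of M K R Q a \<xi> i = (fst (transcript_of M K R Q a \<xi> i), a i (fst (transcript_of M K R Q a \<xi> i)))"
  by (simp add: transcript_of_unfold[OF assms, of Q a \<xi>])

lemma past_subset_indices: "i \<in> indices M K R \<Longrightarrow> past M K i \<subseteq> indices M K R"
  by (cases i) (auto simp: indices_def)

text \<open>The time \<open>r * K + k\<close> strictly increases along \<open>past\<close>. The
  machine does not enter, as simultaneous queries do not see each other.\<close>

lemma indices_induct [consumes 1, case_names less]:
  assumes "i \<in> indices M K R"
    and step: "\<And>i. i \<in> indices M K R \<Longrightarrow> (\<And>j. j \<in> past M K i \<Longrightarrow> P j) \<Longrightarrow> P i"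
  shows "P i"
  using assms(1)
proof (induction "(\<lambda>(m, k, r). r * K + k) i" arbitrary: i rule: less_induct)
  case less
  show ?case
  proof (rule step[OF less.prems])
    fix j assume j: "j \<in> past M K i"
    obtain m k r where i: "i = (m, k, r)" by (cases i)
    obtain m' k' r' where j': "j = (m', k', r')" by (cases j)
    have "r' * K + k' < r * K + k"
    proof (cases "r' < r")
      case True
      then have "k' < K" using j by (auto simp: i j')
      moreover have "(r' + 1) * K \<le> r * K" using True by (intro mult_right_mono) auto
      ultimately show ?thesis by simp
    qed (use j in \<open>auto simp: i j'\<close>)
    then show "P j"
      using j past_subset_indices[OF less.prems] by (intro less.hyps) (auto simp: i j')
  qed
qed

lemma finite_indices: "finite (indices M K R)" by (simp add: indices_def)

lemma card_indices: "card (indices M K R) = M * K * R" by (simp add: indices_def card_cartesian_product)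

section \<open>Drawing the coins of the oracle before the run\<close>

context
  fixes D M K :: nat and P :: "('o::finite) pmf" and A :: "'o \<Rightarrow> rvec \<Rightarrow> rvec"
  assumes A [measurable]: "\<And>w. A w \<in> Rn D \<rightarrow>\<^sub>M Rn D"
begin

lemma noisy_measurable: "noisy D P A \<in> Rn D \<rightarrow>\<^sub>M prob_algebra (Rn D)"
proof (rule measurable_prob_algebraI)
  show "prob_space (noisy D P A x)" if "x \<in> space (Rn D)" for x
    unfolding noisy_def using that measurable_space[OF A]
    by (intro prob_space.prob_space_distr prob_space_measure_pmf) auto
  have "(\<lambda>z. A (snd z) (fst z)) \<in> Rn D \<Otimes>\<^sub>M count_space UNIV \<rightarrow>\<^sub>M Rn D"
    by (rule measurable_compose_countable'[where I = UNIV and f = "\<lambda>w z. A w (fst z)" and g = snd])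
      (auto intro: countable_finite)
  then show "noisy D P A \<in> Rn D \<rightarrow>\<^sub>M subprob_algebra (Rn D)"
    unfolding noisy_def
    by (intro measurable_distr2[where M = "count_space UNIV"])
      (auto simp: case_prod_beta' intro!: measurable_const measure_pmf_in_subprob_algebra)
qed

lemma nn_integral_noisy:
  assumes "x \<in> space (Rn D)" "f \<in> borel_measurable (Rn D)"
  shows "(\<integral>\<^sup>+g. f g \<partial>noisy D P A x) = (\<integral>\<^sup>+w. f (A w x) \<partial>P)"
  unfolding noisy_def using assms measurable_space[OF A]
  by (intro nn_integral_distr) auto

text \<open>Each index is queried once, so its coin can be drawn before the run starts; the product
  \<open>Pi_pmf\<close> expresses that the coins are independent. One coin is split off per
  induction step.\<close>

lemma play_sim:
  fixes S :: "'s measure"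
  assumes Q: "\<And>i. i \<in> set is \<Longrightarrow> Q i \<in> S \<Otimes>\<^sub>M transcripts D (past M K i) \<rightarrow>\<^sub>M Rn D"
    and ord: "\<And>as i bs. is = as @ i # bs \<Longrightarrow> past M K i \<subseteq> J \<union> set as"
    and I: "J \<union> set is = I" and d: "distinct is"
    and f: "f \<in> borel_measurable (S \<Otimes>\<^sub>M transcripts D I)"
    and \<xi>: "\<xi> \<in> space S" and h: "h \<in> space (transcripts D J)"
  shows "(\<integral>\<^sup>+p. f p \<partial>play M K (S \<Otimes>\<^sub>M transcripts D I) Q (noisy D P A) is \<xi> h) =
    (\<integral>\<^sup>+\<omega>. f (\<xi>, sim M K Q (\<lambda>i. A (\<omega> i)) is \<xi> h) \<partial>Pi_pmf (set is) dflt (\<lambda>_. P))"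
  using Q ord I d h
proof (induction "is" arbitrary: J h)
  case Nil
  then have "(\<xi>, h) \<in> space (S \<Otimes>\<^sub>M transcripts D I)" using \<xi> by (auto simp: space_pair_measure)
  then show ?case using f by (simp add: nn_integral_return)
next
  case (Cons i "is")
  let ?N = "S \<Otimes>\<^sub>M transcripts D I"
  have pJ: "past M K i \<subseteq> J" using Cons.prems(2)[of "[]" i "is"] by simp
  define x where "x = Q i (\<xi>, restrict h (past M K i))"
  have "restrict h (past M K i) \<in> space (transcripts D (past M K i))"
    using measurable_space[OF measurable_restrict_subset[OF pJ] Cons.prems(5)] by simp
  then have x: "x \<in> space (Rn D)" unfolding x_def
    using \<xi> by (intro measurable_space[OF Cons.prems(1)[of i]]) (auto simp: space_pair_measure)
  have ord': "past M K k \<subseteq> insert i J \<union> set as" if "is = as @ k # bs" for as k bs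
    using Cons.prems(2)[of "i # as" k bs] that by auto
  have pm: "(\<lambda>p. play M K ?N Q (noisy D P A) is (fst p) (snd p)) \<in> S \<Otimes>\<^sub>M transcripts D (insert i J) \<rightarrow>\<^sub>M prob_algebra ?N"
    by (rule play_measurable[OF noisy_measurable _ ord' _ refl]) (use Cons.prems in auto)
  have u: "(\<lambda>g. (\<xi>, h(i := (x, g)))) \<in> Rn D \<rightarrow>\<^sub>M S \<Otimes>\<^sub>M transcripts D (insert i J)"
    using \<xi> x Cons.prems(5) by (intro measurable_Pair measurable_fun_upd[where J = J]) auto
  have pg: "(\<lambda>g. play M K ?N Q (noisy D P A) is \<xi> (h(i := (x, g)))) \<in> Rn D \<rightarrow>\<^sub>M subprob_algebra ?N"
    using measurable_prob_algebraD[OF measurable_compose[OF u pm]] by simp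
  have sN: "sets (noisy D P A x) = sets (Rn D)" by (simp add: noisy_def)
  have pg': "(\<lambda>g. play M K ?N Q (noisy D P A) is \<xi> (h(i := (x, g)))) \<in> noisy D P A x \<rightarrow>\<^sub>M subprob_algebra ?N"
    using pg by (simp cong: measurable_cong_sets add: measurable_cong_sets[OF sN refl])
  have fm: "(\<lambda>g. \<integral>\<^sup>+p. f p \<partial>play M K ?N Q (noisy D P A) is \<xi> (h(i := (x, g)))) \<in> borel_measurable (Rn D)"
    by (rule measurable_compose[OF pg nn_integral_measurable_subprob_algebra[OF f]])
  have "(\<integral>\<^sup>+p. f p \<partial>play M K ?N Q (noisy D P A) (i # is) \<xi> h) =
    (\<integral>\<^sup>+g. \<integral>\<^sup>+p. f p \<partial>play M K ?N Q (noisy D P A) is \<xi> (h(i := (x, g))) \<partial>noisy D P A x)"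
    unfolding play.simps Let_def x_def[symmetric] by (rule nn_integral_bind[OF f pg'])
  also have "\<dots> = (\<integral>\<^sup>+w. \<integral>\<^sup>+p. f p \<partial>play M K ?N Q (noisy D P A) is \<xi> (h(i := (x, A w x))) \<partial>P)"
    by (rule nn_integral_noisy[OF x fm])
  also have "\<dots> = (\<integral>\<^sup>+w. \<integral>\<^sup>+\<omega>. f (\<xi>, sim M K Q (\<lambda>i. A (\<omega> i)) is \<xi> (h(i := (x, A w x))))
      \<partial>Pi_pmf (set is) dflt (\<lambda>_. P) \<partial>P)"
  proof (intro nn_integral_cong, rule Cons.IH[where J = "insert i J"])
    fix w
    have "(\<xi>, h(i := (x, A w x))) \<in> space (S \<Otimes>\<^sub>M transcripts D (insert i J))"
      using measurable_space[OF u measurable_space[OF A x]] by simp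
    then show "h(i := (x, A w x)) \<in> space (transcripts D (insert i J))" by (simp add: space_pair_measure)
  qed (use Cons.prems ord' in simp_all)
  also have "\<dots> = (\<integral>\<^sup>+w. \<integral>\<^sup>+\<omega>. f (\<xi>, sim M K Q (\<lambda>j. A (fun_upd \<omega> i w j)) (i # is) \<xi> h)
      \<partial>Pi_pmf (set is) dflt (\<lambda>_. P) \<partial>P)"
  proof (intro nn_integral_cong)
    fix w \<omega>
    \<comment> \<open>The coin of \<open>i\<close> is not consulted again, so storing it in
      \<open>\<omega>\<close> leaves the rest of the run unchanged.\<close>
    have "sim M K Q (\<lambda>j. A (\<omega> j)) is \<xi> (h(i := (x, A w x))) =
      sim M K Q (\<lambda>j. A (fun_upd \<omega> i w j)) is \<xi> (h(i := (x, A w x)))"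
      by (rule sim_cong) (use Cons.prems(4) in auto)
    then show "f (\<xi>, sim M K Q (\<lambda>i. A (\<omega> i)) is \<xi> (h(i := (x, A w x)))) =
      f (\<xi>, sim M K Q (\<lambda>j. A (fun_upd \<omega> i w j)) (i # is) \<xi> h)"
      by (simp add: x_def Let_def)
  qed
  also have "\<dots> = (\<integral>\<^sup>+\<omega>. f (\<xi>, sim M K Q (\<lambda>i. A (\<omega> i)) (i # is) \<xi> h) \<partial>Pi_pmf (set (i # is)) dflt (\<lambda>_. P))"
    using Cons.prems(4) by (simp add: Pi_pmf_insert nn_integral_pair_pmf' case_prod_beta' del: sim.simps cong: if_cong)
  finally show ?case .
qed

end

abbreviation noise :: "nat \<Rightarrow> nat \<Rightarrow> nat \<Rightarrow> 'o pmf \<Rightarrow> (qindex \<Rightarrow> 'o) pmf" where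
  "noise M K R P \<equiv> Pi_pmf (indices M K R) undefined (\<lambda>_. P)"

text \<open>Measurability in the seed is inherited from the kernel \<open>play\<close>, so that none
  has to be shown for \<open>transcript_of\<close>.\<close>

lemma
  fixes S :: "'s measure" and P :: "('o::finite) pmf"
  assumes alg: "ic_algorithm D M K R S Q X" and A: "\<And>w. A w \<in> Rn D \<rightarrow>\<^sub>M Rn D"
    and f: "f \<in> borel_measurable (S \<Otimes>\<^sub>M transcripts D (indices M K R))"
  shows nn_integral_run_law_noisy: "(\<integral>\<^sup>+p. f p \<partial>run_law D M K R S Q (noisy D P A)) =
      (\<integral>\<^sup>+\<xi>. \<integral>\<^sup>+\<omega>. f (\<xi>, transcript_of M K R Q (\<lambda>i. A (\<omega> i)) \<xi>) \<partial>noise M K R P \<partial>S)"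
    and measurable_run_law_noisy:
      "(\<lambda>\<xi>. \<integral>\<^sup>+\<omega>. f (\<xi>, transcript_of M K R Q (\<lambda>i. A (\<omega> i)) \<xi>) \<partial>noise M K R P) \<in> borel_measurable S"
proof -
  let ?N = "S \<Otimes>\<^sub>M transcripts D (indices M K R)"
  have Q: "\<And>i. i \<in> set (query_order M K R) \<Longrightarrow> Q i \<in> S \<Otimes>\<^sub>M transcripts D (past M K i) \<rightarrow>\<^sub>M Rn D"
    using alg by (auto simp: ic_algorithm_def set_order)
  have a: "(\<lambda>p. play M K ?N Q (noisy D P A) (query_order M K R) (fst p) (snd p)) \<in> S \<Otimes>\<^sub>M transcripts D {} \<rightarrow>\<^sub>M prob_algebra ?N"
    by (rule play_measurable[OF noisy_measurable[OF A] Q])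
      (use past_order[of M K R] set_order[of M K R] in auto)
  have b: "(\<lambda>\<xi>. (\<xi>, \<lambda>_. undefined)) \<in> S \<rightarrow>\<^sub>M S \<Otimes>\<^sub>M transcripts D {}"
    by (auto intro!: measurable_Pair simp: space_PiM)
  have c: "(\<lambda>\<xi>. play M K ?N Q (noisy D P A) (query_order M K R) \<xi> (\<lambda>_. undefined)) \<in> S \<rightarrow>\<^sub>M subprob_algebra ?N"
    using measurable_prob_algebraD[OF measurable_compose[OF b a]] by simp
  have e: "(\<integral>\<^sup>+p. f p \<partial>play M K ?N Q (noisy D P A) (query_order M K R) \<xi> (\<lambda>_. undefined)) =
    (\<integral>\<^sup>+\<omega>. f (\<xi>, transcript_of M K R Q (\<lambda>i. A (\<omega> i)) \<xi>) \<partial>noise M K R P)" if "\<xi> \<in> space S" for \<xi>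
    unfolding transcript_of_def set_order[symmetric]
    by (rule play_sim[where J = "{}", OF A Q])
      (use that f past_order[of M K R] in \<open>auto simp: set_order distinct_query_order space_PiM\<close>)
  show "(\<integral>\<^sup>+p. f p \<partial>run_law D M K R S Q (noisy D P A)) =
      (\<integral>\<^sup>+\<xi>. \<integral>\<^sup>+\<omega>. f (\<xi>, transcript_of M K R Q (\<lambda>i. A (\<omega> i)) \<xi>) \<partial>noise M K R P \<partial>S)"
    unfolding run_law_def nn_integral_bind[OF f c] by (intro nn_integral_cong e)
  show "(\<lambda>\<xi>. \<integral>\<^sup>+\<omega>. f (\<xi>, transcript_of M K R Q (\<lambda>i. A (\<omega> i)) \<xi>) \<partial>noise M K R P) \<in> borel_measurable S"
    using measurable_compose[OF c nn_integral_measurable_subprob_algebra[OF f]] e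
    by (simp cong: measurable_cong)
qed

text \<open>The coins are discrete, so the almost sure bound becomes one for all coins in the
  support, and only the seed keeps an exceptional null set. The later arguments fix the seed and the
  coins and need this form.\<close>

lemma AE_run_law_noisy:
  fixes S :: "'s measure" and P :: "('o::finite) pmf"
  assumes alg: "ic_algorithm D M K R S Q X" and orc: "sg_oracle D F \<sigma> (noisy D P A)"
    and A: "\<And>w. A w \<in> Rn D \<rightarrow>\<^sub>M Rn D"
    and bnd: "AE p in run_law D M K R S Q (noisy D P A). \<forall>i\<in>indices M K R. vnorm D (fst (snd p i)) \<le> \<gamma>"
  shows "AE \<xi> in S. \<forall>\<omega>\<in>set_pmf (noise M K R P). \<forall>i\<in>indices M K R.
      vnorm D (fst (transcript_of M K R Q (\<lambda>i. A (\<omega> i)) \<xi> i)) \<le> \<gamma>"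
proof -
  let ?N = "S \<Otimes>\<^sub>M transcripts D (indices M K R)"
  define f where "f p = (if \<forall>i\<in>indices M K R. vnorm D (fst (snd p i)) \<le> \<gamma> then 0 else 1::ennreal)"
    for p :: "'s \<times> transcript"
  have v: "(\<lambda>p. vnorm D (fst (snd p i))) \<in> borel_measurable ?N" if i: "i \<in> indices M K R" for i
    unfolding L2_set_def
    by (intro borel_measurable_sqrt[THEN measurable_compose[rotated]] borel_measurable_sum borel_measurable_power
        measurable_compose[OF measurable_snd] measurable_compose[OF measurable_component_singleton[OF i]]
        measurable_compose[OF measurable_fst] measurable_component_singleton)
  have [measurable]: "f \<in> borel_measurable ?N"
    unfolding f_def using finite_indices[of M K R] v
    by (intro measurable_If pred_intros_finite) (auto intro!: borel_measurable_le)
  have "sets (run_law D M K R S Q (noisy D P A)) = sets ?N"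
    using run_law_in_prob_algebra[OF alg orc] by (simp add: space_prob_algebra)
  then have fm: "f \<in> borel_measurable (run_law D M K R S Q (noisy D P A))"
    by (simp cong: measurable_cong_sets)
  have "(\<integral>\<^sup>+p. f p \<partial>run_law D M K R S Q (noisy D P A)) = 0"
    using bnd by (subst nn_integral_0_iff_AE[OF fm]) (auto simp: f_def)
  then have "(\<integral>\<^sup>+\<xi>. \<integral>\<^sup>+\<omega>. f (\<xi>, transcript_of M K R Q (\<lambda>i. A (\<omega> i)) \<xi>) \<partial>noise M K R P \<partial>S) = 0"
    by (subst nn_integral_run_law_noisy[OF alg A, symmetric]) measurable
  then have "AE \<xi> in S. (\<integral>\<^sup>+\<omega>. f (\<xi>, transcript_of M K R Q (\<lambda>i. A (\<omega> i)) \<xi>) \<partial>noise M K R P) = 0"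
    by (subst (asm) nn_integral_0_iff_AE[OF measurable_run_law_noisy[OF alg A]]) measurable
  then show ?thesis
    by eventually_elim (auto simp: nn_integral_0_iff_AE AE_measure_pmf_iff f_def split: if_splits)
qed

text \<open>Yao's principle: it is enough to beat the algorithm on average over a finite family.\<close>

lemma exists_hard_instance:
  fixes S :: "'s measure" and P :: "('o::finite) pmf" and F :: "'t \<Rightarrow> rvec \<Rightarrow> real"
  assumes alg: "ic_algorithm D M K R S Q X" and qb: "queries_bounded D M K R H B \<sigma> \<gamma> S Q"
    and \<Theta>: "finite \<Theta>" "\<Theta> \<noteq> {}"
    and F: "\<And>\<theta>. \<theta> \<in> \<Theta> \<Longrightarrow> F \<theta> \<in> F0_class D H B"
    and Fm: "\<And>\<theta>. \<theta> \<in> \<Theta> \<Longrightarrow> F \<theta> \<in> borel_measurable (Rn D)"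
    and orc: "\<And>\<theta>. \<theta> \<in> \<Theta> \<Longrightarrow> sg_oracle D (F \<theta>) \<sigma> (noisy D P (A \<theta>))"
    and A: "\<And>\<theta> w. \<theta> \<in> \<Theta> \<Longrightarrow> A \<theta> w \<in> Rn D \<rightarrow>\<^sub>M Rn D"
    and key: "\<And>\<xi>. \<xi> \<in> space S \<Longrightarrow>
      (\<And>\<theta> \<omega> i. \<theta> \<in> \<Theta> \<Longrightarrow> \<omega> \<in> set_pmf (noise M K R P) \<Longrightarrow> i \<in> indices M K R \<Longrightarrow>
         vnorm D (fst (transcript_of M K R Q (\<lambda>i. A \<theta> (\<omega> i)) \<xi> i)) \<le> \<gamma>) \<Longrightarrow>
      of_nat (card \<Theta>) * ennreal b \<le> (\<Sum>\<theta>\<in>\<Theta>. \<integral>\<^sup>+\<omega>. ennreal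
         (F \<theta> (X (\<xi>, transcript_of M K R Q (\<lambda>i. A \<theta> (\<omega> i)) \<xi>)) - min_value D (F \<theta>)) \<partial>noise M K R P)"
  shows "\<exists>F\<in>F0_class D H B. \<exists>Orc. sg_oracle D F \<sigma> Orc \<and>
    expected_suboptimality D M K R S Q X Orc F \<ge> ennreal b"
proof (rule ccontr)
  assume neg: "\<not> ?thesis"
  interpret S: prob_space S using alg by (simp add: ic_algorithm_def)
  let ?g = "\<lambda>\<theta> \<xi>. \<integral>\<^sup>+\<omega>. ennreal
         (F \<theta> (X (\<xi>, transcript_of M K R Q (\<lambda>i. A \<theta> (\<omega> i)) \<xi>)) - min_value D (F \<theta>)) \<partial>noise M K R P"
  have X: "X \<in> S \<Otimes>\<^sub>M transcripts D (indices M K R) \<rightarrow>\<^sub>M Rn D" using alg by (simp add: ic_algorithm_def)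
  have f: "(\<lambda>p. ennreal (F \<theta> (X p) - min_value D (F \<theta>))) \<in> borel_measurable (S \<Otimes>\<^sub>M transcripts D (indices M K R))"
    if "\<theta> \<in> \<Theta>" for \<theta>
    using measurable_compose[OF X Fm[OF that]] by measurable
  have gm: "?g \<theta> \<in> borel_measurable S" if "\<theta> \<in> \<Theta>" for \<theta>
    using measurable_run_law_noisy[OF alg A[OF that] f[OF that]] .
  have e: "expected_suboptimality D M K R S Q X (noisy D P (A \<theta>)) (F \<theta>) = (\<integral>\<^sup>+\<xi>. ?g \<theta> \<xi> \<partial>S)"
    if "\<theta> \<in> \<Theta>" for \<theta>
    unfolding expected_suboptimality_def by (rule nn_integral_run_law_noisy[OF alg A[OF that] f[OF that]])
  have "AE \<xi> in S. \<forall>\<theta>\<in>\<Theta>. \<forall>\<omega>\<in>set_pmf (noise M K R P). \<forall>i\<in>indices M K R.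
      vnorm D (fst (transcript_of M K R Q (\<lambda>i. A \<theta> (\<omega> i)) \<xi> i)) \<le> \<gamma>"
  proof (rule AE_finite_allI[OF \<Theta>(1)])
    fix \<theta> assume t: "\<theta> \<in> \<Theta>"
    have "AE p in run_law D M K R S Q (noisy D P (A \<theta>)). \<forall>i\<in>indices M K R. vnorm D (fst (snd p i)) \<le> \<gamma>"
      using qb F[OF t] orc[OF t] by (simp add: queries_bounded_def)
    then show "AE \<xi> in S. \<forall>\<omega>\<in>set_pmf (noise M K R P). \<forall>i\<in>indices M K R.
      vnorm D (fst (transcript_of M K R Q (\<lambda>i. A \<theta> (\<omega> i)) \<xi> i)) \<le> \<gamma>"
      by (rule AE_run_law_noisy[OF alg orc[OF t] A[OF t]])
  qed
  with AE_space have "AE \<xi> in S. of_nat (card \<Theta>) * ennreal b \<le> (\<Sum>\<theta>\<in>\<Theta>. ?g \<theta> \<xi>)"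
    by eventually_elim (rule key, auto)
  then have "(\<integral>\<^sup>+\<xi>. of_nat (card \<Theta>) * ennreal b \<partial>S) \<le> (\<integral>\<^sup>+\<xi>. (\<Sum>\<theta>\<in>\<Theta>. ?g \<theta> \<xi>) \<partial>S)"
    by (rule nn_integral_mono_AE)
  then have 1: "of_nat (card \<Theta>) * ennreal b \<le> (\<Sum>\<theta>\<in>\<Theta>. \<integral>\<^sup>+\<xi>. ?g \<theta> \<xi> \<partial>S)"
    using gm by (simp add: nn_integral_sum S.emeasure_space_1)
  have lt: "(\<integral>\<^sup>+\<xi>. ?g \<theta> \<xi> \<partial>S) < ennreal b" if "\<theta> \<in> \<Theta>" for \<theta>
    using neg F[OF that] orc[OF that] e[OF that] by (metis not_le)
  \<comment> \<open>All expectations are below \<open>b\<close>, hence finite; over the reals the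
    strict inequalities can be summed.\<close>
  define r where "r \<theta> = enn2real (\<integral>\<^sup>+\<xi>. ?g \<theta> \<xi> \<partial>S)" for \<theta>
  have r: "(\<integral>\<^sup>+\<xi>. ?g \<theta> \<xi> \<partial>S) = ennreal (r \<theta>)" "0 \<le> r \<theta>" "r \<theta> < b" if "\<theta> \<in> \<Theta>" for \<theta>
  proof -
    show *: "(\<integral>\<^sup>+\<xi>. ?g \<theta> \<xi> \<partial>S) = ennreal (r \<theta>)" "0 \<le> r \<theta>"
      using less_le_trans[OF lt[OF that] top_greatest] by (simp_all add: r_def)
    show "r \<theta> < b" using lt[OF that] * by (simp add: ennreal_less_iff)
  qed
  have b: "0 < b" using \<Theta>(2) r by fastforce
  have "(\<Sum>\<theta>\<in>\<Theta>. \<integral>\<^sup>+\<xi>. ?g \<theta> \<xi> \<partial>S) = ennreal (\<Sum>\<theta>\<in>\<Theta>. r \<theta>)"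
    using r by (simp add: sum_ennreal)
  also have "\<dots> < ennreal (\<Sum>\<theta>\<in>\<Theta>. b)"
    using r \<Theta> by (intro ennreal_lessI sum_strict_mono) (auto simp: b card_gt_0_iff)
  also have "\<dots> = of_nat (card \<Theta>) * ennreal b"
    using b by (simp add: ennreal_mult ennreal_of_nat_eq_real_of_nat)
  finally have "(\<Sum>\<theta>\<in>\<Theta>. \<integral>\<^sup>+\<xi>. ?g \<theta> \<xi> \<partial>S) < of_nat (card \<Theta>) * ennreal b" .
  with 1 show False by simp
qed

section \<open>The hard functions\<close>

text \<open>The derivative of \<open>hinge\<close>, written as the projection onto
  \<open>[0, \<delta>]\<close>: for \<open>\<delta> \<ge> 0\<close>, \<open>hinge \<delta> s\<close>
  is the maximum of \<open>c * s - c\<^sup>2 / 2\<close> over \<open>c\<close> in this interval,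
  attained at \<open>c = ramp \<delta> s\<close>.\<close>

definition ramp :: "real \<Rightarrow> real \<Rightarrow> real" where "ramp \<delta> s = max 0 (min s \<delta>)"

text \<open>The smoothed hinge: \<open>0\<close> for \<open>s \<le> 0\<close>, \<open>s\<^sup>2 / 2\<close> on \<open>[0, \<delta>]\<close>, and of slope \<open>\<delta>\<close> afterwards.\<close>

definition hinge :: "real \<Rightarrow> real \<Rightarrow> real" where "hinge \<delta> s = ramp \<delta> s * s - (ramp \<delta> s)\<^sup>2 / 2"

lemma ramp_bounds: "0 \<le> ramp \<delta> s" "0 \<le> \<delta> \<Longrightarrow> ramp \<delta> s \<le> \<delta>"
  by (auto simp: ramp_def)

lemma ramp_lipschitz: "\<bar>ramp \<delta> u - ramp \<delta> s\<bar> \<le> \<bar>u - s\<bar>"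
  by (auto simp: ramp_def max_def min_def)

text \<open>The variational inequality of a projection onto an interval.\<close>

lemma ramp_projection:
  assumes "0 \<le> c" "c \<le> \<delta>" shows "0 \<le> (ramp \<delta> u - c) * (u - ramp \<delta> u)"
  using assms by (auto simp: ramp_def max_def min_def mult_nonneg_nonneg mult_nonpos_nonpos mult_nonneg_nonpos)

text \<open>Convexity without derivatives: the gap between \<open>hinge\<close> and its tangent is a
  projection inequality plus a square.\<close>

lemma hinge_ge:
  assumes "0 \<le> \<delta>" shows "hinge \<delta> s + ramp \<delta> s * (u - s) \<le> hinge \<delta> u"
proof -
  let ?c = "ramp \<delta> s" and ?d = "ramp \<delta> u"
  have "hinge \<delta> u - hinge \<delta> s - ?c * (u - s) = (?d - ?c) * (u - ?d) + (?d - ?c)\<^sup>2 / 2"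
    by (simp add: hinge_def power2_eq_square field_simps)
  moreover have "0 \<le> (?d - ?c) * (u - ?d)"
    by (rule ramp_projection) (use assms in \<open>auto simp: ramp_bounds\<close>)
  moreover have "0 \<le> (?d - ?c)\<^sup>2 / 2" by simp
  ultimately show ?thesis by linarith
qed

text \<open>The tangent inequality at \<open>u\<close> instead of \<open>s\<close> bounds the gap by
  the change of slope times \<open>u - s\<close>, and the slope is 1-Lipschitz.\<close>

lemma hinge_le:
  assumes "0 \<le> \<delta>" shows "hinge \<delta> u \<le> hinge \<delta> s + ramp \<delta> s * (u - s) + (u - s)\<^sup>2"
proof -
  have "hinge \<delta> u - hinge \<delta> s - ramp \<delta> s * (u - s) \<le> (ramp \<delta> u - ramp \<delta> s) * (u - s)"
    using hinge_ge[OF assms, of u s] by (simp add: field_simps)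
  also have "\<dots> \<le> \<bar>ramp \<delta> u - ramp \<delta> s\<bar> * \<bar>u - s\<bar>" by (metis abs_ge_self abs_mult)
  also have "\<dots> \<le> \<bar>u - s\<bar> * \<bar>u - s\<bar>" by (intro mult_right_mono ramp_lipschitz) simp
  finally show ?thesis by (simp add: power2_eq_square)
qed

lemma hinge_0: "0 \<le> \<delta> \<Longrightarrow> hinge \<delta> 0 = 0" by (simp add: hinge_def ramp_def)

lemma hinge_nonneg: "0 \<le> \<delta> \<Longrightarrow> 0 \<le> hinge \<delta> s"
  using hinge_ge[of \<delta> 0 s] by (simp add: hinge_0) (simp add: ramp_def)

lemma hinge_self: "0 \<le> \<delta> \<Longrightarrow> hinge \<delta> \<delta> = \<delta>\<^sup>2 / 2"
  by (simp add: hinge_def ramp_def power2_eq_square)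

lemma hinge_sym: "0 \<le> \<delta> \<Longrightarrow> 2 * hinge \<delta> s \<le> hinge \<delta> (s - d) + hinge \<delta> (s + d)"
  using hinge_ge[of \<delta> s "s - d"] hinge_ge[of \<delta> s "s + d"] by simp

lemma vdist_sq: "(vdist D x y)\<^sup>2 = (\<Sum>i<D. (x i - y i)\<^sup>2)"
  by (simp add: L2_set_def sum_nonneg)

lemma vnorm_sq: "(vnorm D x)\<^sup>2 = (\<Sum>i<D. (x i)\<^sup>2)"
  by (simp add: L2_set_def sum_nonneg)

lemma vdist_nonneg: "0 \<le> vdist D x y" by (simp add: L2_set_nonneg)

text \<open>All gradients are verified through these two global inequalities, without a calculus of
  derivatives. The lower one alone gives convexity, the quadratic gap gives
  differentiability.\<close>

lemma
  assumes g: "\<And>x. x \<in> space (Rn D) \<Longrightarrow> g x \<in> space (Rn D)"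
    and lower: "\<And>x z. x \<in> space (Rn D) \<Longrightarrow> z \<in> space (Rn D) \<Longrightarrow>
      F x + (\<Sum>i<D. g x i * (z i - x i)) \<le> F z"
    and upper: "\<And>x z. x \<in> space (Rn D) \<Longrightarrow> z \<in> space (Rn D) \<Longrightarrow>
      F z \<le> F x + (\<Sum>i<D. g x i * (z i - x i)) + C * (vdist D z x)\<^sup>2"
  shows convex_funI_gradient: "convex_fun D F"
    and has_gradientI_quadratic: "x \<in> space (Rn D) \<Longrightarrow> has_gradient D F x (g x)"
proof -
  show "convex_fun D F" unfolding convex_fun_def
  proof (intro ballI)
    fix x y and t :: real assume x: "x \<in> space (Rn D)" and y: "y \<in> space (Rn D)" and t: "t \<in> {0..1}"
    define w where "w = (\<lambda>i\<in>{..<D}. (1 - t) * x i + t * y i)"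
    have w: "w \<in> space (Rn D)" by (simp add: w_def space_PiM)
    have "(1 - t) * (F w + (\<Sum>i<D. g w i * (x i - w i))) + t * (F w + (\<Sum>i<D. g w i * (y i - w i)))
       \<le> (1 - t) * F x + t * F y"
      using t by (intro add_mono mult_left_mono lower w x y) auto
    moreover have "(1 - t) * (\<Sum>i<D. g w i * (x i - w i)) + t * (\<Sum>i<D. g w i * (y i - w i)) =
      (\<Sum>i<D. g w i * ((1 - t) * (x i - w i) + t * (y i - w i)))"
      by (simp add: sum_distrib_left sum.distrib[symmetric] algebra_simps)
    \<comment> \<open>\<open>w\<close> is the convex combination of \<open>x\<close> and
      \<open>y\<close>, so the weighted displacements cancel.\<close>
    moreover have "\<dots> = 0" by (rule sum.neutral) (simp add: w_def algebra_simps)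
    ultimately show "F (\<lambda>i\<in>{..<D}. (1 - t) * x i + t * y i) \<le> (1 - t) * F x + t * F y"
      unfolding w_def[symmetric] by (simp add: algebra_simps)
  qed
  show "has_gradient D F x (g x)" if x: "x \<in> space (Rn D)"
    unfolding has_gradient_def
  proof (intro conjI allI impI g x)
    fix e :: real assume e: "e > 0"
    show "\<exists>d>0. \<forall>y\<in>space (Rn D). vdist D y x < d \<longrightarrow>
        \<bar>F y - F x - (\<Sum>i<D. g x i * (y i - x i))\<bar> \<le> e * vdist D y x"
    proof (intro exI[of _ "e / (\<bar>C\<bar> + 1)"] conjI ballI impI)
      fix y assume y: "y \<in> space (Rn D)" and d: "vdist D y x < e / (\<bar>C\<bar> + 1)"
      have "C * (vdist D y x)\<^sup>2 \<le> ((\<bar>C\<bar> + 1) * vdist D y x) * vdist D y x"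
        by (simp add: power2_eq_square mult.assoc[symmetric] mult_right_mono vdist_nonneg)
      also have "\<dots> \<le> e * vdist D y x"
        using d by (intro mult_right_mono vdist_nonneg) (simp add: field_simps)
      finally show "\<bar>F y - F x - (\<Sum>i<D. g x i * (y i - x i))\<bar> \<le> e * vdist D y x"
        using lower[OF x y] upper[OF x y] by linarith
    qed (use e in simp)
  qed
qed

text \<open>Summation by parts. It turns the inner product with the gradient of a chain, where each
  ramp occurs with both signs, into a sum over links.\<close>

lemma sum_mult_Suc_diff:
  fixes a u :: "nat \<Rightarrow> real"
  shows "(\<Sum>j<N. ((if j = 0 then 0 else a (j - 1)) - a j) * u j) =
    (\<Sum>j<N. a j * (u (Suc j) - u j)) - (if N = 0 then 0 else a (N - 1) * u N)"
  by (induction N) (auto simp: algebra_simps)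

lemma sum_pred_le:
  fixes f :: "nat \<Rightarrow> real"
  assumes "\<And>j. 0 \<le> f j"
  shows "(\<Sum>j<N. if j = 0 then 0 else f (j - 1)) \<le> (\<Sum>j<N. f j)"
proof -
  have "(\<Sum>j<N. if j = 0 then 0 else f (j - 1)) + (if N = 0 then 0 else f (N - 1)) = (\<Sum>j<N. f j)"
    by (induction N) auto
  then show ?thesis using assms[of "N - 1"] by (auto split: if_splits)
qed

lemma power2_diff_le: "((a::real) - b)\<^sup>2 \<le> 2 * a\<^sup>2 + 2 * b\<^sup>2"
  using zero_le_power2[of "a + b"] by (simp add: power2_eq_square algebra_simps)

text \<open>The difference operator has norm at most \<open>2\<close>; \<open>w N = 0\<close> takes
  care of the boundary value.\<close>

lemma sum_diff_Suc_sq_le: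
  fixes w :: "nat \<Rightarrow> real"
  assumes "w N = 0"
  shows "(\<Sum>j<N. (w j - w (Suc j))\<^sup>2) \<le> 4 * (\<Sum>j<N. (w j)\<^sup>2)"
proof -
  have "(\<Sum>j<N. (w (Suc j))\<^sup>2) + (w 0)\<^sup>2 = (\<Sum>j<N. (w j)\<^sup>2) + (w N)\<^sup>2"
    by (induction N) auto
  moreover have "(w N)\<^sup>2 = 0" "0 \<le> (w 0)\<^sup>2" using assms by simp_all
  ultimately have "(\<Sum>j<N. (w (Suc j))\<^sup>2) \<le> (\<Sum>j<N. (w j)\<^sup>2)" by linarith
  moreover have "(\<Sum>j<N. (w j - w (Suc j))\<^sup>2) \<le> (\<Sum>j<N. 2 * (w j)\<^sup>2 + 2 * (w (Suc j))\<^sup>2)"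
    by (intro sum_mono power2_diff_le)
  ultimately show ?thesis by (simp add: sum.distrib sum_distrib_left[symmetric])
qed

section \<open>The chain functions, their gradients and minimizers\<close>

locale chain =
  fixes D N n :: nat and h \<delta> :: real
  assumes N: "0 < N" and n: "0 < n" and Nn: "N * n \<le> D" and h: "0 < h" and \<delta>: "0 < \<delta>"
begin

text \<open>The value \<open>0\<close> beyond \<open>N * n\<close> makes the set finite and lets
  \<open>lift\<close> vanish on the coordinates outside the blocks.\<close>

definition signs :: "(nat \<Rightarrow> real) set" where
  "signs = {\<epsilon>. (\<forall>i<N * n. \<epsilon> i = 1 \<or> \<epsilon> i = -1) \<and> (\<forall>i\<ge>N * n. \<epsilon> i = 0)}"

definition blk :: "nat \<Rightarrow> nat set" where "blk j = {i. i < N * n \<and> i div n = j}"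

text \<open>The factor \<open>1 / sqrt n\<close> makes the sign vectors of the blocks orthonormal.
  Blocks from \<open>N\<close> on are empty, which gives the end value \<open>0\<close> of the
  chain.\<close>

definition co :: "(nat \<Rightarrow> real) \<Rightarrow> rvec \<Rightarrow> nat \<Rightarrow> real" where
  "co \<epsilon> x j = (\<Sum>i\<in>blk j. \<epsilon> i * x i) / sqrt n"

definition fval :: "(nat \<Rightarrow> real) \<Rightarrow> real" where
  "fval y = h * (\<Sum>j<N. hinge \<delta> (\<delta> - (y j - y (Suc j))))"

text \<open>For \<open>j = N - 1\<close> this relies on \<open>y N\<close> being the constant \<open>0\<close>.\<close>

definition fgrad :: "(nat \<Rightarrow> real) \<Rightarrow> nat \<Rightarrow> real" where
  "fgrad y j = h * ((if j = 0 then 0 else ramp \<delta> (\<delta> - (y (j - 1) - y j))) - ramp \<delta> (\<delta> - (y j - y (Suc j))))"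

text \<open>For \<open>\<epsilon> \<in> signs\<close> this is the adjoint of
  \<open>co \<epsilon>\<close> and an isometry: gradients, noise and minimizers are computed in the
  \<open>N\<close> chain coordinates and then lifted.\<close>

definition lift :: "(nat \<Rightarrow> real) \<Rightarrow> (nat \<Rightarrow> real) \<Rightarrow> rvec" where
  "lift \<epsilon> u = (\<lambda>i\<in>{..<D}. u (i div n) * \<epsilon> i / sqrt n)"

definition F :: "(nat \<Rightarrow> real) \<Rightarrow> rvec \<Rightarrow> real" where "F \<epsilon> x = fval (co \<epsilon> x)"

lemma finite_blk: "finite (blk j)" by (simp add: blk_def)

lemma blk_outside: "N \<le> j \<Longrightarrow> blk j = {}"
  using n by (auto simp: blk_def less_mult_imp_div_less dest: leD)

lemma co_outside: "N \<le> j \<Longrightarrow> co \<epsilon> x j = 0" by (simp add: co_def blk_outside)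

lemma card_blk: "j < N \<Longrightarrow> card (blk j) = n"
proof -
  assume j: "j < N"
  have *: "Suc j * n \<le> N * n" using j by (intro mult_right_mono) auto
  have iff: "i div n = j \<longleftrightarrow> j * n \<le> i \<and> i < Suc j * n" for i
    unfolding less_eq_div_iff_mult_less_eq[OF n, symmetric] div_less_iff_less_mult[OF n, symmetric] by auto
  have "blk j = {j * n..<Suc j * n}"
  proof (rule set_eqI)
    show "i \<in> blk j \<longleftrightarrow> i \<in> {j * n..<Suc j * n}" for i
      unfolding blk_def mem_Collect_eq iff atLeastLessThan_iff using * by (meson less_le_trans)
  qed
  then show ?thesis by simp
qed

lemma sum_blocks: "(\<Sum>i<N * n. f i) = (\<Sum>j<N. \<Sum>i\<in>blk j. (f i :: real))"
proof -
  have "(\<Sum>j<N. \<Sum>i\<in>{i\<in>{..<N * n}. i div n = j}. f i) = (\<Sum>i<N * n. f i)"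
    using n by (intro sum.group) (auto simp: less_mult_imp_div_less)
  then show ?thesis by (simp add: blk_def)
qed

lemma sum_D:
  assumes "\<epsilon> \<in> signs" shows "(\<Sum>i<D. \<epsilon> i * f i) = (\<Sum>j<N. \<Sum>i\<in>blk j. \<epsilon> i * f i)"
proof -
  have "(\<Sum>i<D. \<epsilon> i * f i) = (\<Sum>i<N * n. \<epsilon> i * f i)"
    using Nn assms by (intro sum.mono_neutral_right) (auto simp: signs_def)
  then show ?thesis by (simp add: sum_blocks)
qed

lemma signs_sq: "\<epsilon> \<in> signs \<Longrightarrow> i < N * n \<Longrightarrow> \<epsilon> i * \<epsilon> i = 1"
  by (auto simp: signs_def)

lemma lift_space: "lift \<epsilon> u \<in> space (Rn D)" by (simp add: lift_def space_PiM)

lemma lift_inner: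
  assumes "\<epsilon> \<in> signs" shows "(\<Sum>i<D. lift \<epsilon> u i * x i) = (\<Sum>j<N. u j * co \<epsilon> x j)"
proof -
  have "(\<Sum>i<D. lift \<epsilon> u i * x i) = (\<Sum>i<D. \<epsilon> i * (u (i div n) / sqrt n * x i))"
    by (intro sum.cong) (auto simp: lift_def)
  also have "\<dots> = (\<Sum>j<N. \<Sum>i\<in>blk j. \<epsilon> i * (u (i div n) / sqrt n * x i))"
    by (rule sum_D[OF assms])
  also have "\<dots> = (\<Sum>j<N. u j * co \<epsilon> x j)"
    by (intro sum.cong refl) (auto simp: co_def sum_distrib_left sum_divide_distrib blk_def intro!: sum.cong)
  finally show ?thesis .
qed

lemma co_lift:
  assumes "\<epsilon> \<in> signs" "j < N" shows "co \<epsilon> (lift \<epsilon> u) j = u j"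
proof -
  have "(\<Sum>i\<in>blk j. \<epsilon> i * lift \<epsilon> u i) = (\<Sum>i\<in>blk j. u j / sqrt n)"
    using Nn by (intro sum.cong refl) (auto simp: lift_def blk_def signs_sq[OF assms(1)] mult.left_commute)
  also have "\<dots> = u j * sqrt n" using n by (simp add: card_blk[OF assms(2)] real_div_sqrt field_simps)
  finally show ?thesis using n by (simp add: co_def)
qed

lemma lift_norm:
  assumes "\<epsilon> \<in> signs" shows "(\<Sum>i<D. (lift \<epsilon> u i)\<^sup>2) = (\<Sum>j<N. (u j)\<^sup>2)"
  using lift_inner[OF assms, of u "lift \<epsilon> u"] co_lift[OF assms] by (simp add: power2_eq_square)

lemma lift_diff: "i < D \<Longrightarrow> lift \<epsilon> u i - lift \<epsilon> v i = lift \<epsilon> (\<lambda>j. u j - v j) i"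
  by (simp add: lift_def diff_divide_distrib left_diff_distrib)

lemma vdist_lift: "\<epsilon> \<in> signs \<Longrightarrow> (vdist D (lift \<epsilon> u) (lift \<epsilon> v))\<^sup>2 = (\<Sum>j<N. (u j - v j)\<^sup>2)"
  unfolding vdist_sq by (simp add: lift_diff lift_norm)

lemma co_diff: "co \<epsilon> z j - co \<epsilon> x j = co \<epsilon> (\<lambda>i. z i - x i) j"
  by (simp add: co_def diff_divide_distrib[symmetric] sum_subtractf right_diff_distrib)

text \<open>Bessel's inequality, by expanding the squared distance of \<open>x\<close> from its
  projection \<open>lift \<epsilon> (co \<epsilon> x)\<close>.\<close>

lemma co_bessel:
  assumes "\<epsilon> \<in> signs" shows "(\<Sum>j<N. (co \<epsilon> x j)\<^sup>2) \<le> (\<Sum>i<D. (x i)\<^sup>2)"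
proof -
  let ?u = "co \<epsilon> x"
  have "0 \<le> (\<Sum>i<D. (x i - lift \<epsilon> ?u i)\<^sup>2)" by (intro sum_nonneg) simp
  also have "\<dots> = (\<Sum>i<D. (x i)\<^sup>2) - 2 * (\<Sum>i<D. lift \<epsilon> ?u i * x i) + (\<Sum>i<D. (lift \<epsilon> ?u i)\<^sup>2)"
    by (simp add: power2_diff sum.distrib sum_subtractf sum_distrib_left mult.assoc mult.commute[of "x _"])
  finally show ?thesis unfolding lift_inner[OF assms] lift_norm[OF assms] by (simp add: power2_eq_square)
qed

text \<open>Up to sign, the gradient is \<open>h\<close> times the adjoint difference operator
  applied to ramps of differences. Both operators have norm at most \<open>2\<close> and the ramp is
  1-Lipschitz, which gives \<open>4 * h\<close>.\<close>

lemma fgrad_lipschitz: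
  assumes "y N = z N"
  shows "(\<Sum>j<N. (fgrad y j - fgrad z j)\<^sup>2) \<le> (4 * h)\<^sup>2 * (\<Sum>j<N. (y j - z j)\<^sup>2)"
proof -
  define a where "a j = ramp \<delta> (\<delta> - (y j - y (Suc j))) - ramp \<delta> (\<delta> - (z j - z (Suc j)))" for j
  define w where "w j = y j - z j" for j
  have a: "(a j)\<^sup>2 \<le> (w j - w (Suc j))\<^sup>2" for j
  proof -
    have "\<bar>a j\<bar> \<le> \<bar>w j - w (Suc j)\<bar>"
      using ramp_lipschitz[of \<delta> "\<delta> - (y j - y (Suc j))" "\<delta> - (z j - z (Suc j))"]
      by (simp add: a_def w_def)
    then show ?thesis by (simp add: abs_le_square_iff)
  qed
  have "(\<Sum>j<N. (fgrad y j - fgrad z j)\<^sup>2) = (\<Sum>j<N. h\<^sup>2 * ((if j = 0 then 0 else a (j - 1)) - a j)\<^sup>2)"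
    by (intro sum.cong refl) (auto simp: fgrad_def a_def power_mult_distrib[symmetric] algebra_simps)
  also have "\<dots> \<le> (\<Sum>j<N. h\<^sup>2 * (2 * (if j = 0 then 0 else (a (j - 1))\<^sup>2) + 2 * (a j)\<^sup>2))"
  proof (intro sum_mono mult_left_mono)
    show "((if j = 0 then 0 else a (j - 1)) - a j)\<^sup>2 \<le> 2 * (if j = 0 then 0 else (a (j - 1))\<^sup>2) + 2 * (a j)\<^sup>2" for j
      using power2_diff_le[of "if j = 0 then 0 else a (j - 1)" "a j"] by (auto split: if_splits)
  qed simp
  also have "\<dots> = h\<^sup>2 * (2 * (\<Sum>j<N. if j = 0 then 0 else (a (j - 1))\<^sup>2) + 2 * (\<Sum>j<N. (a j)\<^sup>2))"
    by (simp only: sum_distrib_left sum.distrib distrib_left)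
  also have "\<dots> \<le> h\<^sup>2 * (4 * (\<Sum>j<N. (a j)\<^sup>2))"
    using sum_pred_le[of "\<lambda>j. (a j)\<^sup>2" N] by (intro mult_left_mono) auto
  also have "\<dots> \<le> h\<^sup>2 * (4 * (\<Sum>j<N. (w j - w (Suc j))\<^sup>2))"
    by (intro mult_left_mono sum_mono a) auto
  also have "\<dots> \<le> h\<^sup>2 * (4 * (4 * (\<Sum>j<N. (w j)\<^sup>2)))"
    using sum_diff_Suc_sq_le[of w N] assms by (intro mult_left_mono) (auto simp: w_def)
  finally show ?thesis by (simp add: w_def power_mult_distrib)
qed

text \<open>Link by link these are the tangent inequality and the quadratic bound for
  \<open>hinge\<close>. The boundary term of the summation by parts vanishes because
  \<open>co\<close> is \<open>0\<close> at \<open>N\<close>.\<close>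

lemma F_first_order:
  assumes e: "\<epsilon> \<in> signs"
  shows "F \<epsilon> x + (\<Sum>i<D. lift \<epsilon> (fgrad (co \<epsilon> x)) i * (z i - x i)) \<le> F \<epsilon> z"
    and "F \<epsilon> z \<le> F \<epsilon> x + (\<Sum>i<D. lift \<epsilon> (fgrad (co \<epsilon> x)) i * (z i - x i)) + 4 * h * (vdist D z x)\<^sup>2"
proof -
  define u where "u = co \<epsilon> (\<lambda>i. z i - x i)"
  define s where "s y j = \<delta> - (y j - y (Suc j))" for y :: "nat \<Rightarrow> real" and j
  have uN: "u N = 0" by (simp add: u_def co_outside)
  have su: "s (co \<epsilon> z) j - s (co \<epsilon> x) j = u (Suc j) - u j" for j
    using co_diff[of \<epsilon> z j x] co_diff[of \<epsilon> z "Suc j" x] by (simp add: s_def u_def)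
  have "(\<Sum>i<D. lift \<epsilon> (fgrad (co \<epsilon> x)) i * (z i - x i)) = (\<Sum>j<N. fgrad (co \<epsilon> x) j * u j)"
    unfolding u_def by (rule lift_inner[OF e])
  also have "\<dots> = h * (\<Sum>j<N. ((if j = 0 then 0 else ramp \<delta> (s (co \<epsilon> x) (j - 1))) - ramp \<delta> (s (co \<epsilon> x) j)) * u j)"
    unfolding sum_distrib_left by (intro sum.cong refl) (auto simp: fgrad_def s_def)
  also have "\<dots> = h * (\<Sum>j<N. ramp \<delta> (s (co \<epsilon> x) j) * (u (Suc j) - u j))"
    by (subst sum_mult_Suc_diff) (simp add: uN)
  finally have g: "(\<Sum>i<D. lift \<epsilon> (fgrad (co \<epsilon> x)) i * (z i - x i)) =
    h * (\<Sum>j<N. ramp \<delta> (s (co \<epsilon> x) j) * (u (Suc j) - u j))" .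
  have F: "F \<epsilon> x = h * (\<Sum>j<N. hinge \<delta> (s (co \<epsilon> x) j))" for x by (simp add: F_def fval_def s_def)
  have lo: "hinge \<delta> (s (co \<epsilon> x) j) + ramp \<delta> (s (co \<epsilon> x) j) * (u (Suc j) - u j) \<le> hinge \<delta> (s (co \<epsilon> z) j)" for j
    using hinge_ge[of \<delta> "s (co \<epsilon> x) j" "s (co \<epsilon> z) j"] \<delta> by (simp add: su)
  have up: "hinge \<delta> (s (co \<epsilon> z) j) \<le> hinge \<delta> (s (co \<epsilon> x) j) + ramp \<delta> (s (co \<epsilon> x) j) * (u (Suc j) - u j) + (u j - u (Suc j))\<^sup>2" for j
    using hinge_le[of \<delta> "s (co \<epsilon> z) j" "s (co \<epsilon> x) j"] \<delta> by (simp add: su power2_commute)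
  show "F \<epsilon> x + (\<Sum>i<D. lift \<epsilon> (fgrad (co \<epsilon> x)) i * (z i - x i)) \<le> F \<epsilon> z"
    unfolding g F distrib_left[symmetric] sum.distrib[symmetric]
    using h lo by (intro mult_left_mono sum_mono) auto
  have "F \<epsilon> z \<le> h * (\<Sum>j<N. hinge \<delta> (s (co \<epsilon> x) j) + ramp \<delta> (s (co \<epsilon> x) j) * (u (Suc j) - u j) + (u j - u (Suc j))\<^sup>2)"
    unfolding F using h up by (intro mult_left_mono sum_mono) auto
  also have "\<dots> = F \<epsilon> x + (\<Sum>i<D. lift \<epsilon> (fgrad (co \<epsilon> x)) i * (z i - x i)) + h * (\<Sum>j<N. (u j - u (Suc j))\<^sup>2)"
    unfolding g F by (simp add: sum.distrib distrib_left)
  also have "h * (\<Sum>j<N. (u j - u (Suc j))\<^sup>2) \<le> h * (4 * (vdist D z x)\<^sup>2)"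
    using sum_diff_Suc_sq_le[of u N, OF uN] co_bessel[OF e, of "\<lambda>i. z i - x i"] h
    by (intro mult_left_mono) (auto simp: vdist_sq u_def)
  finally show "F \<epsilon> z \<le> F \<epsilon> x + (\<Sum>i<D. lift \<epsilon> (fgrad (co \<epsilon> x)) i * (z i - x i)) + 4 * h * (vdist D z x)\<^sup>2"
    by simp
qed

lemma F_has_gradient:
  assumes "\<epsilon> \<in> signs" "x \<in> space (Rn D)"
  shows "has_gradient D (F \<epsilon>) x (lift \<epsilon> (fgrad (co \<epsilon> x)))"
  by (rule has_gradientI_quadratic[where C = "4 * h" and g = "\<lambda>x. lift \<epsilon> (fgrad (co \<epsilon> x))"])
    (use assms in \<open>simp_all add: F_first_order lift_space\<close>)

lemma fval_nonneg: "0 \<le> fval y"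
  using h \<delta> by (auto simp: fval_def intro!: mult_nonneg_nonneg sum_nonneg hinge_nonneg)

text \<open>The chain coordinates drop by exactly \<open>\<delta>\<close> per link, so that every
  hinge argument is \<open>0\<close>. The norm is at most \<open>\<delta> * N powr (3/2)\<close>,
  which explains the scale of \<open>\<delta>\<close>.\<close>

definition minimizer :: "(nat \<Rightarrow> real) \<Rightarrow> rvec" where
  "minimizer \<epsilon> = lift \<epsilon> (\<lambda>j. real (N - j) * \<delta>)"

lemma F_minimizer: assumes "\<epsilon> \<in> signs" shows "F \<epsilon> (minimizer \<epsilon>) = 0"
proof -
  have co: "co \<epsilon> (minimizer \<epsilon>) j = real (N - j) * \<delta>" for j
    using co_lift[OF assms, of j] co_outside[of j] by (cases "j < N") (auto simp: minimizer_def)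
  have "\<delta> - (real (N - j) * \<delta> - real (N - Suc j) * \<delta>) = 0" if "j < N" for j
    using that by (simp add: Suc_diff_Suc[symmetric] algebra_simps)
  then show ?thesis using \<delta> by (simp add: F_def fval_def co hinge_0)
qed

lemma min_value_F: assumes "\<epsilon> \<in> signs" shows "min_value D (F \<epsilon>) = 0"
  unfolding min_value_def
proof (rule cInf_eq_minimum)
  show "0 \<in> F \<epsilon> ` space (Rn D)"
    using F_minimizer[OF assms] lift_space by (force simp: minimizer_def)
qed (auto simp: F_def fval_nonneg)

lemma F_in_F0_class:
  assumes e: "\<epsilon> \<in> signs" and H: "4 * h \<le> H" and B: "0 \<le> B" "\<delta>\<^sup>2 * real N ^ 3 \<le> B\<^sup>2"
  shows "F \<epsilon> \<in> F0_class D H B"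
  unfolding F0_class_def
proof (intro CollectI conjI bexI[of _ "minimizer \<epsilon>"] ballI)
  show "convex_fun D (F \<epsilon>)"
    by (rule convex_funI_gradient[where C = "4 * h" and g = "\<lambda>x. lift \<epsilon> (fgrad (co \<epsilon> x))"])
      (use e in \<open>simp_all add: F_first_order lift_space\<close>)
  have "vdist D (lift \<epsilon> (fgrad (co \<epsilon> x))) (lift \<epsilon> (fgrad (co \<epsilon> y))) \<le> H * vdist D x y" for x y
  proof (rule power2_le_imp_le)
    have "(vdist D (lift \<epsilon> (fgrad (co \<epsilon> x))) (lift \<epsilon> (fgrad (co \<epsilon> y))))\<^sup>2
      \<le> (4 * h)\<^sup>2 * (\<Sum>j<N. (co \<epsilon> x j - co \<epsilon> y j)\<^sup>2)"
      unfolding vdist_lift[OF e] by (rule fgrad_lipschitz) (simp add: co_outside)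
    also have "\<dots> \<le> H\<^sup>2 * (vdist D x y)\<^sup>2"
      unfolding co_diff vdist_sq using h H by (intro mult_mono co_bessel[OF e] power_mono) (auto intro: sum_nonneg)
    finally show "(vdist D (lift \<epsilon> (fgrad (co \<epsilon> x))) (lift \<epsilon> (fgrad (co \<epsilon> y))))\<^sup>2 \<le> (H * vdist D x y)\<^sup>2"
      by (simp add: power_mult_distrib)
  qed (use h H vdist_nonneg in simp)
  then show "smooth_fun D H (F \<epsilon>)"
    unfolding smooth_fun_def using F_has_gradient[OF e]
    by (intro exI[of _ "\<lambda>x. lift \<epsilon> (fgrad (co \<epsilon> x))"]) auto
  show "minimizer \<epsilon> \<in> space (Rn D)" by (simp add: minimizer_def lift_space)
  show "vnorm D (minimizer \<epsilon>) \<le> B"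
  proof (rule power2_le_imp_le[OF _ B(1)])
    have "(vnorm D (minimizer \<epsilon>))\<^sup>2 = (\<Sum>j<N. (real (N - j) * \<delta>)\<^sup>2)"
      by (simp add: vnorm_sq minimizer_def lift_norm[OF e])
    also have "\<dots> \<le> (\<Sum>j<N. (real N * \<delta>)\<^sup>2)"
      using \<delta> by (intro sum_mono power_mono mult_right_mono) auto
    also have "\<dots> = \<delta>\<^sup>2 * real N ^ 3" by (simp add: power_mult_distrib power3_eq_cube power2_eq_square)
    finally show "(vnorm D (minimizer \<epsilon>))\<^sup>2 \<le> B\<^sup>2" using B(2) by simp
  qed
  show "F \<epsilon> (minimizer \<epsilon>) \<le> F \<epsilon> x" for x by (simp add: F_minimizer[OF e]) (simp add: F_def fval_nonneg)
qed

lemma co_measurable [measurable]: "(\<lambda>x. co \<epsilon> x j) \<in> borel_measurable (Rn D)"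
proof -
  have "(\<lambda>x. x i) \<in> borel_measurable (Rn D)" if "i \<in> blk j" for i
    using that Nn by (intro measurable_component_singleton) (auto simp: blk_def)
  then show ?thesis unfolding co_def by (intro borel_measurable_divide borel_measurable_sum borel_measurable_times) auto
qed

lemma ramp_measurable [measurable]: "ramp c \<in> borel_measurable borel"
  unfolding ramp_def[abs_def] by measurable

lemma hinge_measurable [measurable]: "hinge c \<in> borel_measurable borel"
  unfolding hinge_def[abs_def] by measurable

lemma F_measurable [measurable]: "F \<epsilon> \<in> borel_measurable (Rn D)"
  unfolding F_def[abs_def] fval_def by measurable

lemma lift_measurable:
  assumes "\<And>j. j < N \<Longrightarrow> (\<lambda>x. u x j) \<in> borel_measurable (Rn D)" "\<epsilon> \<in> signs"
  shows "(\<lambda>x. lift \<epsilon> (u x)) \<in> Rn D \<rightarrow>\<^sub>M Rn D"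
  unfolding lift_def
proof (rule measurable_restrict)
  fix i assume "i \<in> {..<D}"
  show "(\<lambda>x. u x (i div n) * \<epsilon> i / sqrt n) \<in> borel_measurable (Rn D)"
  proof (cases "i < N * n")
    case True
    then have "i div n < N" by (simp add: less_mult_imp_div_less)
    then show ?thesis by (intro borel_measurable_divide borel_measurable_times assms(1)) auto
  next
    case False
    then have "\<epsilon> i = 0" using assms(2) by (simp add: signs_def)
    then show ?thesis by simp
  qed
qed

lemma finite_signs: "finite signs"
proof -
  have "signs \<subseteq> (\<lambda>f i. if i < N * n then f i else 0) ` ({..<N * n} \<rightarrow>\<^sub>E {1, -1})"
  proof
    fix \<epsilon> assume "\<epsilon> \<in> signs"
    then have "\<epsilon> = (\<lambda>i. if i < N * n then restrict \<epsilon> {..<N * n} i else 0)"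
      and "restrict \<epsilon> {..<N * n} \<in> {..<N * n} \<rightarrow>\<^sub>E {1, -1}" by (auto simp: signs_def)
    then show "\<epsilon> \<in> (\<lambda>f i. if i < N * n then f i else 0) ` ({..<N * n} \<rightarrow>\<^sub>E {1, -1})" by blast
  qed
  then show ?thesis by (rule finite_subset) (auto intro!: finite_PiE)
qed

lemma signs_nonempty: "signs \<noteq> {}"
  unfolding signs_def by (auto intro!: exI[of _ "\<lambda>i. if i < N * n then 1 else 0"])

end

section \<open>The oracle\<close>

lemma sg_oracle_noisy:
  fixes P :: "('o::finite) pmf"
  assumes A [measurable]: "\<And>w. A w \<in> Rn D \<rightarrow>\<^sub>M Rn D"
    and v: "\<And>x. x \<in> space (Rn D) \<Longrightarrow> has_gradient D F x (v x)"
    and mean: "\<And>x i. x \<in> space (Rn D) \<Longrightarrow> i < D \<Longrightarrow> (\<Sum>w\<in>UNIV. pmf P w * A w x i) = v x i"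
    and var: "\<And>x. x \<in> space (Rn D) \<Longrightarrow> (\<Sum>w\<in>UNIV. pmf P w * (vdist D (A w x) (v x))\<^sup>2) \<le> \<sigma>\<^sup>2"
  shows "sg_oracle D F \<sigma> (noisy D P A)"
  unfolding sg_oracle_def
proof (intro conjI noisy_measurable A ballI)
  fix x assume x: "x \<in> space (Rn D)"
  have m: "(\<lambda>w. A w x) \<in> measure_pmf P \<rightarrow>\<^sub>M Rn D" using x measurable_space[OF A] by auto
  have c: "(\<lambda>g. g i) \<in> borel_measurable (Rn D)" if "i < D" for i
    using that by (intro measurable_component_singleton) auto
  have I: "integrable (noisy D P A x) (\<lambda>g. g i)" "(\<integral>g. g i \<partial>noisy D P A x) = v x i" if i: "i < D" for i
  proof -
    show "integrable (noisy D P A x) (\<lambda>g. g i)"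
      unfolding noisy_def by (subst integrable_distr_eq[OF m c[OF i]])
        (rule integrable_measure_pmf_finite, rule finite)
    have "(\<integral>g. g i \<partial>noisy D P A x) = (\<integral>w. A w x i \<partial>P)"
      unfolding noisy_def by (subst integral_distr[OF m c[OF i]]) simp
    also have "\<dots> = (\<Sum>w\<in>UNIV. A w x i * pmf P w)"
      by (rule integral_measure_pmf_real) auto
    finally show "(\<integral>g. g i \<partial>noisy D P A x) = v x i" using mean[OF x i] by (simp add: mult.commute)
  qed
  have "(\<integral>\<^sup>+g. ennreal ((vdist D g (v x))\<^sup>2) \<partial>noisy D P A x) = (\<integral>\<^sup>+w. ennreal ((vdist D (A w x) (v x))\<^sup>2) \<partial>P)"
  proof (rule nn_integral_noisy[OF A x])
    show "(\<lambda>g. ennreal ((vdist D g (v x))\<^sup>2)) \<in> borel_measurable (Rn D)"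
      unfolding vdist_sq using c by (auto intro!: borel_measurable_sum borel_measurable_power borel_measurable_diff measurable_compose[OF _ measurable_ennreal])
  qed
  also have "\<dots> = (\<Sum>w\<in>UNIV. ennreal ((vdist D (A w x) (v x))\<^sup>2) * pmf P w)"
    by (subst nn_integral_measure_pmf_support[of UNIV]) (auto simp: nn_integral_count_space_finite)
  also have "\<dots> = ennreal (\<Sum>w\<in>UNIV. pmf P w * (vdist D (A w x) (v x))\<^sup>2)"
    by (simp add: ennreal_mult'[symmetric] mult.commute sum_ennreal)
  also have "\<dots> \<le> ennreal (\<sigma>\<^sup>2)" by (intro ennreal_leI var x)
  finally show "\<exists>v. has_gradient D F x v \<and>
        (\<forall>i<D. integrable (noisy D P A x) (\<lambda>g. g i) \<and> (\<integral>g. g i \<partial>noisy D P A x) = v i) \<and>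
        (\<integral>\<^sup>+g. ennreal ((vdist D g v)\<^sup>2) \<partial>noisy D P A x) \<le> ennreal (\<sigma>\<^sup>2)"
    using v[OF x] I by (intro exI[of _ "v x"]) auto
qed

text \<open>As \<open>lift \<epsilon>\<close> is a linear isometry, mean and variance can be checked
  in the chain coordinates.\<close>

lemma (in chain) sg_oracle_lift:
  fixes P :: "('o::finite) pmf"
  assumes e: "\<epsilon> \<in> signs" and c: "\<And>w j. j < N \<Longrightarrow> (\<lambda>x. c w x j) \<in> borel_measurable (Rn D)"
    and mean: "\<And>x j. x \<in> space (Rn D) \<Longrightarrow> j < N \<Longrightarrow> (\<Sum>w\<in>UNIV. pmf P w * c w x j) = fgrad (co \<epsilon> x) j"
    and var: "\<And>x. x \<in> space (Rn D) \<Longrightarrow>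
      (\<Sum>j<N. \<Sum>w\<in>UNIV. pmf P w * (c w x j - fgrad (co \<epsilon> x) j)\<^sup>2) \<le> \<sigma>\<^sup>2"
  shows "sg_oracle D (F \<epsilon>) \<sigma> (noisy D P (\<lambda>w x. lift \<epsilon> (c w x)))"
proof (rule sg_oracle_noisy[where v = "\<lambda>x. lift \<epsilon> (fgrad (co \<epsilon> x))"])
  fix x assume x: "x \<in> space (Rn D)"
  show "(\<Sum>w\<in>UNIV. pmf P w * lift \<epsilon> (c w x) i) = lift \<epsilon> (fgrad (co \<epsilon> x)) i" if i: "i < D" for i
  proof (cases "i < N * n")
    case True
    then have "i div n < N" by (simp add: less_mult_imp_div_less)
    have "(\<Sum>w\<in>UNIV. pmf P w * lift \<epsilon> (c w x) i) = (\<Sum>w\<in>UNIV. pmf P w * c w x (i div n)) * (\<epsilon> i / sqrt n)"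
      unfolding sum_distrib_right using i by (intro sum.cong) (auto simp: lift_def)
    also have "\<dots> = lift \<epsilon> (fgrad (co \<epsilon> x)) i"
      using i by (simp add: mean[OF x \<open>i div n < N\<close>] lift_def)
    finally show ?thesis .
  next
    case False
    then have "\<epsilon> i = 0" using e by (simp add: signs_def)
    then show ?thesis using i by (simp add: lift_def)
  qed
  have "(\<Sum>w\<in>UNIV. pmf P w * (vdist D (lift \<epsilon> (c w x)) (lift \<epsilon> (fgrad (co \<epsilon> x))))\<^sup>2) =
    (\<Sum>j<N. \<Sum>w\<in>UNIV. pmf P w * (c w x j - fgrad (co \<epsilon> x) j)\<^sup>2)"
    by (simp add: vdist_lift[OF e] sum_distrib_left sum.swap[of _ UNIV])
  then show "(\<Sum>w\<in>UNIV. pmf P w * (vdist D (lift \<epsilon> (c w x)) (lift \<epsilon> (fgrad (co \<epsilon> x))))\<^sup>2) \<le> \<sigma>\<^sup>2"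
    using var[OF x] by simp
qed (use c e in \<open>auto intro!: lift_measurable F_has_gradient\<close>)

abbreviation coins :: "real \<Rightarrow> real \<Rightarrow> (bool \<times> bool) pmf" where
  "coins q p \<equiv> pair_pmf (bernoulli_pmf q) (bernoulli_pmf p)"

lemma sum_coins:
  assumes "0 \<le> q" "q \<le> 1" "0 \<le> p" "p \<le> 1"
  shows "(\<Sum>w\<in>UNIV. pmf (coins q p) w * f w) =
    q * (p * f (True, True) + (1 - p) * f (True, False)) +
    (1 - q) * (p * f (False, True) + (1 - p) * f (False, False))"
proof -
  have U: "(UNIV :: (bool \<times> bool) set) = {(True, True), (True, False), (False, True), (False, False)}"
    by (auto simp: UNIV_Times_UNIV[symmetric] UNIV_bool simp del: UNIV_Times_UNIV)
  show ?thesis unfolding U using assms by (simp add: pmf_pair algebra_simps)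
qed

section \<open>An oracle that hides the unreached part of the chain\<close>

locale hidden_chain = chain +
  fixes \<gamma> t p q :: real
  assumes p: "0 < p" "p \<le> 1" and q: "0 < q" "q \<le> 1" and \<gamma>: "0 < \<gamma>" and t: "0 < t"
begin

text \<open>The block of \<open>x\<close> is more correlated with its signs than chance explains:
  for signs independent of \<open>x\<close> this has probability at most
  \<open>2 * exp (- t\<^sup>2 / 2)\<close>. The inequality is strict so that zero signs are never
  \<open>big\<close>.\<close>

definition big :: "(nat \<Rightarrow> real) \<Rightarrow> rvec \<Rightarrow> nat \<Rightarrow> bool" where
  "big \<epsilon> x l \<longleftrightarrow> (co \<epsilon> x l)\<^sup>2 > t\<^sup>2 / n * (\<Sum>i\<in>blk l. (x i)\<^sup>2)"

text \<open>
  The coordinates that a query \<open>x\<close> has certainly reached.  The thresholds depend on the block of \<open>x\<close>,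
  not only on its norm, so that the reached coordinates can be found without knowing the signs in the
  blocks that \<open>x\<close> has not reached.
\<close>

definition act :: "(nat \<Rightarrow> real) \<Rightarrow> rvec \<Rightarrow> nat \<Rightarrow> bool" where
  "act \<epsilon> x j \<longleftrightarrow> \<gamma> < vnorm D x \<or> (\<exists>l\<in>{j..<N}. big \<epsilon> x l)"

definition tr :: "(nat \<Rightarrow> real) \<Rightarrow> rvec \<Rightarrow> nat \<Rightarrow> real" where
  "tr \<epsilon> x j = (if act \<epsilon> x j then co \<epsilon> x j else 0)"

text \<open>
  The first coin asks for the correction that makes the oracle unbiased, the second one reveals the next
  coordinate.
\<close>

definition coef :: "(nat \<Rightarrow> real) \<Rightarrow> bool \<times> bool \<Rightarrow> rvec \<Rightarrow> nat \<Rightarrow> real" where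
  "coef \<epsilon> w x j =
    (if fst w then fgrad (tr \<epsilon> x) j + (fgrad (co \<epsilon> x) j - fgrad (tr \<epsilon> x) j) / q
     else if act \<epsilon> x j then fgrad (tr \<epsilon> x) j
     else if snd w then fgrad (tr \<epsilon> x) j / p else 0)"

lemma act_antimono: "act \<epsilon> x l \<Longrightarrow> j \<le> l \<Longrightarrow> act \<epsilon> x j"
  unfolding act_def by (meson atLeastLessThan_iff order_trans)

text \<open>The truncated coordinates \<open>j - 1\<close>, \<open>j\<close> and
  \<open>Suc j\<close> are all \<open>0\<close>, so both ramps equal \<open>\<delta>\<close> and
  cancel. Of the inactive coordinates only the first can thus have a nonzero gradient. Coordinate
  \<open>0\<close> is excluded because it has only one ramp.\<close>

lemma fgrad_tr_inactive:
  assumes "\<not> act \<epsilon> x j" "\<not> act \<epsilon> x (j - 1)" "0 < j"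
  shows "fgrad (tr \<epsilon> x) j = 0"
proof -
  have "\<not> act \<epsilon> x (Suc j)" using assms(1) act_antimono[of \<epsilon> x "Suc j" j] by auto
  then show ?thesis using assms by (simp add: fgrad_def tr_def)
qed

lemma fgrad_tr_front:
  assumes "\<not> act \<epsilon> x j" shows "(fgrad (tr \<epsilon> x) j)\<^sup>2 \<le> (h * \<delta>)\<^sup>2"
proof -
  have "\<not> act \<epsilon> x (Suc j)" using assms act_antimono[of \<epsilon> x "Suc j" j] by auto
  then have "fgrad (tr \<epsilon> x) j = h * ((if j = 0 then 0 else ramp \<delta> (\<delta> - tr \<epsilon> x (j - 1))) - \<delta>)"
    using assms \<delta> by (simp add: fgrad_def tr_def) (simp add: ramp_def)
  moreover have "\<bar>(if j = 0 then 0 else ramp \<delta> (\<delta> - tr \<epsilon> x (j - 1))) - \<delta>\<bar> \<le> \<delta>"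
    using ramp_bounds[of \<delta>] \<delta> by (simp add: abs_le_iff)
  ultimately show ?thesis
    using h \<delta> by (simp add: power_mult_distrib abs_le_square_iff[symmetric])
qed

text \<open>Only the first inactive coordinate contributes, so the variance caused by the reveal
  coin does not grow with the length of the chain.\<close>

lemma sum_front:
  "(\<Sum>j<N. if act \<epsilon> x j then 0 else (fgrad (tr \<epsilon> x) j)\<^sup>2) \<le> (h * \<delta>)\<^sup>2"
proof (cases "\<exists>j. \<not> act \<epsilon> x j")
  case True
  define k where "k = (LEAST j. \<not> act \<epsilon> x j)"
  have k: "\<not> act \<epsilon> x k" unfolding k_def using True by (rule LeastI_ex)
  have "(if act \<epsilon> x j then 0 else (fgrad (tr \<epsilon> x) j)\<^sup>2) \<le> (if j = k then (h * \<delta>)\<^sup>2 else 0)" for j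
  proof (cases "act \<epsilon> x j \<or> j = k")
    case False
    then have "k < j" using Least_le[of "\<lambda>j. \<not> act \<epsilon> x j" j] by (auto simp: k_def)
    then have "\<not> act \<epsilon> x (j - 1)" using k act_antimono[of \<epsilon> x "j - 1" k] \<open>k < j\<close> by linarith
    then show ?thesis using False \<open>k < j\<close> by (simp add: fgrad_tr_inactive)
  qed (use k fgrad_tr_front[OF k] in auto)
  then have "(\<Sum>j<N. if act \<epsilon> x j then 0 else (fgrad (tr \<epsilon> x) j)\<^sup>2) \<le> (\<Sum>j<N. if j = k then (h * \<delta>)\<^sup>2 else 0)"
    by (intro sum_mono)
  also have "\<dots> \<le> (h * \<delta>)\<^sup>2" by simp
  finally show ?thesis .
qed (use h \<delta> in simp)

text \<open>The square of a truncated coordinate is below a threshold proportional to the squared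
  norm of its own block, and these add up to at most \<open>\<gamma>\<^sup>2\<close>. The bound
  therefore does not grow with \<open>N\<close>.\<close>

lemma sum_correction:
  assumes e: "\<epsilon> \<in> signs"
  shows "(\<Sum>j<N. (fgrad (co \<epsilon> x) j - fgrad (tr \<epsilon> x) j)\<^sup>2) \<le> 16 * h\<^sup>2 * t\<^sup>2 * \<gamma>\<^sup>2 / n"
proof -
  have le: "(\<Sum>j<N. (co \<epsilon> x j - tr \<epsilon> x j)\<^sup>2) \<le> t\<^sup>2 / n * \<gamma>\<^sup>2"
  proof (cases "\<gamma> < vnorm D x")
    case True
    \<comment> \<open>Beyond radius \<open>\<gamma>\<close> every coordinate is active and nothing
      is truncated. This keeps the variance bounded on the whole space.\<close>
    then show ?thesis by (simp add: tr_def act_def)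
  next
    case False
    have "(co \<epsilon> x j - tr \<epsilon> x j)\<^sup>2 \<le> t\<^sup>2 / n * (\<Sum>i\<in>blk j. (x i)\<^sup>2)" if "j < N" for j
      using that by (auto simp: tr_def act_def big_def not_less sum_nonneg)
    then have 1: "(\<Sum>j<N. (co \<epsilon> x j - tr \<epsilon> x j)\<^sup>2) \<le> t\<^sup>2 / n * (\<Sum>j<N. \<Sum>i\<in>blk j. (x i)\<^sup>2)"
      unfolding sum_distrib_left by (intro sum_mono) auto
    have "(\<Sum>j<N. \<Sum>i\<in>blk j. (x i)\<^sup>2) = (\<Sum>i<N * n. (x i)\<^sup>2)" by (rule sum_blocks[symmetric])
    also have "\<dots> \<le> (\<Sum>i<D. (x i)\<^sup>2)" using Nn by (intro sum_mono2) auto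
    also have "\<dots> \<le> \<gamma>\<^sup>2" unfolding vnorm_sq[symmetric] using False by (intro power_mono L2_set_nonneg) auto
    finally show ?thesis by (intro order_trans[OF 1] mult_left_mono) auto
  qed
  have "(\<Sum>j<N. (fgrad (co \<epsilon> x) j - fgrad (tr \<epsilon> x) j)\<^sup>2) \<le> (4 * h)\<^sup>2 * (\<Sum>j<N. (co \<epsilon> x j - tr \<epsilon> x j)\<^sup>2)"
    by (rule fgrad_lipschitz) (simp add: tr_def co_outside)
  also have "\<dots> \<le> (4 * h)\<^sup>2 * (t\<^sup>2 / n * \<gamma>\<^sup>2)" by (intro mult_left_mono le) simp
  finally show ?thesis by (simp add: power_mult_distrib)
qed

text \<open>The reveal coin is unbiased for the truncated gradient, and the correction adds the
  remainder with weight \<open>1 / q\<close>.\<close>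

lemma coef_mean:
  "(\<Sum>w\<in>UNIV. pmf (coins q p) w * coef \<epsilon> w x j) = fgrad (co \<epsilon> x) j"
  using p q by (subst sum_coins) (auto simp: coef_def field_simps)

lemma coef_var:
  "(\<Sum>w\<in>UNIV. pmf (coins q p) w * (coef \<epsilon> w x j - fgrad (co \<epsilon> x) j)\<^sup>2) \<le>
    (fgrad (co \<epsilon> x) j - fgrad (tr \<epsilon> x) j)\<^sup>2 / q + (if act \<epsilon> x j then 0 else (1 / p - 1) * (fgrad (tr \<epsilon> x) j)\<^sup>2)"
proof -
  define b where "b = fgrad (tr \<epsilon> x) j"
  define e where "e = fgrad (co \<epsilon> x) j - b"
  have g: "fgrad (co \<epsilon> x) j = b + e" by (simp add: e_def)
  have c: "coef \<epsilon> w x j - fgrad (co \<epsilon> x) j = (if fst w then e / q - e else if act \<epsilon> x j then - e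
      else if snd w then b / p - b - e else - b - e)" for w
    by (simp add: coef_def b_def[symmetric] g)
  \<comment> \<open>The variance of a remainder \<open>e\<close> that is shown as
    \<open>e / q\<close> with probability \<open>q\<close>.\<close>
  have eq: "q * (e / q - e)\<^sup>2 + (1 - q) * e\<^sup>2 = e\<^sup>2 / q - e\<^sup>2"
    using q by (simp add: power2_eq_square field_simps)
  \<comment> \<open>The variance of the reveal coin around \<open>b\<close>, plus the squared bias
    \<open>e\<^sup>2\<close>.\<close>
  have eb: "p * (b / p - b - e)\<^sup>2 + (1 - p) * (- b - e)\<^sup>2 = (1 / p - 1) * b\<^sup>2 + e\<^sup>2"
    using p by (simp add: power2_eq_square field_simps)
  have e2: "0 \<le> e\<^sup>2" by simp
  show ?thesis
  proof (cases "act \<epsilon> x j")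
    case True
    then have "(\<Sum>w\<in>UNIV. pmf (coins q p) w * (coef \<epsilon> w x j - fgrad (co \<epsilon> x) j)\<^sup>2) = q * (e / q - e)\<^sup>2 + (1 - q) * e\<^sup>2"
      unfolding c using p q by (subst sum_coins) (auto simp: algebra_simps)
    then show ?thesis using True e2 eq by (simp add: e_def b_def)
  next
    case False
    then have "(\<Sum>w\<in>UNIV. pmf (coins q p) w * (coef \<epsilon> w x j - fgrad (co \<epsilon> x) j)\<^sup>2) =
      q * (e / q - e)\<^sup>2 + (1 - q) * (p * (b / p - b - e)\<^sup>2 + (1 - p) * (- b - e)\<^sup>2)"
      unfolding c using p q by (subst sum_coins) (auto simp: algebra_simps)
    also have "\<dots> = (e\<^sup>2 / q - e\<^sup>2) + (1 - q) * ((1 / p - 1) * b\<^sup>2)"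
      unfolding eb using eq by (simp add: algebra_simps)
    also have "\<dots> \<le> e\<^sup>2 / q + 1 * ((1 / p - 1) * b\<^sup>2)"
      using e2 q p by (intro add_mono mult_right_mono mult_nonneg_nonneg) auto
    finally show ?thesis using False by (simp add: e_def b_def)
  qed
qed

lemma big_measurable [measurable]: "Measurable.pred (Rn D) (\<lambda>x. big \<epsilon> x l)"
proof -
  have "(\<lambda>x. x i) \<in> borel_measurable (Rn D)" if "i \<in> blk l" for i
    using that Nn by (intro measurable_component_singleton) (auto simp: blk_def)
  then have [measurable]: "(\<lambda>x. \<Sum>i\<in>blk l. (x i)\<^sup>2) \<in> borel_measurable (Rn D)"
    by (intro borel_measurable_sum borel_measurable_power)
  show ?thesis unfolding big_def by measurable
qed

lemma act_measurable [measurable]: "Measurable.pred (Rn D) (\<lambda>x. act \<epsilon> x j)"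
proof -
  have "(\<lambda>x. x i) \<in> borel_measurable (Rn D)" if "i < D" for i
    using that by (intro measurable_component_singleton) auto
  then have [measurable]: "(\<lambda>x. vnorm D x) \<in> borel_measurable (Rn D)"
    unfolding L2_set_def by (intro measurable_compose[OF _ borel_measurable_sqrt] borel_measurable_sum borel_measurable_power) auto
  show ?thesis unfolding act_def by measurable
qed

lemma coef_measurable: "(\<lambda>x. coef \<epsilon> w x j) \<in> borel_measurable (Rn D)"
proof -
  have [measurable]: "(\<lambda>x. tr \<epsilon> x i) \<in> borel_measurable (Rn D)" for i
    unfolding tr_def by measurable
  have [measurable]: "(\<lambda>x. fgrad (tr \<epsilon> x) j) \<in> borel_measurable (Rn D)"
    "(\<lambda>x. fgrad (co \<epsilon> x) j) \<in> borel_measurable (Rn D)"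
    unfolding fgrad_def by measurable
  show ?thesis unfolding coef_def by measurable
qed

definition ans :: "(nat \<Rightarrow> real) \<Rightarrow> bool \<times> bool \<Rightarrow> rvec \<Rightarrow> rvec" where
  "ans \<epsilon> w x = lift \<epsilon> (coef \<epsilon> w x)"

lemma ans_measurable: "\<epsilon> \<in> signs \<Longrightarrow> ans \<epsilon> w \<in> Rn D \<rightarrow>\<^sub>M Rn D"
  unfolding ans_def[abs_def] by (intro lift_measurable coef_measurable)

lemma sg_oracle_ans:
  assumes e: "\<epsilon> \<in> signs" and s: "16 * h\<^sup>2 * t\<^sup>2 * \<gamma>\<^sup>2 / n / q + (1 / p - 1) * (h * \<delta>)\<^sup>2 \<le> \<sigma>\<^sup>2"
  shows "sg_oracle D (F \<epsilon>) \<sigma> (noisy D (coins q p) (ans \<epsilon>))"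
  unfolding ans_def[abs_def]
proof (rule sg_oracle_lift[OF e])
  fix x
  have "(\<Sum>j<N. \<Sum>w\<in>UNIV. pmf (coins q p) w * (coef \<epsilon> w x j - fgrad (co \<epsilon> x) j)\<^sup>2)
    \<le> (\<Sum>j<N. (fgrad (co \<epsilon> x) j - fgrad (tr \<epsilon> x) j)\<^sup>2 / q + (1 / p - 1) * (if act \<epsilon> x j then 0 else (fgrad (tr \<epsilon> x) j)\<^sup>2))"
    by (intro sum_mono order_trans[OF coef_var]) auto
  also have "\<dots> = (\<Sum>j<N. (fgrad (co \<epsilon> x) j - fgrad (tr \<epsilon> x) j)\<^sup>2) / q +
      (1 / p - 1) * (\<Sum>j<N. if act \<epsilon> x j then 0 else (fgrad (tr \<epsilon> x) j)\<^sup>2)"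
    by (simp only: sum.distrib sum_divide_distrib sum_distrib_left)
  also have "\<dots> \<le> 16 * h\<^sup>2 * t\<^sup>2 * \<gamma>\<^sup>2 / n / q + (1 / p - 1) * (h * \<delta>)\<^sup>2"
    using p q by (intro add_mono divide_right_mono mult_left_mono sum_correction[OF e] sum_front) auto
  finally show "(\<Sum>j<N. \<Sum>w\<in>UNIV. pmf (coins q p) w * (coef \<epsilon> w x j - fgrad (co \<epsilon> x) j)\<^sup>2) \<le> \<sigma>\<^sup>2"
    using s by linarith
qed (use p q in \<open>simp_all add: coef_mean coef_measurable\<close>)

text \<open>Unknown signs are replaced by \<open>0\<close>. The result is in general not in
  \<open>signs\<close>, but \<open>ans\<close> makes sense for it.\<close>

definition trunc :: "nat \<Rightarrow> (nat \<Rightarrow> real) \<Rightarrow> nat \<Rightarrow> real" where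
  "trunc c \<epsilon> i = (if i div n < c then \<epsilon> i else 0)"

lemma co_trunc: "co (trunc c \<epsilon>) x l = (if l < c then co \<epsilon> x l else 0)"
  by (auto simp: co_def trunc_def blk_def intro!: sum.neutral)

text \<open>The locality of the oracle: without a correction, the answer carries no information on
  the blocks from \<open>c'\<close> on. A reveal coin shows just one block more, since only the
  first inactive coordinate of the truncated gradient can be nonzero.\<close>

lemma ans_trunc:
  assumes x: "vnorm D x \<le> \<gamma>" and small: "\<And>l. c \<le> l \<Longrightarrow> l < N \<Longrightarrow> \<not> big \<epsilon> x l"
    and w: "\<not> fst w" and c': "c' = (if snd w then Suc c else c)"
  shows "ans \<epsilon> w x = ans (trunc c' \<epsilon>) w x"
proof -
  have nb: "\<not> big (trunc c' \<epsilon>) x l" if "c' \<le> l" for l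
    using that by (simp add: big_def co_trunc not_less sum_nonneg)
  have "big (trunc c' \<epsilon>) x l = big \<epsilon> x l" if "l < N" for l
  proof (cases "l < c'")
    case False
    then show ?thesis using nb[of l] small[of l] that c' by (auto split: if_splits)
  qed (simp add: big_def co_trunc)
  then have act: "act (trunc c' \<epsilon>) x = act \<epsilon> x" by (auto simp: act_def fun_eq_iff)
  have na: "\<not> act \<epsilon> x j" if "c \<le> j" for j
    using that x small by (auto simp: act_def)
  have tr: "tr (trunc c' \<epsilon>) x = tr \<epsilon> x"
  proof
    show "tr (trunc c' \<epsilon>) x j = tr \<epsilon> x j" for j
      using na[of j] c' unfolding tr_def act co_trunc by (auto split: if_splits)
  qed
  have co: "coef (trunc c' \<epsilon>) w x = coef \<epsilon> w x" using w by (simp add: coef_def act tr fun_eq_iff)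
  \<comment> \<open>If the reveal coin shows, then \<open>c' = Suc c\<close>, and both
    \<open>j\<close> and \<open>j - 1\<close> are inactive; otherwise inactive coordinates are
    answered by \<open>0\<close>.\<close>
  have "coef \<epsilon> w x j = 0" if "c' \<le> j" for j
  proof -
    have "c \<le> j" using that c' by (auto split: if_splits)
    moreover have "fgrad (tr \<epsilon> x) j = 0" if "snd w"
      using that \<open>c' \<le> j\<close> c' by (intro fgrad_tr_inactive na) auto
    ultimately show ?thesis using w na by (simp add: coef_def)
  qed
  then show ?thesis unfolding ans_def co by (auto simp: lift_def trunc_def not_less)
qed

end

section \<open>Concentration of random signs\<close>

text \<open>The moment bound for a fair sign. It is the analytic part of Hoeffding's lemma for a
  coin of bias \<open>1 / 2\<close> and an interval of length \<open>2 * y\<close>; negative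
  \<open>x\<close> follow by symmetry.\<close>

lemma exp_plus_exp_minus_le: "exp x + exp (- x) \<le> 2 * exp (x\<^sup>2 / 2)" for x :: real
proof -
  have *: "exp y + exp (- y) \<le> 2 * exp (y\<^sup>2 / 2)" if "0 \<le> y" for y :: real
  proof -
    have pos: "0 < 1 + 1 / 2 * (exp (2 * y) - 1)" using exp_gt_zero[of "2 * y"] by (simp add: field_simps add_pos_pos)
    have "- (2 * y) * (1 / 2) + ln (1 + 1 / 2 * (exp (2 * y) - 1)) \<le> (2 * y)\<^sup>2 / 8"
      by (rule Hoeffdings_lemma_aux) (use that in auto)
    then have "ln (1 + 1 / 2 * (exp (2 * y) - 1)) \<le> y\<^sup>2 / 2 + y" by (simp add: power_mult_distrib)
    then have "1 + 1 / 2 * (exp (2 * y) - 1) \<le> exp (y\<^sup>2 / 2 + y)" using pos by (metis exp_le_cancel_iff exp_ln)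
    moreover have "1 + a \<le> 2 * b" if "1 + 1 / 2 * (a - 1) \<le> b" for a b :: real
      using that by (simp add: field_simps)
    ultimately have "1 + exp (2 * y) \<le> 2 * exp (y\<^sup>2 / 2 + y)" by blast
    then have "(1 + exp (2 * y)) * exp (- y) \<le> 2 * exp (y\<^sup>2 / 2 + y) * exp (- y)"
      by (intro mult_right_mono) auto
    then show ?thesis by (simp add: distrib_right mult.assoc exp_add[symmetric])
  qed
  show ?thesis using *[of x] *[of "- x"] by (cases "0 \<le> x") (auto simp: add.commute)
qed

context chain begin

abbreviation neg :: "nat \<Rightarrow> (nat \<Rightarrow> real) \<Rightarrow> nat \<Rightarrow> real" where "neg i \<epsilon> \<equiv> \<epsilon>(i := - \<epsilon> i)"

lemma neg_signs: "\<epsilon> \<in> signs \<Longrightarrow> neg i \<epsilon> \<in> signs"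
  by (auto simp: signs_def)

lemma sum_signs_neg: "(\<Sum>\<epsilon>\<in>signs. g (neg i \<epsilon>)) = (\<Sum>\<epsilon>\<in>signs. g \<epsilon> :: real)"
  by (rule sum.reindex_bij_witness[where i = "neg i" and j = "neg i"]) (auto intro!: neg_signs)

text \<open>A moment bound for adaptive vectors: \<open>a\<close> may depend on the signs outside
  \<open>J\<close>, as a query does. The weight \<open>\<Phi>\<close> is there for the induction,
  where it absorbs the factor of the coordinate that is removed.\<close>

lemma sum_signs_exp:
  assumes "finite J" "J \<subseteq> {..<N * n}"
    and "\<And>\<epsilon>. \<epsilon> \<in> signs \<Longrightarrow> 0 \<le> \<Phi> \<epsilon>"
    and "\<And>\<epsilon> i. \<epsilon> \<in> signs \<Longrightarrow> i \<in> J \<Longrightarrow> \<Phi> (neg i \<epsilon>) = \<Phi> \<epsilon>"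
    and "\<And>\<epsilon> i. \<epsilon> \<in> signs \<Longrightarrow> i \<in> J \<Longrightarrow> a (neg i \<epsilon>) = a \<epsilon>"
  shows "(\<Sum>\<epsilon>\<in>signs. \<Phi> \<epsilon> * exp (\<Sum>i\<in>J. \<epsilon> i * a \<epsilon> i)) \<le> (\<Sum>\<epsilon>\<in>signs. \<Phi> \<epsilon> * exp (\<Sum>i\<in>J. (a \<epsilon> i)\<^sup>2 / 2))"
  using assms
proof (induction J arbitrary: \<Phi>)
  case (insert i J)
  define g where "g \<epsilon> = \<Phi> \<epsilon> * exp (\<Sum>i\<in>insert i J. \<epsilon> i * a \<epsilon> i)" for \<epsilon>
  define \<Psi> where "\<Psi> \<epsilon> = \<Phi> \<epsilon> * exp ((a \<epsilon> i)\<^sup>2 / 2)" for \<epsilon>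
  \<comment> \<open>Pairing \<open>\<epsilon>\<close> with \<open>neg i \<epsilon>\<close> averages
    over one sign while everything else stays fixed.\<close>
  have "g \<epsilon> + g (neg i \<epsilon>) \<le> 2 * (\<Psi> \<epsilon> * exp (\<Sum>i\<in>J. \<epsilon> i * a \<epsilon> i))" if e: "\<epsilon> \<in> signs" for \<epsilon>
  proof -
    have inv: "\<Phi> (neg i \<epsilon>) = \<Phi> \<epsilon>" "a (neg i \<epsilon>) = a \<epsilon>"
      by (rule insert.prems(3)[OF e] insert.prems(4)[OF e], simp)+
    have s: "(\<Sum>k\<in>J. neg i \<epsilon> k * a \<epsilon> k) = (\<Sum>k\<in>J. \<epsilon> k * a \<epsilon> k)"
      using insert.hyps by (intro sum.cong) auto
    have "g \<epsilon> + g (neg i \<epsilon>) = \<Phi> \<epsilon> * exp (\<Sum>k\<in>J. \<epsilon> k * a \<epsilon> k) * (exp (\<epsilon> i * a \<epsilon> i) + exp (- (\<epsilon> i * a \<epsilon> i)))"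
      unfolding g_def inv using insert.hyps s by (simp add: exp_add exp_diff exp_minus divide_inverse algebra_simps)
    also have "\<dots> \<le> \<Phi> \<epsilon> * exp (\<Sum>k\<in>J. \<epsilon> k * a \<epsilon> k) * (2 * exp ((\<epsilon> i * a \<epsilon> i)\<^sup>2 / 2))"
      using insert.prems(2)[OF e] by (intro mult_left_mono exp_plus_exp_minus_le) auto
    also have "(\<epsilon> i * a \<epsilon> i)\<^sup>2 = (a \<epsilon> i)\<^sup>2"
      using e insert.prems(1) by (auto simp: signs_def power_mult_distrib)
    finally show ?thesis by (simp only: \<Psi>_def mult_ac)
  qed
  then have "(\<Sum>\<epsilon>\<in>signs. g \<epsilon> + g (neg i \<epsilon>)) \<le> (\<Sum>\<epsilon>\<in>signs. 2 * (\<Psi> \<epsilon> * exp (\<Sum>i\<in>J. \<epsilon> i * a \<epsilon> i)))"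
    by (intro sum_mono)
  then have "(\<Sum>\<epsilon>\<in>signs. g \<epsilon>) \<le> (\<Sum>\<epsilon>\<in>signs. \<Psi> \<epsilon> * exp (\<Sum>i\<in>J. \<epsilon> i * a \<epsilon> i))"
    by (simp add: sum.distrib sum_signs_neg sum_distrib_left[symmetric])
  also have "\<dots> \<le> (\<Sum>\<epsilon>\<in>signs. \<Psi> \<epsilon> * exp (\<Sum>i\<in>J. (a \<epsilon> i)\<^sup>2 / 2))"
    by (rule insert.IH) (use insert.prems in \<open>auto simp: \<Psi>_def\<close>)
  also have "\<dots> = (\<Sum>\<epsilon>\<in>signs. \<Phi> \<epsilon> * exp (\<Sum>i\<in>insert i J. (a \<epsilon> i)\<^sup>2 / 2))"
    using insert.hyps by (simp add: \<Psi>_def exp_add mult.assoc)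
  finally show ?case by (simp add: g_def)
qed simp

text \<open>Markov's inequality for the exponential moment. The vector is scaled to length at most
  \<open>t\<close>, which makes exponent \<open>1\<close> the right choice.\<close>

lemma card_signs_one_sided:
  assumes J: "finite J" "J \<subseteq> {..<N * n}"
    and inv: "\<And>\<epsilon> i. \<epsilon> \<in> signs \<Longrightarrow> i \<in> J \<Longrightarrow> a (neg i \<epsilon>) = a \<epsilon>"
    and norm: "\<And>\<epsilon>. (\<Sum>i\<in>J. (a \<epsilon> i)\<^sup>2) \<le> t\<^sup>2"
  shows "real (card {\<epsilon> \<in> signs. t\<^sup>2 < (\<Sum>i\<in>J. \<epsilon> i * a \<epsilon> i)}) \<le> exp (- t\<^sup>2 / 2) * card signs"
proof -
  have "real (card {\<epsilon> \<in> signs. t\<^sup>2 < (\<Sum>i\<in>J. \<epsilon> i * a \<epsilon> i)}) = (\<Sum>\<epsilon> | \<epsilon> \<in> signs \<and> t\<^sup>2 < (\<Sum>i\<in>J. \<epsilon> i * a \<epsilon> i). 1)"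
    by simp
  also have "\<dots> \<le> (\<Sum>\<epsilon> | \<epsilon> \<in> signs \<and> t\<^sup>2 < (\<Sum>i\<in>J. \<epsilon> i * a \<epsilon> i). exp (- t\<^sup>2) * exp (\<Sum>i\<in>J. \<epsilon> i * a \<epsilon> i))"
    by (intro sum_mono) (auto simp: exp_add[symmetric])
  also have "\<dots> \<le> (\<Sum>\<epsilon>\<in>signs. exp (- t\<^sup>2) * exp (\<Sum>i\<in>J. \<epsilon> i * a \<epsilon> i))"
    using finite_signs by (intro sum_mono2) auto
  also have "\<dots> \<le> (\<Sum>\<epsilon>\<in>signs. exp (- t\<^sup>2) * exp (\<Sum>i\<in>J. (a \<epsilon> i)\<^sup>2 / 2))"
    by (rule sum_signs_exp[OF J, where \<Phi> = "\<lambda>_. exp (- t\<^sup>2)"]) (auto simp: inv)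
  also have "\<dots> \<le> (\<Sum>\<epsilon>\<in>signs. exp (- t\<^sup>2 / 2))"
  proof (intro sum_mono)
    show "exp (- t\<^sup>2) * exp (\<Sum>i\<in>J. (a \<epsilon> i)\<^sup>2 / 2) \<le> exp (- t\<^sup>2 / 2)" for \<epsilon>
      using norm[of \<epsilon>] by (simp add: exp_add[symmetric] sum_divide_distrib[symmetric])
  qed
  finally show ?thesis by (simp add: mult.commute)
qed

lemma card_signs_two_sided:
  assumes J: "finite J" "J \<subseteq> {..<N * n}" and t: "0 < t"
    and inv: "\<And>\<epsilon> i. \<epsilon> \<in> signs \<Longrightarrow> i \<in> J \<Longrightarrow> u (neg i \<epsilon>) = u \<epsilon>"
  shows "real (card {\<epsilon> \<in> signs. t\<^sup>2 * (\<Sum>i\<in>J. (u \<epsilon> i)\<^sup>2) < (\<Sum>i\<in>J. \<epsilon> i * u \<epsilon> i)\<^sup>2}) \<le> 2 * exp (- t\<^sup>2 / 2) * card signs"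
proof -
  define U where "U \<epsilon> = sqrt (\<Sum>i\<in>J. (u \<epsilon> i)\<^sup>2)" for \<epsilon>
  have U: "(U \<epsilon>)\<^sup>2 = (\<Sum>i\<in>J. (u \<epsilon> i)\<^sup>2)" "0 \<le> U \<epsilon>" for \<epsilon> by (auto simp: U_def sum_nonneg)
  \<comment> \<open>The vector \<open>u \<epsilon>\<close> rescaled to length \<open>t\<close>, with
    sign \<open>s\<close>. If it is zero on \<open>J\<close>, division by zero gives
    \<open>0\<close>, which satisfies the norm bound as well.\<close>
  define a where "a s \<epsilon> i = s * t * u \<epsilon> i / U \<epsilon>" for s :: real and \<epsilon> i
  let ?E = "\<lambda>s. {\<epsilon> \<in> signs. t\<^sup>2 < (\<Sum>i\<in>J. \<epsilon> i * a s \<epsilon> i)}"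
  have a_sum: "(\<Sum>i\<in>J. \<epsilon> i * a s \<epsilon> i) = s * t * (\<Sum>i\<in>J. \<epsilon> i * u \<epsilon> i) / U \<epsilon>" for s \<epsilon>
    by (simp add: a_def sum_distrib_left sum_divide_distrib mult_ac)
  have norm: "(\<Sum>i\<in>J. (a s \<epsilon> i)\<^sup>2) \<le> t\<^sup>2" if "s\<^sup>2 = 1" for s \<epsilon>
  proof -
    have "(\<Sum>i\<in>J. (a s \<epsilon> i)\<^sup>2) = t\<^sup>2 * (\<Sum>i\<in>J. (u \<epsilon> i)\<^sup>2) / (U \<epsilon>)\<^sup>2"
      using that by (simp add: a_def power_divide power_mult_distrib sum_distrib_left sum_divide_distrib)
    then show ?thesis by (simp add: U(1)[symmetric])
  qed
  have "{\<epsilon> \<in> signs. t\<^sup>2 * (\<Sum>i\<in>J. (u \<epsilon> i)\<^sup>2) < (\<Sum>i\<in>J. \<epsilon> i * u \<epsilon> i)\<^sup>2} \<subseteq> ?E 1 \<union> ?E (-1)"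
  proof
    fix \<epsilon> assume *: "\<epsilon> \<in> {\<epsilon> \<in> signs. t\<^sup>2 * (\<Sum>i\<in>J. (u \<epsilon> i)\<^sup>2) < (\<Sum>i\<in>J. \<epsilon> i * u \<epsilon> i)\<^sup>2}"
    define z where "z = (\<Sum>i\<in>J. \<epsilon> i * u \<epsilon> i)"
    have "U \<epsilon> \<noteq> 0"
    proof
      assume "U \<epsilon> = 0"
      then have "\<forall>i\<in>J. (u \<epsilon> i)\<^sup>2 = 0" using U(1)[of \<epsilon>] J by (subst sum_nonneg_eq_0_iff[symmetric]) auto
      then have "z = 0" by (simp add: z_def)
      then show False using * U(1)[of \<epsilon>] by (simp add: z_def \<open>U \<epsilon> = 0\<close> U(1)[symmetric])
    qed
    then have pos: "0 < U \<epsilon>" using U(2)[of \<epsilon>] by simp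
    have "(t * U \<epsilon>)\<^sup>2 < z\<^sup>2" using * by (simp add: power_mult_distrib U z_def)
    then have "t * U \<epsilon> < \<bar>z\<bar>" using t pos by (metis abs_le_square_iff abs_of_pos linorder_not_le mult_pos_pos)
    then have "t < \<bar>z\<bar> / U \<epsilon>" using pos by (simp add: pos_less_divide_eq)
    then have "t\<^sup>2 < t * (\<bar>z\<bar> / U \<epsilon>)" using mult_strict_left_mono[OF \<open>t < \<bar>z\<bar> / U \<epsilon>\<close> t] by (simp add: power2_eq_square)
    then have "t\<^sup>2 < 1 * t * z / U \<epsilon> \<or> t\<^sup>2 < (-1) * t * z / U \<epsilon>" by (cases "0 \<le> z") auto
    then show "\<epsilon> \<in> ?E 1 \<union> ?E (-1)" using * unfolding a_sum z_def by auto
  qed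
  then have "card {\<epsilon> \<in> signs. t\<^sup>2 * (\<Sum>i\<in>J. (u \<epsilon> i)\<^sup>2) < (\<Sum>i\<in>J. \<epsilon> i * u \<epsilon> i)\<^sup>2} \<le> card (?E 1 \<union> ?E (-1))"
    using finite_signs by (intro card_mono) auto
  also have "\<dots> \<le> card (?E 1) + card (?E (-1))" by (rule card_Un_le)
  finally have "real (card {\<epsilon> \<in> signs. t\<^sup>2 * (\<Sum>i\<in>J. (u \<epsilon> i)\<^sup>2) < (\<Sum>i\<in>J. \<epsilon> i * u \<epsilon> i)\<^sup>2}) \<le> card (?E 1) + card (?E (-1))"
    by simp
  also have "\<dots> \<le> exp (- t\<^sup>2 / 2) * card signs + exp (- t\<^sup>2 / 2) * card signs"
    unfolding of_nat_add by (intro add_mono card_signs_one_sided J norm) (auto simp: a_def U_def inv fun_eq_iff)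
  finally show ?thesis by (simp add: mult_ac)
qed

end

section \<open>Progress along the chain\<close>

text \<open>Also used with \<open>k\<close> in place of \<open>K\<close>, to count the reveal coins
  before the \<open>k\<close>-th query of a machine.\<close>

definition reveals :: "nat \<Rightarrow> (qindex \<Rightarrow> bool \<times> bool) \<Rightarrow> nat \<Rightarrow> nat \<Rightarrow> nat" where
  "reveals K \<omega> r m = card {k. k < K \<and> snd (\<omega> (m, k, r))}"

text \<open>After a round all machines can continue from the one that got furthest, hence the
  maximum per round.\<close>

definition progress :: "nat \<Rightarrow> nat \<Rightarrow> (qindex \<Rightarrow> bool \<times> bool) \<Rightarrow> nat \<Rightarrow> nat" where
  "progress M K \<omega> r = (\<Sum>s<r. Max (reveals K \<omega> s ` {..<M}))"

text \<open>Upper bounds for the number of blocks of signs that influence the query with index \<open>i\<close> and its answer.\<close>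

fun reached :: "nat \<Rightarrow> nat \<Rightarrow> (qindex \<Rightarrow> bool \<times> bool) \<Rightarrow> qindex \<Rightarrow> nat" where
  "reached M K \<omega> (m, k, r) = progress M K \<omega> r + reveals k \<omega> r m"

definition reached_after :: "nat \<Rightarrow> nat \<Rightarrow> (qindex \<Rightarrow> bool \<times> bool) \<Rightarrow> qindex \<Rightarrow> nat" where
  "reached_after M K \<omega> i = (if snd (\<omega> i) then Suc (reached M K \<omega> i) else reached M K \<omega> i)"

lemma reached_le_after: "reached M K \<omega> i \<le> reached_after M K \<omega> i"
  by (simp add: reached_after_def)

lemma reveals_mono: "k \<le> k' \<Longrightarrow> reveals k \<omega> r m \<le> reveals k' \<omega> r m"
  unfolding reveals_def by (intro card_mono) auto

lemma reached_after_eq: "reached_after M K \<omega> (m, k, r) = progress M K \<omega> r + reveals (Suc k) \<omega> r m"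
proof -
  have "{k'. k' < Suc k \<and> snd (\<omega> (m, k', r))} =
    (if snd (\<omega> (m, k, r)) then insert k {k'. k' < k \<and> snd (\<omega> (m, k', r))} else {k'. k' < k \<and> snd (\<omega> (m, k', r))})"
    by (auto simp: less_Suc_eq)
  then show ?thesis by (simp add: reached_after_def reveals_def)
qed

lemma progress_mono: "r \<le> s \<Longrightarrow> progress M K \<omega> r \<le> progress M K \<omega> s"
  unfolding progress_def by (intro sum_mono2) auto

lemma reached_after_le_progress:
  assumes "m < M" "k < K" "r < s"
  shows "reached_after M K \<omega> (m, k, r) \<le> progress M K \<omega> s"
proof -
  have "reached_after M K \<omega> (m, k, r) \<le> progress M K \<omega> r + reveals K \<omega> r m"
    unfolding reached_after_eq using assms by (intro add_left_mono reveals_mono) auto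
  also have "\<dots> \<le> progress M K \<omega> r + Max (reveals K \<omega> r ` {..<M})"
    using assms by (intro add_left_mono Max_ge) auto
  also have "\<dots> = progress M K \<omega> (Suc r)" by (simp add: progress_def)
  also have "\<dots> \<le> progress M K \<omega> s" using assms by (intro progress_mono) auto
  finally show ?thesis .
qed

text \<open>Here the communication pattern enters: an answer of the same round comes from the same
  machine and is covered by its own coins, an answer of an earlier round by the maximum over the
  machines.\<close>

lemma reached_after_past:
  assumes "j \<in> past M K i" shows "reached_after M K \<omega> j \<le> reached M K \<omega> i"
proof -
  obtain m k r where i: "i = (m, k, r)" by (cases i)
  consider k' where "j = (m, k', r)" "k' < k" | m' k' r' where "j = (m', k', r')" "m' < M" "k' < K" "r' < r"
    using assms by (auto simp: i)
  then show ?thesis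
  proof cases
    case 1
    then show ?thesis using reveals_mono[of "Suc k'" k \<omega> r m] by (simp add: i reached_after_eq)
  next
    case 2
    then show ?thesis using reached_after_le_progress[of m' M k' K r' r \<omega>] by (simp add: i)
  qed
qed

lemma reached_after_indices: "i \<in> indices M K R \<Longrightarrow> reached_after M K \<omega> i \<le> progress M K \<omega> R"
  by (auto simp: indices_def intro!: reached_after_le_progress)

context chain begin

definition flip :: "nat \<Rightarrow> (nat \<Rightarrow> real) \<Rightarrow> nat \<Rightarrow> real" where
  "flip c \<epsilon> i = (if i div n < c then \<epsilon> i else - \<epsilon> i)"

lemma flip_flip: "flip c (flip c \<epsilon>) = \<epsilon>" by (auto simp: flip_def)

lemma flip_signs: "\<epsilon> \<in> signs \<Longrightarrow> flip c \<epsilon> \<in> signs" by (auto simp: flip_def signs_def)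

lemma co_flip: "co (flip c \<epsilon>) x l = (if l < c then co \<epsilon> x l else - co \<epsilon> x l)"
  by (auto simp: co_def flip_def blk_def sum_negf)

text \<open>In a link from \<open>c\<close> on, both end points change sign, so the difference
  \<open>d\<close> becomes \<open>- d\<close>. By convexity the hinges at
  \<open>\<delta> - d\<close> and \<open>\<delta> + d\<close> add up to at least twice the value at
  \<open>\<delta>\<close>, which is \<open>\<delta>\<^sup>2\<close>.\<close>

lemma F_flip: "real (N - c) * (h * \<delta>\<^sup>2) \<le> F \<epsilon> x + F (flip c \<epsilon>) x"
proof -
  let ?g = "\<lambda>\<epsilon> j. hinge \<delta> (\<delta> - (co \<epsilon> x j - co \<epsilon> x (Suc j)))"
  have "real (N - c) * (h * \<delta>\<^sup>2) = h * (\<Sum>j\<in>{c..<N}. \<delta>\<^sup>2)" by simp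
  also have "\<dots> \<le> h * (\<Sum>j\<in>{c..<N}. ?g \<epsilon> j + ?g (flip c \<epsilon>) j)"
  proof (intro mult_left_mono sum_mono)
    fix j assume "j \<in> {c..<N}"
    then show "\<delta>\<^sup>2 \<le> ?g \<epsilon> j + ?g (flip c \<epsilon>) j"
      using hinge_sym[of \<delta> \<delta> "co \<epsilon> x j - co \<epsilon> x (Suc j)"] \<delta>
      by (simp add: co_flip hinge_self algebra_simps)
  qed (use h in simp)
  also have "\<dots> \<le> h * (\<Sum>j<N. ?g \<epsilon> j + ?g (flip c \<epsilon>) j)"
    using h \<delta> by (intro mult_left_mono sum_mono2) (auto intro!: add_nonneg_nonneg hinge_nonneg)
  also have "\<dots> = F \<epsilon> x + F (flip c \<epsilon>) x"
    by (simp add: F_def fval_def sum.distrib distrib_left)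
  finally show ?thesis .
qed

end

context hidden_chain begin

lemma trunc_trunc: "c \<le> c' \<Longrightarrow> trunc c (trunc c' \<epsilon>) = trunc c \<epsilon>"
  by (auto simp: trunc_def)

lemma trunc_mono: "trunc c' \<epsilon> = trunc c' \<epsilon>' \<Longrightarrow> c \<le> c' \<Longrightarrow> trunc c \<epsilon> = trunc c \<epsilon>'"
  by (metis trunc_trunc)

lemma trunc_flip: "c \<le> c' \<Longrightarrow> trunc c (flip c' \<epsilon>) = trunc c \<epsilon>"
  by (auto simp: trunc_def flip_def)

lemma big_flip: "big (flip c \<epsilon>) x l = big \<epsilon> x l"
  by (simp add: big_def co_flip)

section \<open>Real and idealized runs for a fixed seed\<close>

context
  fixes M K R :: nat and Q :: "qindex \<Rightarrow> 's \<times> transcript \<Rightarrow> rvec" and \<xi> :: 's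
begin

definition real_run :: "(nat \<Rightarrow> real) \<Rightarrow> (qindex \<Rightarrow> bool \<times> bool) \<Rightarrow> transcript" where
  "real_run \<epsilon> \<omega> = transcript_of M K R Q (\<lambda>i. ans \<epsilon> (\<omega> i)) \<xi>"

text \<open>The truncation level depends on the coins only, neither on the signs nor on the queries.
  For fixed coins, the answer at \<open>i\<close> is a function of the query and of a fixed set of
  signs.\<close>

definition ideal_run :: "(nat \<Rightarrow> real) \<Rightarrow> (qindex \<Rightarrow> bool \<times> bool) \<Rightarrow> transcript" where
  "ideal_run \<epsilon> \<omega> = transcript_of M K R Q (\<lambda>i. ans (trunc (reached_after M K \<omega> i) \<epsilon>) (\<omega> i)) \<xi>"

lemma query_cong:
  assumes "i \<in> indices M K R" "\<And>j. j \<in> past M K i \<Longrightarrow> transcript_of M K R Q a \<xi> j = transcript_of M K R Q b \<xi> j"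
  shows "fst (transcript_of M K R Q a \<xi> i) = fst (transcript_of M K R Q b \<xi> i)"
proof -
  have "restrict (transcript_of M K R Q a \<xi>) (past M K i) = restrict (transcript_of M K R Q b \<xi>) (past M K i)"
    by (rule restrict_ext) (rule assms(2))
  then show ?thesis by (simp only: transcript_of_unfold[OF assms(1)] fst_conv)
qed

lemma ideal_run_eq_query:
  assumes "i \<in> indices M K R"
  shows "ideal_run \<epsilon> \<omega> i = (fst (ideal_run \<epsilon> \<omega> i),
    ans (trunc (reached_after M K \<omega> i) \<epsilon>) (\<omega> i) (fst (ideal_run \<epsilon> \<omega> i)))"
  unfolding ideal_run_def by (rule transcript_of_eq_query[OF assms])

lemma real_run_eq_query:
  assumes "i \<in> indices M K R"
  shows "real_run \<epsilon> \<omega> i = (fst (real_run \<epsilon> \<omega> i), ans \<epsilon> (\<omega> i) (fst (real_run \<epsilon> \<omega> i)))"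
  unfolding real_run_def by (rule transcript_of_eq_query[OF assms])

lemma ideal_run_cong:
  assumes "i \<in> indices M K R"
  shows "trunc (reached_after M K \<omega> i) \<epsilon> = trunc (reached_after M K \<omega> i) \<epsilon>' \<Longrightarrow> ideal_run \<epsilon> \<omega> i = ideal_run \<epsilon>' \<omega> i"
  using assms
proof (induction i rule: indices_induct)
  case (less i)
  have q: "fst (ideal_run \<epsilon> \<omega> i) = fst (ideal_run \<epsilon>' \<omega> i)"
    unfolding ideal_run_def
  proof (rule query_cong[OF less.hyps])
    fix j assume j: "j \<in> past M K i"
    have "reached_after M K \<omega> j \<le> reached_after M K \<omega> i"
      using reached_after_past[OF j] reached_le_after by (rule order_trans)
    from less.IH[OF j trunc_mono[OF less.prems this]]
    show "transcript_of M K R Q (\<lambda>i. ans (trunc (reached_after M K \<omega> i) \<epsilon>) (\<omega> i)) \<xi> j =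
      transcript_of M K R Q (\<lambda>i. ans (trunc (reached_after M K \<omega> i) \<epsilon>') (\<omega> i)) \<xi> j"
      by (simp add: ideal_run_def)
  qed
  show ?case
    by (rule trans[OF ideal_run_eq_query[OF less.hyps] trans[OF _ ideal_run_eq_query[OF less.hyps, symmetric]]])
      (simp only: q less.prems)
qed

text \<open>A query does not see its own answer, so \<open>reached\<close> takes the place of
  \<open>reached_after\<close>. The block that the answer may reveal is thus still independent of
  the query.\<close>

lemma ideal_query_cong:
  assumes i: "i \<in> indices M K R" and eq: "trunc (reached M K \<omega> i) \<epsilon> = trunc (reached M K \<omega> i) \<epsilon>'"
  shows "fst (ideal_run \<epsilon> \<omega> i) = fst (ideal_run \<epsilon>' \<omega> i)"
  unfolding ideal_run_def
proof (rule query_cong[OF i])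
  fix j assume j: "j \<in> past M K i"
  have "j \<in> indices M K R" using past_subset_indices[OF i] j by auto
  from ideal_run_cong[OF this trunc_mono[OF eq reached_after_past[OF j]]]
  show "transcript_of M K R Q (\<lambda>i. ans (trunc (reached_after M K \<omega> i) \<epsilon>) (\<omega> i)) \<xi> j =
    transcript_of M K R Q (\<lambda>i. ans (trunc (reached_after M K \<omega> i) \<epsilon>') (\<omega> i)) \<xi> j"
    by (simp add: ideal_run_def)
qed

text \<open>Stated for the idealized run, where a query is independent of the blocks it is tested
  against; for the real run such a bound would be circular.\<close>

definition lucky :: "(nat \<Rightarrow> real) \<Rightarrow> (qindex \<Rightarrow> bool \<times> bool) \<Rightarrow> bool" where
  "lucky \<epsilon> \<omega> \<longleftrightarrow> (\<forall>i\<in>indices M K R. vnorm D (fst (ideal_run \<epsilon> \<omega> i)) \<le> \<gamma> \<longrightarrow>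
     (\<forall>l\<in>{reached M K \<omega> i..<N}. \<not> big \<epsilon> (fst (ideal_run \<epsilon> \<omega> i)) l))"

text \<open>Induction along \<open>past\<close>: equal earlier entries give equal queries, and at a
  lucky query without correction \<open>ans_trunc\<close> equates the answers.\<close>

lemma real_run_eq_ideal_run:
  assumes l: "lucky \<epsilon> \<omega>" and c: "\<And>i. i \<in> indices M K R \<Longrightarrow> \<not> fst (\<omega> i)"
    and b: "\<And>i. i \<in> indices M K R \<Longrightarrow> vnorm D (fst (real_run \<epsilon> \<omega> i)) \<le> \<gamma>"
  shows "real_run \<epsilon> \<omega> = ideal_run \<epsilon> \<omega>"
proof
  fix i
  show "real_run \<epsilon> \<omega> i = ideal_run \<epsilon> \<omega> i"
  proof (cases "i \<in> indices M K R")
    case True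
    then show ?thesis
    proof (induction i rule: indices_induct)
      case (less i)
      have q: "fst (real_run \<epsilon> \<omega> i) = fst (ideal_run \<epsilon> \<omega> i)"
        unfolding real_run_def ideal_run_def
        by (rule query_cong[OF less.hyps]) (use less.IH in \<open>simp add: real_run_def ideal_run_def\<close>)
      have a: "ans \<epsilon> (\<omega> i) (fst (real_run \<epsilon> \<omega> i)) =
        ans (trunc (reached_after M K \<omega> i) \<epsilon>) (\<omega> i) (fst (real_run \<epsilon> \<omega> i))"
        by (rule ans_trunc[where c = "reached M K \<omega> i"])
          (use b[OF less.hyps] c[OF less.hyps] l less.hyps q in \<open>auto simp: lucky_def reached_after_def\<close>)
      show ?case
        by (rule trans[OF real_run_eq_query[OF less.hyps] trans[OF _ ideal_run_eq_query[OF less.hyps, symmetric]]])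
          (simp only: a[unfolded q] q)
    qed
  qed (simp add: real_run_def ideal_run_def transcript_of_notin)
qed

lemma ideal_run_flip: "ideal_run (flip (progress M K \<omega> R) \<epsilon>) \<omega> = ideal_run \<epsilon> \<omega>"
proof
  fix i
  show "ideal_run (flip (progress M K \<omega> R) \<epsilon>) \<omega> i = ideal_run \<epsilon> \<omega> i"
  proof (cases "i \<in> indices M K R")
    case True
    then show ?thesis by (intro ideal_run_cong trunc_flip reached_after_indices)
  qed (simp add: ideal_run_def transcript_of_notin)
qed

text \<open>\<open>big\<close> only sees squares of \<open>co\<close>. The set of lucky signs is
  therefore closed under the pairing by \<open>flip\<close>.\<close>

lemma lucky_flip: "lucky (flip (progress M K \<omega> R) \<epsilon>) \<omega> = lucky \<epsilon> \<omega>"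
  by (simp add: lucky_def ideal_run_flip big_flip)

text \<open>For fixed coins, changing a sign in block \<open>l\<close> does not change the query, so
  the query can serve as the adaptive vector of the concentration bound.\<close>

lemma card_big_le:
  assumes i: "i \<in> indices M K R" and l: "reached M K \<omega> i \<le> l"
  shows "real (card {\<epsilon> \<in> signs. big \<epsilon> (fst (ideal_run \<epsilon> \<omega> i)) l}) \<le> 2 * exp (- t\<^sup>2 / 2) * card signs"
proof -
  have eq: "big \<epsilon> x l \<longleftrightarrow> t\<^sup>2 * (\<Sum>k\<in>blk l. (x k)\<^sup>2) < (\<Sum>k\<in>blk l. \<epsilon> k * x k)\<^sup>2" for \<epsilon> x
    using n by (simp add: big_def co_def power_divide divide_less_cancel)
  show ?thesis
    unfolding eq
  proof (rule card_signs_two_sided[OF finite_blk _ t])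
    show "blk l \<subseteq> {..<N * n}" by (auto simp: blk_def)
    fix \<epsilon> k assume k: "k \<in> blk l"
    then have "trunc (reached M K \<omega> i) (neg k \<epsilon>) = trunc (reached M K \<omega> i) \<epsilon>"
      using l by (auto simp: trunc_def blk_def)
    from ideal_query_cong[OF i this] show "fst (ideal_run (neg k \<epsilon>) \<omega> i) = fst (ideal_run \<epsilon> \<omega> i)" .
  qed
qed

lemma card_unlucky_le:
  "real (card {\<epsilon> \<in> signs. \<not> lucky \<epsilon> \<omega>}) \<le> 2 * real (M * K * R) * real N * exp (- t\<^sup>2 / 2) * card signs"
proof -
  let ?E = "\<lambda>i l. {\<epsilon> \<in> signs. reached M K \<omega> i \<le> l \<and> big \<epsilon> (fst (ideal_run \<epsilon> \<omega> i)) l}"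
  have "{\<epsilon> \<in> signs. \<not> lucky \<epsilon> \<omega>} \<subseteq> (\<Union>i\<in>indices M K R. \<Union>l\<in>{..<N}. ?E i l)"
    by (fastforce simp: lucky_def simp del: reached.simps)
  then have "card {\<epsilon> \<in> signs. \<not> lucky \<epsilon> \<omega>} \<le> card (\<Union>i\<in>indices M K R. \<Union>l\<in>{..<N}. ?E i l)"
    using finite_signs finite_indices by (intro card_mono) auto
  also have "\<dots> \<le> (\<Sum>i\<in>indices M K R. card (\<Union>l\<in>{..<N}. ?E i l))"
    by (rule card_UN_le) (rule finite_indices)
  also have "\<dots> \<le> (\<Sum>i\<in>indices M K R. \<Sum>l<N. card (?E i l))"
    by (intro sum_mono card_UN_le) simp
  finally have "real (card {\<epsilon> \<in> signs. \<not> lucky \<epsilon> \<omega>}) \<le> (\<Sum>i\<in>indices M K R. \<Sum>l<N. real (card (?E i l)))"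
    by (simp flip: of_nat_sum)
  also have "\<dots> \<le> (\<Sum>i\<in>indices M K R. \<Sum>l<N. 2 * exp (- t\<^sup>2 / 2) * card signs)"
  proof (intro sum_mono)
    fix i l assume i: "i \<in> indices M K R"
    show "real (card (?E i l)) \<le> 2 * exp (- t\<^sup>2 / 2) * card signs"
      using card_big_le[OF i, of \<omega> l] by (cases "reached M K \<omega> i \<le> l") auto
  qed
  finally show ?thesis by (simp add: card_indices mult_ac)
qed

lemma sum_F_ge:
  assumes c: "\<And>i. i \<in> indices M K R \<Longrightarrow> \<not> fst (\<omega> i)" and N2: "2 * progress M K \<omega> R \<le> N"
    and b: "\<And>\<epsilon> i. \<epsilon> \<in> signs \<Longrightarrow> i \<in> indices M K R \<Longrightarrow> vnorm D (fst (real_run \<epsilon> \<omega> i)) \<le> \<gamma>"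
    and tt: "2 * real (M * K * R) * real N * exp (- t\<^sup>2 / 2) \<le> 1 / 8"
  shows "7 / 8 * real (card signs) * (real N * h * \<delta>\<^sup>2 / 4) \<le> (\<Sum>\<epsilon>\<in>signs. F \<epsilon> (X (\<xi>, real_run \<epsilon> \<omega>)))"
proof -
  let ?E = "{\<epsilon> \<in> signs. lucky \<epsilon> \<omega>}" and ?T = "progress M K \<omega> R"
  let ?f = "\<lambda>\<epsilon>. F \<epsilon> (X (\<xi>, ideal_run \<epsilon> \<omega>))"
  have "card signs = card ?E + card {\<epsilon> \<in> signs. \<not> lucky \<epsilon> \<omega>}"
    using finite_signs by (subst card_Un_disjoint[symmetric]) (auto intro!: arg_cong[of _ _ card])
  moreover have "2 * real (M * K * R) * real N * exp (- t\<^sup>2 / 2) * card signs \<le> 1 / 8 * card signs"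
    by (intro mult_right_mono tt) simp
  ultimately have E: "7 / 8 * real (card signs) \<le> card ?E" using card_unlucky_le[of \<omega>] by simp
  have "7 / 8 * real (card signs) * (real N * h * \<delta>\<^sup>2 / 4) \<le> card ?E * (real N * h * \<delta>\<^sup>2 / 4)"
    using h by (intro mult_right_mono E) auto
  also have "\<dots> \<le> card ?E * (real (N - ?T) * (h * \<delta>\<^sup>2) / 2)"
  proof -
    \<comment> \<open>At least half of the links are unreached.\<close>
    have "real N / 2 * (h * \<delta>\<^sup>2) \<le> real (N - ?T) * (h * \<delta>\<^sup>2)"
      using N2 h by (intro mult_right_mono) (auto simp: of_nat_diff)
    then have "real N * h * \<delta>\<^sup>2 / 4 \<le> real (N - ?T) * (h * \<delta>\<^sup>2) / 2" by (simp add: mult_ac)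
    then show ?thesis by (rule mult_left_mono) simp
  qed
  also have "\<dots> = (\<Sum>\<epsilon>\<in>?E. real (N - ?T) * (h * \<delta>\<^sup>2)) / 2" by simp
  \<comment> \<open>Both sign patterns of a pair receive the same output, so \<open>F_flip\<close>
    applies to it.\<close>
  also have "\<dots> \<le> (\<Sum>\<epsilon>\<in>?E. ?f \<epsilon> + ?f (flip ?T \<epsilon>)) / 2"
    unfolding ideal_run_flip by (intro divide_right_mono sum_mono F_flip) simp
  also have "\<dots> = (\<Sum>\<epsilon>\<in>?E. ?f \<epsilon>)"
  proof -
    have "(\<Sum>\<epsilon>\<in>?E. ?f (flip ?T \<epsilon>)) = (\<Sum>\<epsilon>\<in>?E. ?f \<epsilon>)"
      by (rule sum.reindex_bij_witness[where i = "flip ?T" and j = "flip ?T"])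
        (auto simp: flip_flip lucky_flip intro: flip_signs)
    then show ?thesis by (simp add: sum.distrib)
  qed
  also have "\<dots> = (\<Sum>\<epsilon>\<in>?E. F \<epsilon> (X (\<xi>, real_run \<epsilon> \<omega>)))"
    by (intro sum.cong refl) (simp add: real_run_eq_ideal_run c b)
  also have "\<dots> \<le> (\<Sum>\<epsilon>\<in>signs. F \<epsilon> (X (\<xi>, real_run \<epsilon> \<omega>)))"
    using finite_signs by (intro sum_mono2) (auto simp: F_def fval_nonneg)
  finally show ?thesis .
qed

end

lemma chain_lower_bound:
  fixes S :: "'s measure"
  assumes alg: "ic_algorithm D M K R S Q X" and qb: "queries_bounded D M K R H B \<sigma> \<gamma> S Q"
    and H: "4 * h \<le> H" and B: "0 \<le> B" "\<delta>\<^sup>2 * real N ^ 3 \<le> B\<^sup>2"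
    and s: "16 * h\<^sup>2 * t\<^sup>2 * \<gamma>\<^sup>2 / n / q + (1 / p - 1) * (h * \<delta>)\<^sup>2 \<le> \<sigma>\<^sup>2"
    and tt: "2 * real (M * K * R) * real N * exp (- t\<^sup>2 / 2) \<le> 1 / 8"
    and qq: "real (M * K * R) * q \<le> 1 / 8"
    and pr: "measure_pmf.prob (noise M K R (coins q p)) {\<omega>. N < 2 * progress M K \<omega> R} \<le> 1 / 8"
  shows "\<exists>F\<in>F0_class D H B. \<exists>Orc. sg_oracle D F \<sigma> Orc \<and>
    expected_suboptimality D M K R S Q X Orc F \<ge> ennreal (real N * h * \<delta>\<^sup>2 / 8)"
proof (rule exists_hard_instance[OF alg qb finite_signs signs_nonempty, where F = F and A = ans])
  fix \<xi> assume b: "\<And>\<epsilon> \<omega> i. \<epsilon> \<in> signs \<Longrightarrow> \<omega> \<in> set_pmf (noise M K R (coins q p)) \<Longrightarrow> i \<in> indices M K R \<Longrightarrow>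
         vnorm D (fst (transcript_of M K R Q (\<lambda>i. ans \<epsilon> (\<omega> i)) \<xi> i)) \<le> \<gamma>"
  let ?P = "noise M K R (coins q p)"
  let ?f = "\<lambda>\<epsilon> \<omega>. F \<epsilon> (X (\<xi>, transcript_of M K R Q (\<lambda>i. ans \<epsilon> (\<omega> i)) \<xi>))"
  define v where "v = real N * h * \<delta>\<^sup>2 / 4"
  have v: "0 \<le> v" using h by (simp add: v_def)
  define G where "G = {\<omega>. (\<forall>i\<in>indices M K R. \<not> fst (\<omega> i)) \<and> 2 * progress M K \<omega> R \<le> N}"
  \<comment> \<open>The two failures, a correction at some query and too much progress, have
    probability at most \<open>1 / 8\<close> each.\<close>
  have G: "3 / 4 \<le> measure_pmf.prob ?P G"
  proof -
    have c: "measure_pmf.prob ?P {\<omega>. fst (\<omega> i)} = q" if "i \<in> indices M K R" for i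
    proof -
      have "measure_pmf.prob ?P {\<omega>. fst (\<omega> i)} = measure_pmf.prob (map_pmf fst (map_pmf (\<lambda>\<omega>. \<omega> i) ?P)) {True}"
        by (simp add: measure_map_pmf vimage_def)
      also have "\<dots> = q" using that q
        by (simp add: Pi_pmf_component finite_indices map_fst_pair_pmf measure_pmf_single)
      finally show ?thesis .
    qed
    have "measure_pmf.prob ?P (- G) \<le> measure_pmf.prob ?P ((\<Union>i\<in>indices M K R. {\<omega>. fst (\<omega> i)}) \<union> {\<omega>. N < 2 * progress M K \<omega> R})"
      by (intro measure_pmf.finite_measure_mono) (auto simp: G_def)
    also have "\<dots> \<le> measure_pmf.prob ?P (\<Union>i\<in>indices M K R. {\<omega>. fst (\<omega> i)}) + measure_pmf.prob ?P {\<omega>. N < 2 * progress M K \<omega> R}"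
      by (intro measure_Un_le) auto
    also have "measure_pmf.prob ?P (\<Union>i\<in>indices M K R. {\<omega>. fst (\<omega> i)}) \<le> (\<Sum>i\<in>indices M K R. measure_pmf.prob ?P {\<omega>. fst (\<omega> i)})"
      by (intro measure_pmf.finite_measure_subadditive_finite finite_indices) auto
    also have "\<dots> = real (M * K * R) * q" by (simp add: c card_indices)
    finally have "measure_pmf.prob ?P (- G) \<le> 1 / 4" using qq pr by simp
    then show ?thesis using measure_pmf.prob_compl[of G ?P] by (simp add: Compl_eq_Diff_UNIV)
  qed
  have "of_nat (card signs) * ennreal (real N * h * \<delta>\<^sup>2 / 8) \<le> ennreal (7 / 8 * real (card signs) * v) * ennreal (measure_pmf.prob ?P G)"
  proof -
    \<comment> \<open>Lucky signs and good coins together have weight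
      \<open>7 / 8 * 3 / 4 = 21 / 32\<close>, more than \<open>1 / 2\<close>.\<close>
    have "real (card signs) * v * (1 / 2) \<le> real (card signs) * v * (21 / 32)"
      using v by (intro mult_left_mono) auto
    then have "real (card signs) * (v / 2) \<le> 7 / 8 * real (card signs) * v * (3 / 4)" by simp
    also have "\<dots> \<le> 7 / 8 * real (card signs) * v * measure_pmf.prob ?P G"
      using v by (intro mult_left_mono G) auto
    finally have "ennreal (real (card signs) * (v / 2)) \<le> ennreal (7 / 8 * real (card signs) * v * measure_pmf.prob ?P G)"
      by (rule ennreal_leI)
    then have "of_nat (card signs) * ennreal (v / 2) \<le> ennreal (7 / 8 * real (card signs) * v) * ennreal (measure_pmf.prob ?P G)"
      using v by (simp add: ennreal_mult[symmetric] ennreal_of_nat_eq_real_of_nat)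
    moreover have "v / 2 = real N * h * \<delta>\<^sup>2 / 8" by (simp add: v_def)
    ultimately show ?thesis by simp
  qed
  also have "\<dots> = (\<integral>\<^sup>+\<omega>. ennreal (7 / 8 * real (card signs) * v) * indicator G \<omega> \<partial>?P)"
    by (simp add: nn_integral_cmult measure_pmf.emeasure_eq_measure)
  also have "\<dots> \<le> (\<integral>\<^sup>+\<omega>. (\<Sum>\<epsilon>\<in>signs. ennreal (?f \<epsilon> \<omega> - min_value D (F \<epsilon>))) \<partial>?P)"
  proof (intro nn_integral_mono_AE AE_pmfI)
    fix \<omega> assume \<omega>: "\<omega> \<in> set_pmf ?P"
    have "ennreal (7 / 8 * real (card signs) * v) \<le> ennreal (\<Sum>\<epsilon>\<in>signs. ?f \<epsilon> \<omega>)" if "\<omega> \<in> G"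
      unfolding v_def using that b[OF _ \<omega>] tt
      by (intro ennreal_leI sum_F_ge[unfolded real_run_def]) (auto simp: G_def)
    then show "ennreal (7 / 8 * real (card signs) * v) * indicator G \<omega> \<le> (\<Sum>\<epsilon>\<in>signs. ennreal (?f \<epsilon> \<omega> - min_value D (F \<epsilon>)))"
      by (simp add: min_value_F sum_ennreal F_def fval_nonneg split: split_indicator)
  qed
  also have "\<dots> = (\<Sum>\<epsilon>\<in>signs. \<integral>\<^sup>+\<omega>. ennreal (?f \<epsilon> \<omega> - min_value D (F \<epsilon>)) \<partial>?P)"
    by (rule nn_integral_sum) simp
  finally show "of_nat (card signs) * ennreal (real N * h * \<delta>\<^sup>2 / 8) \<le> \<dots>" .
qed (use s in \<open>auto intro!: F_in_F0_class[OF _ H B] sg_oracle_ans ans_measurable F_measurable\<close>)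

end

section \<open>Tail bound for the progress\<close>

lemma sum_indices:
  fixes a :: "nat \<Rightarrow> nat \<Rightarrow> nat \<Rightarrow> real"
  assumes "\<And>r. r < R \<Longrightarrow> \<mu> r < M"
  shows "(\<Sum>(m, k, r)\<in>indices M K R. if m = \<mu> r then a m k r else 0) = (\<Sum>r<R. \<Sum>k<K. a (\<mu> r) k r)"
proof -
  have "(\<Sum>(m, k, r)\<in>indices M K R. if m = \<mu> r then a m k r else 0) =
    (\<Sum>m<M. \<Sum>k<K. \<Sum>r<R. if m = \<mu> r then a m k r else 0)"
    by (simp add: indices_def sum.cartesian_product)
  also have "\<dots> = (\<Sum>r<R. \<Sum>k<K. \<Sum>m<M. if m = \<mu> r then a m k r else 0)"
    by (subst sum.swap, subst (2) sum.swap, subst sum.swap) (rule refl)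
  also have "\<dots> = (\<Sum>r<R. \<Sum>k<K. a (\<mu> r) k r)"
    by (intro sum.cong refl) (use assms in \<open>auto simp: sum.delta'\<close>)
  finally show ?thesis .
qed

text \<open>Here \<open>\<mu>\<close> selects one machine per round, which leaves
  \<open>K * R\<close> independent coins. A Chernoff bound with exponent \<open>1\<close> is enough,
  as constants are free.\<close>

lemma reveals_tail:
  assumes p: "0 \<le> p" "p \<le> 1" and \<mu>: "\<And>r. r < R \<Longrightarrow> \<mu> r < M"
  shows "measure_pmf.prob (noise M K R (coins q p)) {\<omega>. c \<le> (\<Sum>r<R. real (reveals K \<omega> r (\<mu> r)))}
    \<le> exp (2 * p * real (K * R) - c)"
proof -
  let ?P = "noise M K R (coins q p)"
  define f :: "qindex \<Rightarrow> bool \<times> bool \<Rightarrow> real"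
    where "f = (\<lambda>(m, k, r) w. if m = \<mu> r then (if snd w then exp 1 else 1) else 1)"
  let ?S = "\<lambda>\<omega>. \<Sum>r<R. real (reveals K \<omega> r (\<mu> r))"
  have S: "exp (?S \<omega>) = (\<Prod>i\<in>indices M K R. f i (\<omega> i))" for \<omega>
  proof -
    have "?S \<omega> = (\<Sum>r<R. \<Sum>k<K. if snd (\<omega> (\<mu> r, k, r)) then 1 else 0)"
      by (intro sum.cong refl) (simp add: reveals_def sum.If_cases Int_def)
    also have "\<dots> = (\<Sum>(m, k, r)\<in>indices M K R. if m = \<mu> r then (if snd (\<omega> (m, k, r)) then 1 else 0) else 0)"
      by (rule sum_indices[OF \<mu>, symmetric])
    finally show ?thesis
      by (simp only: exp_sum[OF finite_indices]) (auto simp: f_def intro!: prod.cong)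
  qed
  have fin: "finite (set_pmf ?P)"
    by (rule finite_subset[OF set_Pi_pmf_subset'[OF finite_indices]]) (auto intro!: finite_PiE_dflt finite_indices)
  have Ef: "measure_pmf.expectation (coins q p) (f (m, k, r)) \<le> exp (if m = \<mu> r then 2 * p else 0)" for m k r
  proof (cases "m = \<mu> r")
    case True
    have "measure_pmf.expectation (coins q p) (f (m, k, r)) =
      measure_pmf.expectation (map_pmf snd (coins q p)) (\<lambda>b. if b then exp 1 else 1)"
      using True by (simp add: f_def)
    also have "\<dots> = 1 + p * (exp 1 - 1)"
      using p by (simp add: map_snd_pair_pmf algebra_simps)
    \<comment> \<open>From \<open>exp 1 \<le> 3\<close>.\<close>
    also have "\<dots> \<le> 1 + 2 * p" using p exp_le by (simp add: mult_left_mono mult.commute)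
    also have "\<dots> \<le> exp (2 * p)" by (rule exp_ge_add_one_self)
    finally show ?thesis using True by simp
  qed (simp add: f_def)
  have "measure_pmf.prob ?P {\<omega>. c \<le> ?S \<omega>} = measure_pmf.expectation ?P (indicator {\<omega>. c \<le> ?S \<omega>})"
    by simp
  also have "\<dots> \<le> measure_pmf.expectation ?P (\<lambda>\<omega>. exp (- c) * (\<Prod>i\<in>indices M K R. f i (\<omega> i)))"
  proof (rule integral_mono)
    fix \<omega>
    show "indicator {\<omega>. c \<le> ?S \<omega>} \<omega> \<le> exp (- c) * (\<Prod>i\<in>indices M K R. f i (\<omega> i))"
      unfolding S[symmetric] exp_add[symmetric] by (simp split: split_indicator)
  qed (intro integrable_measure_pmf_finite fin)+
  also have "\<dots> = exp (- c) * (\<Prod>i\<in>indices M K R. measure_pmf.expectation (coins q p) (f i))"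
    by (simp, subst expectation_prod_Pi_pmf)
      (auto intro!: integrable_measure_pmf_finite finite_indices simp: f_def)
  also have "\<dots> \<le> exp (- c) * (\<Prod>(m, k, r)\<in>indices M K R. exp (if m = \<mu> r then 2 * p else 0))"
    using Ef by (intro mult_left_mono prod_mono) (auto simp: f_def intro!: integral_nonneg)
  also have "(\<Prod>(m, k, r)\<in>indices M K R. exp (if m = \<mu> r then 2 * p else 0)) =
    exp (\<Sum>(m, k, r)\<in>indices M K R. if m = \<mu> r then 2 * p else 0)"
    by (simp add: exp_sum finite_indices case_prod_beta')
  also have "(\<Sum>(m, k, r)\<in>indices M K R. if m = \<mu> r then 2 * p else 0) = 2 * p * real (K * R)"
    by (subst sum_indices[OF \<mu>]) auto
  finally show ?thesis by (simp add: exp_add[symmetric])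
qed

text \<open>Union bound over the choices of the machine that makes the most progress in each round.\<close>

lemma progress_tail:
  assumes p: "0 \<le> p" "p \<le> 1" and M: "0 < M"
  shows "measure_pmf.prob (noise M K R (coins q p)) {\<omega>. N < 2 * progress M K \<omega> R}
    \<le> real M ^ R * exp (2 * p * real (K * R) - real N / 2)"
proof -
  let ?P = "noise M K R (coins q p)"
  let ?E = "\<lambda>\<mu>. {\<omega>. real N / 2 \<le> (\<Sum>r<R. real (reveals K \<omega> r (\<mu> r)))}"
  let ?U = "{..<R} \<rightarrow>\<^sub>E {..<M}"
  have "{\<omega>. N < 2 * progress M K \<omega> R} \<subseteq> (\<Union>\<mu>\<in>?U. ?E \<mu>)"
  proof
    fix \<omega> assume \<omega>: "\<omega> \<in> {\<omega>. N < 2 * progress M K \<omega> R}"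
    have "\<exists>m<M. Max (reveals K \<omega> r ` {..<M}) = reveals K \<omega> r m" for r
    proof -
      have "Max (reveals K \<omega> r ` {..<M}) \<in> reveals K \<omega> r ` {..<M}" using M by (intro Max_in) auto
      then show ?thesis by auto
    qed
    then obtain m where m: "\<And>r. m r < M" "\<And>r. Max (reveals K \<omega> r ` {..<M}) = reveals K \<omega> r (m r)" by metis
    have "progress M K \<omega> R = (\<Sum>r<R. reveals K \<omega> r (restrict m {..<R} r))"
      unfolding progress_def m(2) by (intro sum.cong) auto
    then have "restrict m {..<R} \<in> ?U \<and> \<omega> \<in> ?E (restrict m {..<R})"
      using m(1) \<omega> by (auto simp flip: of_nat_sum)
    then show "\<omega> \<in> (\<Union>\<mu>\<in>?U. ?E \<mu>)" by blast
  qed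
  then have "measure_pmf.prob ?P {\<omega>. N < 2 * progress M K \<omega> R} \<le> measure_pmf.prob ?P (\<Union>\<mu>\<in>?U. ?E \<mu>)"
    by (intro measure_pmf.finite_measure_mono) auto
  also have "\<dots> \<le> (\<Sum>\<mu>\<in>?U. measure_pmf.prob ?P (?E \<mu>))"
    by (intro measure_pmf.finite_measure_subadditive_finite finite_PiE) auto
  also have "\<dots> \<le> (\<Sum>\<mu>\<in>?U. exp (2 * p * real (K * R) - real N / 2))"
    by (intro sum_mono reveals_tail p) auto
  finally show ?thesis by (simp add: card_PiE)
qed

section \<open>The statistical term\<close>

text \<open>
  Without correction the answers are \<open>0\<close>, so they do not distinguish the two signs of a chain of length one.
\<close>

lemma (in chain) statistical_lower_bound:
  fixes S :: "'s measure"
  assumes alg: "ic_algorithm D M K R S Q X" and qb: "queries_bounded D M K R H B \<sigma> \<gamma> S Q"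
    and N1: "N = 1" and H: "4 * h \<le> H" and B: "0 \<le> B" "\<delta>\<^sup>2 \<le> B\<^sup>2"
    and q: "0 < q" "q \<le> 1" "real (M * K * R) * q \<le> 1 / 2" and s: "(h * \<delta>)\<^sup>2 / q \<le> \<sigma>\<^sup>2"
  shows "\<exists>F\<in>F0_class D H B. \<exists>Orc. sg_oracle D F \<sigma> Orc \<and>
    expected_suboptimality D M K R S Q X Orc F \<ge> ennreal (h * \<delta>\<^sup>2 / 4)"
proof (rule exists_hard_instance[OF alg qb finite_signs signs_nonempty, where F = F
      and A = "\<lambda>\<epsilon> w x. lift \<epsilon> (\<lambda>j. if w then fgrad (co \<epsilon> x) j / q else 0)" and P = "bernoulli_pmf q"])
  let ?A = "\<lambda>\<epsilon> w x. lift \<epsilon> (\<lambda>j. if w then fgrad (co \<epsilon> x) j / q else 0)"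
  have cm: "(\<lambda>x. if w then fgrad (co \<epsilon> x) j / q else 0) \<in> borel_measurable (Rn D)" for \<epsilon> j and w :: bool
    unfolding fgrad_def by measurable
  show "?A \<epsilon> w \<in> Rn D \<rightarrow>\<^sub>M Rn D" if "\<epsilon> \<in> signs" for \<epsilon> w
    by (intro lift_measurable cm that)
  show "sg_oracle D (F \<epsilon>) \<sigma> (noisy D (bernoulli_pmf q) (?A \<epsilon>))" if e: "\<epsilon> \<in> signs" for \<epsilon>
  proof (rule sg_oracle_lift[OF e cm])
    fix x
    let ?g = "fgrad (co \<epsilon> x) 0"
    \<comment> \<open>A chain of length one has a single ramp, of height at most
      \<open>\<delta>\<close>.\<close>
    have "\<bar>?g\<bar> \<le> h * \<delta>"
      using h \<delta> ramp_bounds[of \<delta>] by (simp add: fgrad_def)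
    then have "?g\<^sup>2 \<le> (h * \<delta>)\<^sup>2" using h \<delta> by (simp add: abs_le_square_iff[symmetric])
    then have g: "?g\<^sup>2 / q \<le> (h * \<delta>)\<^sup>2 / q" using q by (intro divide_right_mono) auto
    have "q * (?g / q - ?g)\<^sup>2 + (1 - q) * ?g\<^sup>2 = ?g\<^sup>2 / q - ?g\<^sup>2"
      using q by (simp add: power2_eq_square field_simps)
    also have "\<dots> \<le> \<sigma>\<^sup>2" using g s zero_le_power2[of ?g] by linarith
    finally show "(\<Sum>j<N. \<Sum>w\<in>UNIV. pmf (bernoulli_pmf q) w * ((if w then fgrad (co \<epsilon> x) j / q else 0) - fgrad (co \<epsilon> x) j)\<^sup>2) \<le> \<sigma>\<^sup>2"
      using q by (simp add: N1 UNIV_bool add.commute)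
  qed (use q in \<open>auto simp: UNIV_bool\<close>)
  fix \<xi>
  let ?P = "noise M K R (bernoulli_pmf q)"
  let ?f = "\<lambda>\<epsilon> \<omega>. F \<epsilon> (X (\<xi>, transcript_of M K R Q (\<lambda>i. ?A \<epsilon> (\<omega> i)) \<xi>))"
  define v where "v = h * \<delta>\<^sup>2 / 2"
  have v: "0 \<le> v" using h by (simp add: v_def)
  define G where "G = {\<omega> :: qindex \<Rightarrow> bool. \<forall>i\<in>indices M K R. \<not> \<omega> i}"
  have G: "1 / 2 \<le> measure_pmf.prob ?P G"
  proof -
    have c: "measure_pmf.prob ?P {\<omega>. \<omega> i} = q" if "i \<in> indices M K R" for i
    proof -
      have "measure_pmf.prob ?P {\<omega>. \<omega> i} = measure_pmf.prob (map_pmf (\<lambda>\<omega>. \<omega> i) ?P) {True}"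
        by (simp add: measure_map_pmf vimage_def)
      also have "\<dots> = q" using that q by (simp add: Pi_pmf_component finite_indices measure_pmf_single)
      finally show ?thesis .
    qed
    have "measure_pmf.prob ?P (- G) \<le> measure_pmf.prob ?P (\<Union>i\<in>indices M K R. {\<omega>. \<omega> i})"
      by (intro measure_pmf.finite_measure_mono) (auto simp: G_def)
    also have "\<dots> \<le> (\<Sum>i\<in>indices M K R. measure_pmf.prob ?P {\<omega>. \<omega> i})"
      by (intro measure_pmf.finite_measure_subadditive_finite finite_indices) auto
    also have "\<dots> = real (M * K * R) * q" by (simp add: c card_indices)
    finally have "measure_pmf.prob ?P (- G) \<le> 1 / 2" using q by simp
    then show ?thesis using measure_pmf.prob_compl[of G ?P] by (simp add: Compl_eq_Diff_UNIV)
  qed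
  have const: "real (card signs) * v \<le> (\<Sum>\<epsilon>\<in>signs. ?f \<epsilon> \<omega>)" if "\<omega> \<in> G" for \<omega>
  proof -
    let ?T = "transcript_of M K R Q (\<lambda>_ _. \<lambda>i\<in>{..<D}. 0) \<xi>"
    have T: "transcript_of M K R Q (\<lambda>i. ?A \<epsilon> (\<omega> i)) \<xi> = ?T" for \<epsilon>
      unfolding transcript_of_def
      by (rule sim_cong) (use that in \<open>auto simp: G_def set_order lift_def\<close>)
    \<comment> \<open>\<open>flip 0\<close> changes all signs while the output stays the same, so
      each pair pays the bound of \<open>F_flip\<close>.\<close>
    have "(\<Sum>\<epsilon>\<in>signs. F (flip 0 \<epsilon>) (X (\<xi>, ?T))) = (\<Sum>\<epsilon>\<in>signs. F \<epsilon> (X (\<xi>, ?T)))"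
      by (rule sum.reindex_bij_witness[where i = "flip 0" and j = "flip 0"])
        (auto simp: flip_flip intro: flip_signs)
    then have "2 * (\<Sum>\<epsilon>\<in>signs. F \<epsilon> (X (\<xi>, ?T))) = (\<Sum>\<epsilon>\<in>signs. F \<epsilon> (X (\<xi>, ?T)) + F (flip 0 \<epsilon>) (X (\<xi>, ?T)))"
      by (simp add: sum.distrib)
    also have "\<dots> \<ge> (\<Sum>\<epsilon>\<in>signs. h * \<delta>\<^sup>2)"
      using F_flip[of 0 _ "X (\<xi>, ?T)"] N1 by (intro sum_mono) auto
    finally show ?thesis unfolding T by (simp add: v_def)
  qed
  have "of_nat (card signs) * ennreal (h * \<delta>\<^sup>2 / 4) \<le> ennreal (real (card signs) * v) * ennreal (measure_pmf.prob ?P G)"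
  proof -
    have "real (card signs) * v * (1 / 2) \<le> real (card signs) * v * measure_pmf.prob ?P G"
      using v by (intro mult_left_mono G) auto
    then have "real (card signs) * (v / 2) \<le> real (card signs) * v * measure_pmf.prob ?P G" by simp
    then have "ennreal (real (card signs) * (v / 2)) \<le> ennreal (real (card signs) * v * measure_pmf.prob ?P G)"
      by (rule ennreal_leI)
    then have "of_nat (card signs) * ennreal (v / 2) \<le> ennreal (real (card signs) * v) * ennreal (measure_pmf.prob ?P G)"
      using v by (simp add: ennreal_mult[symmetric] ennreal_of_nat_eq_real_of_nat)
    moreover have "v / 2 = h * \<delta>\<^sup>2 / 4" by (simp add: v_def)
    ultimately show ?thesis by simp
  qed
  also have "\<dots> = (\<integral>\<^sup>+\<omega>. ennreal (real (card signs) * v) * indicator G \<omega> \<partial>?P)"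
    by (simp add: nn_integral_cmult measure_pmf.emeasure_eq_measure)
  also have "\<dots> \<le> (\<integral>\<^sup>+\<omega>. (\<Sum>\<epsilon>\<in>signs. ennreal (?f \<epsilon> \<omega> - min_value D (F \<epsilon>))) \<partial>?P)"
  proof (rule nn_integral_mono)
    fix \<omega>
    show "ennreal (real (card signs) * v) * indicator G \<omega> \<le> (\<Sum>\<epsilon>\<in>signs. ennreal (?f \<epsilon> \<omega> - min_value D (F \<epsilon>)))"
      using ennreal_leI[OF const, of \<omega>] by (simp add: min_value_F sum_ennreal F_def fval_nonneg split: split_indicator)
  qed
  also have "\<dots> = (\<Sum>\<epsilon>\<in>signs. \<integral>\<^sup>+\<omega>. ennreal (?f \<epsilon> \<omega> - min_value D (F \<epsilon>)) \<partial>?P)"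
    by (rule nn_integral_sum) simp
  finally show "of_nat (card signs) * ennreal (h * \<delta>\<^sup>2 / 4) \<le> \<dots>" .
next
  show "F \<epsilon> \<in> F0_class D H B" if "\<epsilon> \<in> signs" for \<epsilon>
    by (rule F_in_F0_class[OF that H B(1)]) (use B N1 in simp)
qed (rule F_measurable)

section \<open>A single query\<close>

text \<open>A Huber function of the first coordinate, written with two hinges so that their
  estimates apply. Its gradient is constant on either side at distance at least
  \<open>\<delta>\<close> from \<open>\<theta>\<close>.\<close>

definition huber :: "real \<Rightarrow> real \<Rightarrow> real \<Rightarrow> rvec \<Rightarrow> real" where
  "huber h \<delta> \<theta> x = h * (hinge \<delta> (x 0 - \<theta>) + hinge \<delta> (\<theta> - x 0))"

definition huber_grad :: "nat \<Rightarrow> real \<Rightarrow> real \<Rightarrow> real \<Rightarrow> rvec \<Rightarrow> rvec" where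
  "huber_grad D h \<delta> \<theta> x = (\<lambda>i\<in>{..<D}. if i = 0 then h * (ramp \<delta> (x 0 - \<theta>) - ramp \<delta> (\<theta> - x 0)) else 0)"

context
  fixes D :: nat and h \<delta> \<theta> :: real
  assumes D: "0 < D" and h: "0 < h" and \<delta>: "0 < \<delta>"
begin

lemma sum_first: "(\<Sum>i<D. if i = 0 then a else (0::real)) = a"
  using D by (simp add: sum.delta)

lemma first_le_vdist: "(x 0 - y 0)\<^sup>2 \<le> (vdist D x y)\<^sup>2"
  unfolding vdist_sq using D by (intro member_le_sum[of 0]) auto

lemma huber_grad_inner:
  "(\<Sum>i<D. huber_grad D h \<delta> \<theta> x i * u i) = h * (ramp \<delta> (x 0 - \<theta>) - ramp \<delta> (\<theta> - x 0)) * u 0"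
proof -
  have "(\<Sum>i<D. huber_grad D h \<delta> \<theta> x i * u i) =
    (\<Sum>i<D. if i = 0 then h * (ramp \<delta> (x 0 - \<theta>) - ramp \<delta> (\<theta> - x 0)) * u 0 else 0)"
    by (intro sum.cong) (auto simp: huber_grad_def)
  then show ?thesis by (simp only: sum_first)
qed

lemma huber_first_order:
  "huber h \<delta> \<theta> x + (\<Sum>i<D. huber_grad D h \<delta> \<theta> x i * (z i - x i)) \<le> huber h \<delta> \<theta> z"
  "huber h \<delta> \<theta> z \<le> huber h \<delta> \<theta> x + (\<Sum>i<D. huber_grad D h \<delta> \<theta> x i * (z i - x i)) + 2 * h * (vdist D z x)\<^sup>2"
proof -
  define a b d where "a = x 0 - \<theta>" and "b = \<theta> - x 0" and "d = z 0 - x 0"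
  have z: "z 0 - \<theta> = a + d" "\<theta> - z 0 = b - d" by (simp_all add: a_def b_def d_def)
  have "huber h \<delta> \<theta> x + h * (ramp \<delta> a - ramp \<delta> b) * d = h * ((hinge \<delta> a + ramp \<delta> a * d) + (hinge \<delta> b - ramp \<delta> b * d))"
    by (simp add: huber_def a_def b_def algebra_simps)
  moreover have "huber h \<delta> \<theta> z = h * (hinge \<delta> (a + d) + hinge \<delta> (b - d))" by (simp add: huber_def z)
  moreover have "hinge \<delta> a + ramp \<delta> a * d \<le> hinge \<delta> (a + d)" "hinge \<delta> b - ramp \<delta> b * d \<le> hinge \<delta> (b - d)"
    using hinge_ge[of \<delta> a "a + d"] hinge_ge[of \<delta> b "b - d"] \<delta> by auto
  moreover have "hinge \<delta> (a + d) \<le> hinge \<delta> a + ramp \<delta> a * d + d\<^sup>2" "hinge \<delta> (b - d) \<le> hinge \<delta> b - ramp \<delta> b * d + d\<^sup>2"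
    using hinge_le[of \<delta> "a + d" a] hinge_le[of \<delta> "b - d" b] \<delta> by auto
  moreover have "d\<^sup>2 \<le> (vdist D z x)\<^sup>2" unfolding d_def by (rule first_le_vdist)
  moreover have g: "(\<Sum>i<D. huber_grad D h \<delta> \<theta> x i * (z i - x i)) = h * (ramp \<delta> a - ramp \<delta> b) * d"
    by (simp add: huber_grad_inner a_def b_def d_def)
  ultimately have "huber h \<delta> \<theta> x + (\<Sum>i<D. huber_grad D h \<delta> \<theta> x i * (z i - x i)) \<le> huber h \<delta> \<theta> z \<and>
    huber h \<delta> \<theta> z \<le> huber h \<delta> \<theta> x + (\<Sum>i<D. huber_grad D h \<delta> \<theta> x i * (z i - x i)) + h * (2 * (vdist D z x)\<^sup>2)"
    using h by (simp only: g distrib_left[symmetric]) (auto intro!: mult_left_mono)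
  then show "huber h \<delta> \<theta> x + (\<Sum>i<D. huber_grad D h \<delta> \<theta> x i * (z i - x i)) \<le> huber h \<delta> \<theta> z"
    "huber h \<delta> \<theta> z \<le> huber h \<delta> \<theta> x + (\<Sum>i<D. huber_grad D h \<delta> \<theta> x i * (z i - x i)) + 2 * h * (vdist D z x)\<^sup>2"
    by auto
qed

lemma huber_grad_space: "huber_grad D h \<delta> \<theta> x \<in> space (Rn D)" by (simp add: huber_grad_def space_PiM)

lemma huber_has_gradient: "x \<in> space (Rn D) \<Longrightarrow> has_gradient D (huber h \<delta> \<theta>) x (huber_grad D h \<delta> \<theta> x)"
  by (rule has_gradientI_quadratic[where C = "2 * h" and g = "huber_grad D h \<delta> \<theta>"])
    (simp_all add: huber_first_order huber_grad_space)

lemma huber_nonneg: "0 \<le> huber h \<delta> \<theta> x"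
  using h \<delta> by (simp add: huber_def hinge_nonneg)

lemma huber_ge: "h * (\<delta> * \<bar>x 0 - \<theta>\<bar> - \<delta>\<^sup>2 / 2) \<le> huber h \<delta> \<theta> x"
proof -
  \<comment> \<open>The tangent at \<open>\<delta>\<close>, where the slope is already
    maximal.\<close>
  have *: "\<delta> * s - \<delta>\<^sup>2 / 2 \<le> hinge \<delta> s" for s
    using hinge_ge[of \<delta> \<delta> s] \<delta> by (simp add: hinge_self ramp_def power2_eq_square right_diff_distrib)
  have "\<delta> * \<bar>x 0 - \<theta>\<bar> - \<delta>\<^sup>2 / 2 \<le> hinge \<delta> (x 0 - \<theta>) + hinge \<delta> (\<theta> - x 0)"
    using *[of "x 0 - \<theta>"] *[of "\<theta> - x 0"] hinge_nonneg[of \<delta>] \<delta>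
    by (cases "x 0 \<ge> \<theta>") (auto intro: order_trans[OF _ add_increasing] order_trans[OF _ add_increasing2])
  then show ?thesis unfolding huber_def using h by (intro mult_left_mono) auto
qed

lemma huber_minimizer: "huber h \<delta> \<theta> (\<lambda>i\<in>{..<D}. if i = 0 then \<theta> else 0) = 0"
  using D \<delta> by (simp add: huber_def hinge_0)

lemma min_value_huber: "min_value D (huber h \<delta> \<theta>) = 0"
  unfolding min_value_def
proof (rule cInf_eq_minimum)
  have "(\<lambda>i\<in>{..<D}. if i = 0 then \<theta> else 0) \<in> space (Rn D)" by (simp add: space_PiM)
  then show "0 \<in> huber h \<delta> \<theta> ` space (Rn D)" using huber_minimizer by force
qed (auto simp: huber_nonneg)

lemma huber_in_F0_class:
  assumes H: "2 * h \<le> H" and B: "\<bar>\<theta>\<bar> \<le> B"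
  shows "huber h \<delta> \<theta> \<in> F0_class D H B"
  unfolding F0_class_def
proof (intro CollectI conjI bexI[of _ "\<lambda>i\<in>{..<D}. if i = 0 then \<theta> else 0"] ballI)
  show "convex_fun D (huber h \<delta> \<theta>)"
    by (rule convex_funI_gradient[where C = "2 * h" and g = "huber_grad D h \<delta> \<theta>"])
      (simp_all add: huber_first_order huber_grad_space)
  have "vdist D (huber_grad D h \<delta> \<theta> x) (huber_grad D h \<delta> \<theta> y) \<le> H * vdist D x y" for x y
  proof (rule power2_le_imp_le)
    define s where "s z = ramp \<delta> (z 0 - \<theta>) - ramp \<delta> (\<theta> - z 0)" for z :: rvec
    have "(vdist D (huber_grad D h \<delta> \<theta> x) (huber_grad D h \<delta> \<theta> y))\<^sup>2 = (\<Sum>i<D. if i = 0 then (h * (s x - s y))\<^sup>2 else 0)"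
      unfolding vdist_sq by (intro sum.cong) (auto simp: huber_grad_def s_def algebra_simps)
    also have "\<dots> = h\<^sup>2 * (s x - s y)\<^sup>2" by (simp only: sum_first power_mult_distrib)
    also have "\<bar>s x - s y\<bar> \<le> \<bar>2 * (x 0 - y 0)\<bar>"
      using ramp_lipschitz[of \<delta> "x 0 - \<theta>" "y 0 - \<theta>"] ramp_lipschitz[of \<delta> "\<theta> - x 0" "\<theta> - y 0"]
      by (simp add: s_def abs_if split: if_splits)
    then have "h\<^sup>2 * (s x - s y)\<^sup>2 \<le> h\<^sup>2 * (2 * (x 0 - y 0))\<^sup>2"
      by (intro mult_left_mono) (simp_all only: abs_le_square_iff zero_le_power2)
    also have "\<dots> = (2 * h)\<^sup>2 * (x 0 - y 0)\<^sup>2" by (simp only: power_mult_distrib mult_ac)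
    also have "\<dots> \<le> H\<^sup>2 * (vdist D x y)\<^sup>2"
      using h H by (intro mult_mono first_le_vdist power_mono) auto
    finally show "(vdist D (huber_grad D h \<delta> \<theta> x) (huber_grad D h \<delta> \<theta> y))\<^sup>2 \<le> (H * vdist D x y)\<^sup>2"
      by (simp add: power_mult_distrib)
  qed (use h H vdist_nonneg in simp)
  then show "smooth_fun D H (huber h \<delta> \<theta>)"
    unfolding smooth_fun_def using huber_has_gradient huber_grad_space by blast
  show "(\<lambda>i\<in>{..<D}. if i = 0 then \<theta> else 0) \<in> space (Rn D)" by (simp add: space_PiM)
  have "vnorm D (\<lambda>i\<in>{..<D}. if i = 0 then \<theta> else 0) = sqrt (\<Sum>i<D. if i = 0 then \<theta>\<^sup>2 else 0)"
    unfolding L2_set_def by (intro arg_cong[of _ _ sqrt] sum.cong) auto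
  then show "vnorm D (\<lambda>i\<in>{..<D}. if i = 0 then \<theta> else 0) \<le> B" using B by (simp only: sum_first) simp
  show "huber h \<delta> \<theta> (\<lambda>i\<in>{..<D}. if i = 0 then \<theta> else 0) \<le> huber h \<delta> \<theta> x" for x
    unfolding huber_minimizer by (rule huber_nonneg)
qed

lemma first_measurable: "(\<lambda>x. x 0) \<in> borel_measurable (Rn D)"
  using D by (intro measurable_component_singleton) auto

lemma huber_measurable: "huber h \<delta> \<theta> \<in> borel_measurable (Rn D)"
  using first_measurable unfolding huber_def[abs_def] hinge_def ramp_def by measurable

lemma huber_grad_measurable: "huber_grad D h \<delta> \<theta> \<in> Rn D \<rightarrow>\<^sub>M Rn D"
  unfolding huber_grad_def[abs_def]
proof (rule measurable_restrict)
  show "(\<lambda>x. if i = 0 then h * (ramp \<delta> (x 0 - \<theta>) - ramp \<delta> (\<theta> - x 0)) else 0) \<in> borel_measurable (Rn D)" for i :: nat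
    using first_measurable unfolding ramp_def by measurable
qed

text \<open>The oracle is exact, with a one-point noise space: a single query is too little even
  without noise.\<close>

lemma sg_oracle_huber: "sg_oracle D (huber h \<delta> \<theta>) \<sigma> (noisy D (return_pmf ()) (\<lambda>_. huber_grad D h \<delta> \<theta>))"
  by (rule sg_oracle_noisy[where v = "huber_grad D h \<delta> \<theta>"])
    (simp_all add: huber_grad_measurable huber_has_gradient UNIV_unit L2_set_def)

end

text \<open>
  A gradient of a Huber function with a minimizer far from the query only tells on which side the
  minimizer is, and this leaves two of four possible minimizers.
\<close>

lemma single_query_lower_bound:
  fixes S :: "'s measure"
  assumes alg: "ic_algorithm D 1 1 1 S Q X" and qb: "queries_bounded D 1 1 1 H B \<sigma> \<gamma> S Q"
    and D: "0 < D" and H: "0 < H" and B: "0 < B"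
  shows "\<exists>F\<in>F0_class D H B. \<exists>Orc. sg_oracle D F \<sigma> Orc \<and>
    expected_suboptimality D 1 1 1 S Q X Orc F \<ge> ennreal (H * B\<^sup>2 / 400)"
proof -
  \<comment> \<open>\<open>2 * h = H\<close> is the smoothness limit. \<open>\<delta>\<close> is
    less than half of the gap \<open>B / 3\<close> between neighbouring minimizers, so any query is
    at least \<open>\<delta>\<close> above the lower two or at least \<open>\<delta>\<close> below
    the upper two.\<close>
  define h \<delta> where "h = H / 2" and "\<delta> = B / 8"
  have h: "0 < h" and \<delta>: "0 < \<delta>" using H B by (auto simp: h_def \<delta>_def)
  define \<theta> where "\<theta> j = B * real j / 3" for j :: nat
  let ?A = "\<lambda>j _. huber_grad D h \<delta> (\<theta> j)"
  let ?\<Theta> = "{0, 1, 2, 3 :: nat}"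
  show ?thesis
  proof (rule exists_hard_instance[OF alg qb, where \<Theta> = ?\<Theta> and F = "\<lambda>j. huber h \<delta> (\<theta> j)"
        and A = ?A and P = "return_pmf ()"])
    show "huber h \<delta> (\<theta> j) \<in> F0_class D H B" if "j \<in> ?\<Theta>" for j
      using that B by (intro huber_in_F0_class[OF D h \<delta>]) (auto simp: h_def \<theta>_def)
    fix \<xi>
    let ?f = "\<lambda>j. huber h \<delta> (\<theta> j) (X (\<xi>, transcript_of 1 1 1 Q (\<lambda>i. ?A j ()) \<xi>))"
    \<comment> \<open>The only query is determined by the seed and is the same for all four
      functions.\<close>
    define x where "x = Q (0, 0, 0) (\<xi>, \<lambda>_. undefined)"
    have qo: "query_order 1 1 1 = [(0, 0, 0)]" by (simp add: query_order_def)
    have tr: "transcript_of 1 1 1 Q a \<xi> = (\<lambda>_. undefined)((0, 0, 0) := (x, a (0, 0, 0) x))" for a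
      unfolding transcript_of_def qo by (simp add: x_def Let_def restrict_def)
    have pair: "h * B\<^sup>2 / 50 \<le> ?f j + ?f (Suc j)" if "?A j () x = ?A (Suc j) () x" for j
    proof -
      define z where "z = X (\<xi>, (\<lambda>_. undefined)((0, 0, 0) := (x, ?A j () x)))"
      have "h * (\<delta> * \<bar>z 0 - \<theta> j\<bar> - \<delta>\<^sup>2 / 2) + h * (\<delta> * \<bar>z 0 - \<theta> (Suc j)\<bar> - \<delta>\<^sup>2 / 2) \<le> ?f j + ?f (Suc j)"
        unfolding tr that[symmetric] z_def[symmetric] by (intro add_mono huber_ge[OF D h \<delta>])
      moreover have "h * (\<delta> * (B / 3)) \<le> h * (\<delta> * (\<bar>z 0 - \<theta> j\<bar> + \<bar>z 0 - \<theta> (Suc j)\<bar>))"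
      proof (intro mult_left_mono)
        have "\<theta> (Suc j) - \<theta> j = B / 3" by (simp add: \<theta>_def field_simps)
        then show "B / 3 \<le> \<bar>z 0 - \<theta> j\<bar> + \<bar>z 0 - \<theta> (Suc j)\<bar>" by linarith
      qed (use h \<delta> in auto)
      ultimately have "h * (\<delta> * (B / 3)) - h * \<delta>\<^sup>2 \<le> ?f j + ?f (Suc j)" by (simp add: algebra_simps)
      moreover have "h * (\<delta> * (B / 3)) - h * \<delta>\<^sup>2 = h * B\<^sup>2 * (5 / 192)"
        by (simp add: \<delta>_def power2_eq_square field_simps)
      moreover have "h * B\<^sup>2 * (1 / 50) \<le> h * B\<^sup>2 * (5 / 192)" using h by (intro mult_left_mono) auto
      ultimately show ?thesis by linarith
    qed
    have nn: "0 \<le> ?f j" for j by (intro huber_nonneg[OF D h \<delta>])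
    have "h * B\<^sup>2 / 50 \<le> (\<Sum>j\<in>?\<Theta>. ?f j)"
    proof (cases "x 0 \<ge> \<theta> 1 + \<delta>")
      case True
      then have "?A 0 () x = ?A 1 () x"
        using B by (auto simp: huber_grad_def ramp_def \<theta>_def \<delta>_def)
      then show ?thesis using pair[of 0] nn[of 2] nn[of 3] by simp
    next
      case False
      then have "?A 2 () x = ?A 3 () x"
        using B by (auto simp: huber_grad_def ramp_def \<theta>_def \<delta>_def)
      then show ?thesis using pair[of 2] nn[of 0] nn[of 1] by (simp add: eval_nat_numeral)
    qed
    then have "ennreal (4 * (H * B\<^sup>2 / 400)) \<le> ennreal (\<Sum>j\<in>?\<Theta>. ?f j)"
      by (intro ennreal_leI) (simp add: h_def)
    also have "ennreal (4 * (H * B\<^sup>2 / 400)) = of_nat (card ?\<Theta>) * ennreal (H * B\<^sup>2 / 400)"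
      using H by (subst ennreal_mult) simp_all
    also have "ennreal (\<Sum>j\<in>?\<Theta>. ?f j) = (\<Sum>j\<in>?\<Theta>. ennreal (?f j))" using nn by (intro sum_ennreal[symmetric]) auto
    finally show "of_nat (card ?\<Theta>) * ennreal (H * B\<^sup>2 / 400) \<le> (\<Sum>j\<in>?\<Theta>. \<integral>\<^sup>+\<omega>.
        ennreal (huber h \<delta> (\<theta> j) (X (\<xi>, transcript_of 1 1 1 Q (\<lambda>i. ?A j (\<omega> i)) \<xi>)) - min_value D (huber h \<delta> (\<theta> j)))
        \<partial>noise 1 1 1 (return_pmf ()))"
      by (simp add: min_value_huber[OF D h \<delta>])
  qed (auto intro!: huber_measurable[OF D h \<delta>] huber_grad_measurable[OF D h \<delta>] sg_oracle_huber[OF D h \<delta>])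
qed

section \<open>Choice of the parameters\<close>

lemma progress_le: assumes "0 < M" shows "progress M K \<omega> R \<le> K * R"
proof -
  have "card {k. k < K \<and> snd (\<omega> (m, k, r))} \<le> card {..<K}" for r m
    by (intro card_mono) auto
  then have "Max (reveals K \<omega> r ` {..<M}) \<le> K" for r
    using assms by (intro Max.boundedI) (auto simp: reveals_def)
  then have "progress M K \<omega> R \<le> (\<Sum>r<R. K)" unfolding progress_def by (intro sum_mono)
  then show ?thesis by (simp add: mult.commute)
qed

text \<open>\<open>416 = 16 * 26\<close> comes from \<open>16 * A * N\<close> in the union bound
  with \<open>N \<le> 26 * (K * R)\<close>. As \<open>416 \<le> 2 ^ 9\<close>, it can be absorbed
  into the logarithm once \<open>x\<close> is at least \<open>2\<close>; this is why a single query
  is treated separately.\<close>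

lemma ln_mult_le:
  assumes "2 \<le> (x :: real)" shows "ln (416 * x) \<le> 10 * ln x"
proof -
  have "(2 :: real) ^ 9 \<le> x ^ 9" using assms by (intro power_mono) auto
  then have "416 * x \<le> x ^ 9 * x" using assms by (intro mult_right_mono) auto
  also have "x ^ 9 * x = x ^ 10" by (simp flip: power_Suc2)
  finally have "ln (416 * x) \<le> ln (x ^ 10)" using assms by (intro ln_mono) auto
  then show ?thesis using assms by (simp add: ln_realpow)
qed

lemma lower_bound_mono:
  assumes "\<exists>F\<in>C. \<exists>Orc. P F Orc \<and> ennreal a \<le> E F Orc" "b \<le> a"
  shows "\<exists>F\<in>C. \<exists>Orc. P F Orc \<and> ennreal b \<le> E F Orc"
  using assms by (blast intro: order_trans[OF ennreal_leI])

text \<open>Common to the first and the third term, which differ in the length \<open>N\<close>, the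
  reveal probability \<open>p\<close> and the scale \<open>h\<close>.\<close>

lemma optimization_lower_bound:
  fixes S :: "'s measure" and M K R D N :: nat
  assumes alg: "ic_algorithm D M K R S Q X" and qb: "queries_bounded D M K R H B \<sigma> \<gamma> S Q"
    and MKR: "2 \<le> M * K * R" and N: "0 < N" "N \<le> 26 * (K * R)"
    and pos: "0 < H" "0 < B" "0 < \<sigma>" "0 < \<gamma>"
    and D1: "20000 * real (K * R) \<le> D"
    and D2: "20000 * (H\<^sup>2 * \<gamma>\<^sup>2 * real (K * R) * real (M * K * R) / \<sigma>\<^sup>2 * ln (real M * (real K)\<^sup>2 * (real R)\<^sup>2)) \<le> D"
    and h: "0 < h" "4 * h \<le> H" and p: "0 < p" "p \<le> 1"
    and hp: "(1 / p - 1) * (h\<^sup>2 * B\<^sup>2 / real N ^ 3) \<le> \<sigma>\<^sup>2 / 2"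
    and pr: "\<And>q. 0 < q \<Longrightarrow> q \<le> 1 \<Longrightarrow>
      measure_pmf.prob (noise M K R (coins q p)) {\<omega>. N < 2 * progress M K \<omega> R} \<le> 1 / 8"
  shows "\<exists>F\<in>F0_class D H B. \<exists>Orc. sg_oracle D F \<sigma> Orc \<and>
    expected_suboptimality D M K R S Q X Orc F \<ge> ennreal (h * B\<^sup>2 / (8 * (real N)\<^sup>2))"
proof -
  \<comment> \<open>\<open>q\<close> keeps the probability of any correction at most
    \<open>1 / 8\<close>, \<open>t\<close> solves
    \<open>2 * A * N * exp (- t\<^sup>2 / 2) = 1 / 8\<close>, and \<open>\<delta>\<close> satisfies
    \<open>\<delta>\<^sup>2 * N ^ 3 = B\<^sup>2\<close>.\<close>
  define A where "A = real (M * K * R)"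
  define \<Lambda> where "\<Lambda> = ln (real M * (real K)\<^sup>2 * (real R)\<^sup>2)"
  define n where "n = D div N"
  define q where "q = 1 / (8 * A)"
  define t where "t = sqrt (2 * ln (16 * A * N))"
  define \<delta> where "\<delta> = B / sqrt (real N ^ 3)"
  have A: "2 \<le> A" unfolding A_def using MKR by linarith
  have KR: "1 \<le> K * R" "1 \<le> M" using MKR by (auto simp: Suc_le_eq intro!: Nat.gr0I)
  have \<delta>2: "\<delta>\<^sup>2 = B\<^sup>2 / real N ^ 3" using N by (simp add: \<delta>_def power_divide)
  have AN: "16 < 16 * A * N" using A N by (smt (verit) mult_less_cancel_left_pos mult_le_cancel_left1 of_nat_0_less_iff of_nat_less_1_iff not_less_eq less_one mult.assoc)
  have t2: "t\<^sup>2 = 2 * ln (16 * A * N)" using AN by (simp add: t_def)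
  have t: "0 < t" using AN by (simp add: t_def)
  have "N \<le> D" using N D1 KR by linarith
  then have n: "0 < n" using N by (simp add: n_def div_greater_zero_iff)
  \<comment> \<open>Rounding down \<open>D / N\<close> loses at most a factor \<open>2\<close>; with
    \<open>N \<le> 26 * (K * R)\<close> this gives the \<open>52\<close> below.\<close>
  have "D < N * (n + 1)" unfolding n_def using N by (metis Suc_eq_plus1 dividend_less_times_div mult_Suc_right add.commute)
  also have "\<dots> \<le> N * (2 * n)" using n by (intro mult_left_mono) auto
  also have "\<dots> \<le> 26 * (K * R) * (2 * n)" using N by (intro mult_right_mono) auto
  finally have "real D \<le> real (26 * (K * R) * (2 * n))" by (simp only: of_nat_le_iff less_imp_le)
  then have Dn: "real D \<le> 52 * real (K * R) * real n" by simp
  have x2: "2 \<le> real M * (real K)\<^sup>2 * (real R)\<^sup>2"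
  proof -
    have "2 * 1 \<le> (M * K * R) * (K * R)" using MKR KR by (intro mult_mono) auto
    then have "2 \<le> real ((M * K * R) * (K * R))" by linarith
    then show ?thesis by (simp add: power2_eq_square mult_ac)
  qed
  have \<Lambda>: "ln (16 * A * N) \<le> 10 * \<Lambda>"
  proof -
    have "real N \<le> 26 * real (K * R)" using N by linarith
    then have "16 * A * N \<le> 16 * A * (26 * real (K * R))" using A by (intro mult_left_mono) auto
    also have "\<dots> = 416 * (real M * (real K)\<^sup>2 * (real R)\<^sup>2)" by (simp add: A_def power2_eq_square mult_ac)
    finally have "ln (16 * A * N) \<le> ln (416 * (real M * (real K)\<^sup>2 * (real R)\<^sup>2))"
      using AN by (intro ln_mono) auto
    then show ?thesis using ln_mult_le[OF x2] by (simp add: \<Lambda>_def)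
  qed
  define Z where "Z = H\<^sup>2 * \<gamma>\<^sup>2 * A / \<sigma>\<^sup>2"
  have Z: "0 < Z" using pos A by (simp add: Z_def)
  have "real (K * R) * (20000 * Z * \<Lambda>) \<le> real (K * R) * (52 * real n)"
    using D2 Dn by (simp add: Z_def A_def \<Lambda>_def mult_ac)
  then have "20000 * Z * \<Lambda> \<le> 52 * real n" using KR by (simp add: mult_le_cancel_left)
  moreover have "Z * ln (16 * A * N) \<le> Z * (10 * \<Lambda>)" using Z \<Lambda> by (intro mult_left_mono) auto
  moreover have "0 \<le> Z * \<Lambda>" using Z x2 by (simp add: \<Lambda>_def)
  \<comment> \<open>The dimension constant has to be at least \<open>52 * 320\<close>, where
    \<open>320 = 32 * 10\<close> combines the noise bound with the comparison of the
    logarithms.\<close>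
  ultimately have Zn: "32 * (Z * ln (16 * A * N)) \<le> real n" by simp
  have noise: "16 * h\<^sup>2 * t\<^sup>2 * \<gamma>\<^sup>2 / n / q \<le> \<sigma>\<^sup>2 / 2"
  proof -
    have "(4 * h)\<^sup>2 \<le> H\<^sup>2" using h by (intro power_mono) auto
    then have "16 * h\<^sup>2 * (t\<^sup>2 * \<gamma>\<^sup>2 / n / q) \<le> H\<^sup>2 * (t\<^sup>2 * \<gamma>\<^sup>2 / n / q)"
      using A by (intro mult_right_mono) (auto simp: power_mult_distrib q_def)
    also have "\<dots> = 16 * (Z * ln (16 * A * N)) * \<sigma>\<^sup>2 / n"
      using pos A n by (simp add: t2 q_def Z_def field_simps)
    also have "\<dots> \<le> \<sigma>\<^sup>2 / 2"
      using Zn n mult_right_mono[OF Zn, of "\<sigma>\<^sup>2"] by (simp add: field_simps)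
    finally show ?thesis by simp
  qed
  note hH = h(2)
  interpret hidden_chain D N n h \<delta> \<gamma> t p q
    by unfold_locales (use N n h p t pos A in \<open>auto simp: n_def \<delta>_def q_def\<close>)
  have "h * B\<^sup>2 / (8 * (real N)\<^sup>2) \<le> real N * h * \<delta>\<^sup>2 / 8"
    unfolding \<delta>2 using N by (simp add: power2_eq_square power3_eq_cube)
  moreover have "\<exists>F\<in>F0_class D H B. \<exists>Orc. sg_oracle D F \<sigma> Orc \<and>
    expected_suboptimality D M K R S Q X Orc F \<ge> ennreal (real N * h * \<delta>\<^sup>2 / 8)"
  proof (rule chain_lower_bound[OF alg qb hH])
    show "\<delta>\<^sup>2 * real N ^ 3 \<le> B\<^sup>2" using N by (simp add: \<delta>2)
    show "16 * h\<^sup>2 * t\<^sup>2 * \<gamma>\<^sup>2 / n / q + (1 / p - 1) * (h * \<delta>)\<^sup>2 \<le> \<sigma>\<^sup>2"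
    proof -
      have "(h * \<delta>)\<^sup>2 = h\<^sup>2 * B\<^sup>2 / real N ^ 3" by (simp add: power_mult_distrib \<delta>2)
      with noise hp show ?thesis by (simp only:)
    qed
    have "exp (- t\<^sup>2 / 2) = 1 / (16 * A * N)" using AN by (simp add: t2 exp_minus inverse_eq_divide)
    then show "2 * real (M * K * R) * real N * exp (- t\<^sup>2 / 2) \<le> 1 / 8"
      using A N unfolding A_def[symmetric] by simp
    show "real (M * K * R) * q \<le> 1 / 8" using A unfolding A_def[symmetric] by (simp add: q_def)
    show "measure_pmf.prob (noise M K R (coins q p)) {\<omega>. N < 2 * progress M K \<omega> R} \<le> 1 / 8"
      using q by (rule pr)
  qed (use pos in simp)
  ultimately show ?thesis by (rule lower_bound_mono[rotated])
qed

lemma statistical_term: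
  fixes S :: "'s measure" and M K R D :: nat
  assumes alg: "ic_algorithm D M K R S Q X" and qb: "queries_bounded D M K R H B \<sigma> \<gamma> S Q"
    and MKR: "0 < M * K * R" and D: "0 < D" and pos: "0 < H" "0 < B" "0 < \<sigma>"
  shows "\<exists>F\<in>F0_class D H B. \<exists>Orc. sg_oracle D F \<sigma> Orc \<and>
    expected_suboptimality D M K R S Q X Orc F \<ge>
      ennreal (min (\<sigma> * B / sqrt (real M * real K * real R)) (H * B\<^sup>2) / 16)"
proof -
  define A where "A = real (M * K * R)"
  \<comment> \<open>No correction happens with probability at least \<open>1 / 2\<close>, and
    \<open>h\<close> is the largest scale allowed by smoothness and by the variance
    \<open>(h * B)\<^sup>2 / q\<close>.\<close>
  define q where "q = 1 / (2 * A)"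
  define h where "h = min (H / 4) (\<sigma> * sqrt q / B)"
  have A: "1 \<le> A" unfolding A_def using MKR by linarith
  then have q: "0 < q" "q \<le> 1" by (auto simp: q_def)
  have h: "0 < h" using pos q by (simp add: h_def)
  interpret chain D 1 1 h B by unfold_locales (use D h pos in auto)
  have "\<exists>F\<in>F0_class D H B. \<exists>Orc. sg_oracle D F \<sigma> Orc \<and>
    expected_suboptimality D M K R S Q X Orc F \<ge> ennreal (h * B\<^sup>2 / 4)"
  proof (rule statistical_lower_bound[OF alg qb refl _ _ _ q])
    show "real (M * K * R) * q \<le> 1 / 2" unfolding A_def[symmetric] using A by (simp add: q_def)
    have "h * B \<le> \<sigma> * sqrt q / B * B" unfolding h_def using pos by (intro mult_right_mono) auto
    then have "(h * B)\<^sup>2 \<le> (\<sigma> * sqrt q)\<^sup>2" using h pos by (intro power_mono) auto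
    then show "(h * B)\<^sup>2 / q \<le> \<sigma>\<^sup>2" using q by (simp add: power_mult_distrib field_simps)
  qed (use pos in \<open>auto simp: h_def\<close>)
  moreover have "min (\<sigma> * B / sqrt A) (H * B\<^sup>2) / 16 \<le> h * B\<^sup>2 / 4"
  proof (cases "H / 4 \<le> \<sigma> * sqrt q / B")
    case True
    then have "H * B\<^sup>2 / 16 = h * B\<^sup>2 / 4" by (simp add: h_def)
    moreover have "min (\<sigma> * B / sqrt A) (H * B\<^sup>2) / 16 \<le> H * B\<^sup>2 / 16" by (intro divide_right_mono) auto
    ultimately show ?thesis by (rule ord_le_eq_trans[rotated])
  next
    case False
    have "sqrt A * sqrt 2 \<le> sqrt A * 4"
      using A by (intro mult_left_mono) (auto intro: real_le_lsqrt)
    then have "1 / (sqrt A * 4) \<le> sqrt q"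
      using A by (simp add: q_def real_sqrt_divide real_sqrt_mult frac_le mult.commute)
    then have "\<sigma> * B * (1 / (sqrt A * 4)) \<le> \<sigma> * B * sqrt q" using pos by (intro mult_left_mono) auto
    moreover have "h * B\<^sup>2 = \<sigma> * B * sqrt q" using False pos by (simp add: h_def power2_eq_square)
    moreover have "\<sigma> * B / sqrt A / 16 = \<sigma> * B * (1 / (sqrt A * 4)) / 4" by simp
    ultimately have "\<sigma> * B / sqrt A / 16 \<le> h * B\<^sup>2 / 4" by (simp only: divide_right_mono)
    then show ?thesis by (rule order_trans[OF divide_right_mono[OF min.cobounded1], rotated]) simp
  qed
  moreover have "real M * real K * real R = A" by (simp add: A_def)
  ultimately show ?thesis by (simp only: lower_bound_mono)
qed

lemma sequential_term:
  fixes S :: "'s measure" and M K R D :: nat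
  assumes alg: "ic_algorithm D M K R S Q X" and qb: "queries_bounded D M K R H B \<sigma> \<gamma> S Q"
    and MKR: "2 \<le> M * K * R" and pos: "0 < H" "0 < B" "0 < \<sigma>" "0 < \<gamma>"
    and D1: "20000 * real (K * R) \<le> D"
    and D2: "20000 * (H\<^sup>2 * \<gamma>\<^sup>2 * real (K * R) * real (M * K * R) / \<sigma>\<^sup>2 * ln (real M * (real K)\<^sup>2 * (real R)\<^sup>2)) \<le> D"
  shows "\<exists>F\<in>F0_class D H B. \<exists>Orc. sg_oracle D F \<sigma> Orc \<and>
    expected_suboptimality D M K R S Q X Orc F \<ge> ennreal (H * B\<^sup>2 / ((real K)\<^sup>2 * (real R)\<^sup>2) / 128)"
proof -
  have pr: "0 < M" "0 < K * R" using MKR by (auto intro!: Nat.gr0I)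
  have eq: "H * B\<^sup>2 / ((real K)\<^sup>2 * (real R)\<^sup>2) / 128 = H / 4 * B\<^sup>2 / (8 * (real (2 * (K * R)))\<^sup>2)"
    by (simp add: power_mult_distrib)
  show ?thesis
    unfolding eq
  proof (rule optimization_lower_bound[OF alg qb MKR _ _ pos D1 D2, where p = 1])
    \<comment> \<open>Even if every query reveals a block, only \<open>K * R\<close> blocks are
      reached, half of the chain.\<close>
    have "{\<omega>. 2 * (K * R) < 2 * progress M K \<omega> R} = {}"
      using progress_le[OF pr(1), of K _ R] by (auto simp: not_less)
    then show "measure_pmf.prob (noise M K R (coins q 1)) {\<omega>. 2 * (K * R) < 2 * progress M K \<omega> R} \<le> 1 / 8" for q
      by simp
  qed (use pr pos in auto)
qed

lemma round_term:
  fixes S :: "'s measure" and M K R D :: nat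
  assumes alg: "ic_algorithm D M K R S Q X" and qb: "queries_bounded D M K R H B \<sigma> \<gamma> S Q"
    and MKR: "2 \<le> M * K * R" and pos: "0 < H" "0 < B" "0 < \<sigma>" "0 < \<gamma>"
    and D1: "20000 * real (K * R) \<le> D"
    and D2: "20000 * (H\<^sup>2 * \<gamma>\<^sup>2 * real (K * R) * real (M * K * R) / \<sigma>\<^sup>2 * ln (real M * (real K)\<^sup>2 * (real R)\<^sup>2)) \<le> D"
    and K: "1 + ln (real M) \<le> K"
  shows "\<exists>F\<in>F0_class D H B. \<exists>Orc. sg_oracle D F \<sigma> Orc \<and>
    expected_suboptimality D M K R S Q X Orc F \<ge>
      ennreal (min (\<sigma> * B / sqrt (real K * real R)) (H * B\<^sup>2 / ((real R)\<^sup>2 * (1 + ln (real M))\<^sup>2)) / 5408)"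
proof -
  have MKRpos: "1 \<le> M" "1 \<le> K" "1 \<le> R" using MKR by (auto simp: Suc_le_eq intro!: Nat.gr0I)
  \<comment> \<open>\<open>L\<close> is the expected number of reveal coins of one machine over all
    rounds. With \<open>N\<close> about \<open>12 * L\<close>, the term \<open>N / 2\<close> in the
    tail bound beats both \<open>M ^ R \<le> exp L\<close> and twice the mean, leaving
    \<open>exp (- 3 * L)\<close>.\<close>
  define l where "l = 1 + ln (real M)"
  define L where "L = real R * l"
  define p where "p = l / K"
  define N where "N = nat \<lceil>12 * L\<rceil>"
  \<comment> \<open>The largest scale allowed by smoothness and by half of the variance
    budget.\<close>
  define h where "h = min (H / 4) (\<sigma> * sqrt (p / 2) * sqrt (real N ^ 3) / B)"
  have l: "1 \<le> l" using MKRpos by (simp add: l_def)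
  have L: "1 \<le> L" unfolding L_def using MKRpos l by (metis mult_mono mult_1 of_nat_0_le_iff of_nat_1 of_nat_le_iff zero_le_one)
  have "l \<le> K" using K by (simp add: l_def)
  then have p: "0 < p" "p \<le> 1" using l MKRpos by (auto simp: p_def)
  have pKR: "p * real (K * R) = L" using MKRpos by (simp add: p_def L_def)
  have N: "12 * L \<le> N" "N \<le> 13 * L"
  proof -
    have "real N = of_int \<lceil>12 * L\<rceil>" using L by (simp add: N_def)
    then show "12 * L \<le> N" "N \<le> 13 * L" using L ceiling_correct[of "12 * L"] by auto
  qed
  have N0: "0 < N" using N L by (intro Nat.gr0I) auto
  have "L \<le> real (K * R)" using pKR p(2) mult_right_mono[OF p(2), of "real (K * R)"] by simp
  then have N26: "N \<le> 26 * (K * R)" using N(2) by linarith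
  have h: "0 < h" "4 * h \<le> H" using pos p N0 by (auto simp: h_def)
  have "\<exists>F\<in>F0_class D H B. \<exists>Orc. sg_oracle D F \<sigma> Orc \<and>
    expected_suboptimality D M K R S Q X Orc F \<ge> ennreal (h * B\<^sup>2 / (8 * (real N)\<^sup>2))"
  proof (rule optimization_lower_bound[OF alg qb MKR N0 N26 pos D1 D2 h p])
    have "h * B \<le> \<sigma> * sqrt (p / 2) * sqrt (real N ^ 3) / B * B"
      unfolding h_def using pos by (intro mult_right_mono) auto
    then have "(h * B)\<^sup>2 \<le> (\<sigma> * sqrt (p / 2) * sqrt (real N ^ 3))\<^sup>2" using h pos by (intro power_mono) auto
    then have "h\<^sup>2 * B\<^sup>2 / real N ^ 3 \<le> \<sigma>\<^sup>2 * p / 2"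
      using p N0 by (simp add: power_mult_distrib field_simps)
    then have "1 / p * (h\<^sup>2 * B\<^sup>2 / real N ^ 3) \<le> 1 / p * (\<sigma>\<^sup>2 * p / 2)" using p by (intro mult_left_mono) auto
    moreover have "(1 / p - 1) * (h\<^sup>2 * B\<^sup>2 / real N ^ 3) \<le> 1 / p * (h\<^sup>2 * B\<^sup>2 / real N ^ 3)"
      by (intro mult_right_mono) auto
    moreover have "1 / p * (\<sigma>\<^sup>2 * p / 2) = \<sigma>\<^sup>2 / 2" using p by simp
    ultimately show "(1 / p - 1) * (h\<^sup>2 * B\<^sup>2 / real N ^ 3) \<le> \<sigma>\<^sup>2 / 2" by linarith
    fix q
    have "real M ^ R = exp (real R * ln (real M))" using MKRpos by (simp add: exp_of_nat_mult)
    also have "\<dots> \<le> exp L" using MKRpos by (simp add: L_def l_def distrib_left)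
    finally have M: "real M ^ R \<le> exp L" .
    have "measure_pmf.prob (noise M K R (coins q p)) {\<omega>. N < 2 * progress M K \<omega> R}
        \<le> real M ^ R * exp (2 * p * real (K * R) - real N / 2)"
      using p MKRpos by (intro progress_tail) auto
    also have "\<dots> \<le> exp L * exp (2 * L - 6 * L)"
      using M N pKR by (intro mult_mono) (auto simp: mult.assoc)
    also have "\<dots> \<le> exp (- 3)" using L by (simp add: exp_add[symmetric])
    also have "\<dots> \<le> 1 / 8"
    proof -
      have "(2 :: real) ^ 3 \<le> exp 1 ^ 3" using exp_ge_add_one_self[of 1] by (intro power_mono) auto
      also have "\<dots> = exp 3" using exp_of_nat_mult[of 3 "1 :: real"] by simp
      finally show ?thesis by (simp add: exp_minus field_simps)
    qed
    finally show "measure_pmf.prob (noise M K R (coins q p)) {\<omega>. N < 2 * progress M K \<omega> R} \<le> 1 / 8" .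
  qed
  moreover have "min (\<sigma> * B / sqrt (real K * real R)) (H * B\<^sup>2 / ((real R)\<^sup>2 * l\<^sup>2)) / 5408 \<le> h * B\<^sup>2 / (8 * (real N)\<^sup>2)"
  proof (cases "H / 4 \<le> \<sigma> * sqrt (p / 2) * sqrt (real N ^ 3) / B")
    case True
    have "(real N)\<^sup>2 \<le> (13 * L)\<^sup>2" using N by (intro power_mono) auto
    then have "H * B\<^sup>2 / (32 * (13 * L)\<^sup>2) \<le> H * B\<^sup>2 / (32 * (real N)\<^sup>2)"
      using pos N0 L by (intro divide_left_mono mult_left_mono) (auto intro!: mult_pos_pos)
    moreover have "h * B\<^sup>2 / (8 * (real N)\<^sup>2) = H * B\<^sup>2 / (32 * (real N)\<^sup>2)" using True by (simp add: h_def)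
    ultimately have "H * B\<^sup>2 / ((real R)\<^sup>2 * l\<^sup>2) / 5408 \<le> h * B\<^sup>2 / (8 * (real N)\<^sup>2)"
      by (simp add: L_def power_mult_distrib)
    then show ?thesis by (rule order_trans[OF divide_right_mono[OF min.cobounded2], rotated]) simp
  next
    case False
    have "h * B\<^sup>2 / (8 * (real N)\<^sup>2) = \<sigma> * B * (sqrt (p / 2) * sqrt (real N ^ 3) / (8 * (real N)\<^sup>2))"
      using False pos by (simp add: h_def power2_eq_square)
    also have "sqrt (p / 2) * sqrt (real N ^ 3) / (8 * (real N)\<^sup>2) = sqrt (p / (2 * real N)) / 8"
      using N0 by (simp add: power3_eq_cube power2_eq_square real_sqrt_mult real_sqrt_divide field_simps)
    finally have e: "h * B\<^sup>2 / (8 * (real N)\<^sup>2) = \<sigma> * B * (sqrt (p / (2 * real N)) / 8)" .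
    \<comment> \<open>The factor \<open>l\<close> of \<open>p\<close> cancels against
      \<open>N\<close>, which is of order \<open>R * l\<close>. The bound is weakened from
      \<open>26\<close> to \<open>676 = 26\<^sup>2\<close> for a rational root; the other case, with
      \<open>5408 = 32 * 13\<^sup>2\<close>, has the worse constant anyway.\<close>
    have "1 / (676 * (real K * real R)) \<le> p / (2 * real N)"
    proof -
      have "2 * real N \<le> 26 * L" using N by simp
      then have "p / (26 * L) \<le> p / (2 * real N)" using p N0 L by (intro divide_left_mono) auto
      moreover have "p / (26 * L) = 1 / (26 * (real K * real R))"
        using p L MKRpos l by (simp add: L_def p_def field_simps)
      moreover have "1 / (676 * (real K * real R)) \<le> 1 / (26 * (real K * real R))"
        using MKRpos by (intro divide_left_mono) auto
      ultimately show ?thesis by linarith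
    qed
    then have "sqrt (1 / (676 * (real K * real R))) \<le> sqrt (p / (2 * real N))" by (rule real_sqrt_le_mono)
    moreover have "sqrt (1 / (676 * (real K * real R))) = 1 / (26 * sqrt (real K * real R))"
    proof -
      have "sqrt 676 = (26 :: real)" by (rule real_sqrt_unique) auto
      then show ?thesis by (simp add: real_sqrt_divide real_sqrt_mult)
    qed
    ultimately have "\<sigma> * B * (1 / (26 * sqrt (real K * real R)) / 8) \<le> h * B\<^sup>2 / (8 * (real N)\<^sup>2)"
      unfolding e using pos by (intro mult_left_mono divide_right_mono) auto
    moreover have "\<sigma> * B / sqrt (real K * real R) * (1 / 5408) \<le> \<sigma> * B / sqrt (real K * real R) * (1 / 208)"
      using pos by (intro mult_left_mono) auto
    ultimately have "\<sigma> * B / sqrt (real K * real R) / 5408 \<le> h * B\<^sup>2 / (8 * (real N)\<^sup>2)" by simp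
    then show ?thesis by (rule order_trans[OF divide_right_mono[OF min.cobounded1], rotated]) simp
  qed
  ultimately show ?thesis unfolding l_def by (rule lower_bound_mono)
qed

lemma lower_bound:
  fixes S :: "'s measure" and M K R D :: nat
  assumes MKR: "1 \<le> M" "1 \<le> K" "1 \<le> R" and pos: "0 < H" "0 < B" "0 < \<sigma>" "0 < \<gamma>"
    and D: "real D \<ge> 20000 * (real K * real R
      + (\<gamma>\<^sup>2 * real K * real R / B\<^sup>2
         + H\<^sup>2 * \<gamma>\<^sup>2 * real K * real R
             * (sqrt \<sigma> * real K * real R / sqrt (H * B) + real M * real K * real R) / \<sigma>\<^sup>2)
        * ln (real M * (real K)\<^sup>2 * (real R)\<^sup>2))"
    and alg: "ic_algorithm D M K R S Q X" and qb: "queries_bounded D M K R H B \<sigma> \<gamma> S Q"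
  shows "\<exists>F\<in>F0_class D H B. \<exists>Orc. sg_oracle D F \<sigma> Orc \<and>
          expected_suboptimality D M K R S Q X Orc F \<ge>
            ennreal (1 / 20000 * (H * B\<^sup>2 / ((real K)\<^sup>2 * (real R)\<^sup>2)
              + min (\<sigma> * B / sqrt (real M * real K * real R)) (H * B\<^sup>2)
              + min (\<sigma> * B / sqrt (real K * real R))
                    (H * B\<^sup>2 / ((real R)\<^sup>2 * (1 + ln (real M))\<^sup>2))))"
proof -
  define \<Lambda> where "\<Lambda> = ln (real M * (real K)\<^sup>2 * (real R)\<^sup>2)"
  define T1 where "T1 = H * B\<^sup>2 / ((real K)\<^sup>2 * (real R)\<^sup>2)"
  define T2 where "T2 = min (\<sigma> * B / sqrt (real M * real K * real R)) (H * B\<^sup>2)"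
  define T3 where "T3 = min (\<sigma> * B / sqrt (real K * real R)) (H * B\<^sup>2 / ((real R)\<^sup>2 * (1 + ln (real M))\<^sup>2))"
  have "1 * 1 \<le> real M * (real K)\<^sup>2" using MKR by (intro mult_mono) auto
  then have "1 * 1 \<le> real M * (real K)\<^sup>2 * (real R)\<^sup>2" using MKR by (intro mult_mono) auto
  then have \<Lambda>: "0 \<le> \<Lambda>" by (simp add: \<Lambda>_def)
  have T1: "0 \<le> T1" using pos by (simp add: T1_def)
  let ?ok = "\<lambda>b. \<exists>F\<in>F0_class D H B. \<exists>Orc. sg_oracle D F \<sigma> Orc \<and>
          expected_suboptimality D M K R S Q X Orc F \<ge> ennreal b"
  have mono: "?ok b" if "?ok a" "b \<le> a" for a b
    using that by (rule lower_bound_mono)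
  have D1: "20000 * real (K * R) \<le> D"
    and D2: "20000 * (H\<^sup>2 * \<gamma>\<^sup>2 * real (K * R) * real (M * K * R) / \<sigma>\<^sup>2 * \<Lambda>) \<le> D"
  proof -
    define a b c where "a = \<gamma>\<^sup>2 * real K * real R / B\<^sup>2 * \<Lambda>"
      and "b = H\<^sup>2 * \<gamma>\<^sup>2 * real K * real R * (sqrt \<sigma> * real K * real R / sqrt (H * B)) / \<sigma>\<^sup>2 * \<Lambda>"
      and "c = H\<^sup>2 * \<gamma>\<^sup>2 * real (K * R) * real (M * K * R) / \<sigma>\<^sup>2 * \<Lambda>"
    have nn: "0 \<le> a" "0 \<le> b" "0 \<le> c" using pos \<Lambda> by (auto simp: a_def b_def c_def)
    have "20000 * (real (K * R) + (a + (b + c))) \<le> D"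
      using D unfolding a_def b_def c_def \<Lambda>_def[symmetric]
      by (simp add: distrib_left distrib_right add_divide_distrib mult_ac)
    then show "20000 * real (K * R) \<le> D" "20000 * c \<le> D"
      using nn of_nat_0_le_iff[of "K * R"] by (simp_all only: distrib_left) 
  qed
  have "1 \<le> real (K * R)" using MKR by (metis mult_le_mono nat_mult_1 of_nat_1 of_nat_le_iff)
  then have D0: "0 < D" using D1 by (intro Nat.gr0I) auto
  have "?ok (1 / 20000 * (T1 + T2 + T3))"
  proof (cases "M * K * R = 1")
    case True
    then have one: "M = 1" "K = 1" "R = 1" by auto
    have le: "1 / 20000 * s \<le> c / 400" if "s \<le> 3 * c" "0 < c" for s c :: real
      using that by simp
    have HB: "0 < H * B\<^sup>2" using pos by simp
    have "?ok (H * B\<^sup>2 / 400)"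
      using single_query_lower_bound[of D S Q X H B \<sigma> \<gamma>] alg qb D0 pos unfolding one by blast
    \<comment> \<open>For a single query each of the three terms is at most
      \<open>H * B\<^sup>2\<close>.\<close>
    moreover have "T1 + T2 + T3 \<le> 3 * (H * B\<^sup>2)" unfolding T1_def T2_def T3_def one by simp
    then have "1 / 20000 * (T1 + T2 + T3) \<le> H * B\<^sup>2 / 400" using HB le[of "T1 + T2 + T3" "H * B\<^sup>2"] by blast
    ultimately show ?thesis by (rule mono)
  next
    case False
    moreover have "0 < M * K * R" using MKR by simp
    ultimately have MKR2: "2 \<le> M * K * R" by linarith
    have ok1: "?ok (T1 / 128)"
      unfolding T1_def by (rule sequential_term[OF alg qb MKR2 pos D1 D2[unfolded \<Lambda>_def]])
    have ok2: "?ok (T2 / 16)"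
      unfolding T2_def by (rule statistical_term[OF alg qb \<open>0 < M * K * R\<close> D0 pos(1-3)])
    \<comment> \<open>The reveal probability \<open>(1 + ln M) / K\<close> must not exceed
      \<open>1\<close>; where it would, the third term is covered by the first.\<close>
    have ok3: "?ok (T3 / 5408) \<or> T3 \<le> T1"
    proof (cases "1 + ln (real M) \<le> K")
      case True
      then show ?thesis
        unfolding T3_def using round_term[OF alg qb MKR2 pos D1 D2[unfolded \<Lambda>_def]] by blast
    next
      case False
      have "0 \<le> ln (real M)" using MKR by simp
      have "(real K)\<^sup>2 \<le> (1 + ln (real M))\<^sup>2" using False by (intro power_mono) auto
      then have "H * B\<^sup>2 / ((real R)\<^sup>2 * (1 + ln (real M))\<^sup>2) \<le> H * B\<^sup>2 / ((real R)\<^sup>2 * (real K)\<^sup>2)"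
        using pos MKR \<open>0 \<le> ln (real M)\<close> by (intro divide_left_mono mult_left_mono) (auto intro!: mult_pos_pos)
      then show ?thesis unfolding T3_def T1_def by (simp add: mult.commute min.coboundedI2)
    qed
    \<comment> \<open>The largest term alone suffices: \<open>20000\<close> exceeds three times each
      of \<open>128\<close>, \<open>16\<close> and \<open>5408\<close>.\<close>
    consider "T2 \<le> T1" "T3 \<le> T1" | "T1 \<le> T2" "T3 \<le> T2" | "T1 < T3" "T2 < T3" by linarith
    then show ?thesis
    proof cases
      case 1
      then show ?thesis using T1 by (intro mono[OF ok1]) simp
    next
      case 2
      then show ?thesis using T1 by (intro mono[OF ok2]) simp
    next
      case 3
      then have "?ok (T3 / 5408)" using ok3 by auto
      then show ?thesis by (rule mono) (use 3 T1 in simp)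
    qed
  qed
  then show ?thesis by (simp only: T1_def T2_def T3_def)
qed

theorem theorem11:
  shows "\<exists>c1>0. \<exists>c2>0. \<forall>M\<ge>1. \<forall>K\<ge>1. \<forall>R\<ge>1. \<forall>H>0. \<forall>B>0. \<forall>\<sigma>>0. \<forall>\<gamma>>0. \<forall>D.
    real D \<ge> c1 * (real K * real R
      + (\<gamma>\<^sup>2 * real K * real R / B\<^sup>2
         + H\<^sup>2 * \<gamma>\<^sup>2 * real K * real R
             * (sqrt \<sigma> * real K * real R / sqrt (H * B) + real M * real K * real R) / \<sigma>\<^sup>2)
        * ln (real M * (real K)\<^sup>2 * (real R)\<^sup>2)) \<longrightarrow>
    (\<forall>(S :: (nat \<Rightarrow> real) measure) Q X.
       ic_algorithm D M K R S Q X \<and> queries_bounded D M K R H B \<sigma> \<gamma> S Q \<longrightarrow>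
       (\<exists>F\<in>F0_class D H B. \<exists>Orc. sg_oracle D F \<sigma> Orc \<and>
          expected_suboptimality D M K R S Q X Orc F \<ge>
            ennreal (c2 * (H * B\<^sup>2 / ((real K)\<^sup>2 * (real R)\<^sup>2)
              + min (\<sigma> * B / sqrt (real M * real K * real R)) (H * B\<^sup>2)
              + min (\<sigma> * B / sqrt (real K * real R))
                    (H * B\<^sup>2 / ((real R)\<^sup>2 * (1 + ln (real M))\<^sup>2))))))"
proof (rule exI[of _ "20000 :: real"], rule conjI, simp, rule exI[of _ "1 / 20000 :: real"], rule conjI, simp,
    intro allI impI)
qed (elim conjE, rule lower_bound; assumption)

end
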